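(* Let $(M,J,\langle\cdot,\cdot\rangle)$ be a Hermite surface, let $\beta\in\mathbb{R}$ with $\beta\neq -1$, and let $\Sigma$ be a closed oriented real surface smoothly immersed in $M$ which is symplectic, i.e. its Kähler angle $\alpha$ satisfies $\cos\alpha>0$. Suppose that the complex structure $J$ satisfies, along $\Sigma$, for all tangent vector fields $X,Y$ of $\Sigma$ and all normal vector fields $\xi$ of $\Sigma$ in $M$, $$\langle(\bar\nabla_{\xi}J)X,Y\rangle+\langle(\bar\nabla_{X}J)Y,\xi\rangle+\langle(\bar\nabla_{Y}J)\xi,X\rangle=0 .$$ Then the Euler–Lagrange equation of the functional $L_\beta=\int_\Sigma\frac{1}{\cos^\beta\alpha}\,d\mu$ is $$\cos^{3}\alpha\,\mathbf{H}-\beta\,\bigl(J(J\nabla\cos\alpha)^{\top}\bigr)^{\bot}=0,$$ that is, $\Sigma$ is a critical point of $L_\beta$ in the class of symplectic surfaces if and only if this equation holds on $\Sigma$.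
   Context: A Hermite surface $(M,J,\langle\cdot,\cdot\rangle)$ is a complex surface (real dimension 4) with complex structure $J$ and Riemannian metric $\langle\cdot,\cdot\rangle$ such that $\langle JU,JV\rangle=\langle U,V\rangle$; its Kähler form is $\omega(U,V)=\langle JU,V\rangle$ (not assumed closed). $\bar\nabla$ is the Levi-Civita connection of $M$. For an oriented surface $\Sigma$ smoothly immersed in $M$, with induced metric $g$ and area element $d\mu=d\mu_\Sigma$, the Kähler angle $\alpha$ is defined by $\omega|_\Sigma=\cos\alpha\,d\mu_\Sigma$. The surface is called symplectic if $\cos\alpha>0$ everywhere. $\nabla\cos\alpha$ is the gradient of $\cos\alpha$ on $(\Sigma,g)$; $(\cdot)^\top$ and $(\cdot)^\bot$ are the projections of $TM|_\Sigma$ onto the tangent and normal bundles of $\Sigma$. The second fundamental form is $B(X,Y)=(\bar\nabla_XY)^\bot$ and the mean curvature vector $\mathbf{H}$ is its trace, $\mathbf{H}=B(e_1,e_1)+B(e_2,e_2)$ for an orthonormal tangent frame. $\Sigma$ is a critical point of $L_\beta$ if $\frac{d}{dt}\big|_{t=0}L_\beta(\phi_t)=0$ for every smooth one-parameter family of immersions $\phi_t:\Sigma\to M$, with $\phi_0$ the given immersion and with variational field $\frac{\partial\phi_t}{\partial t}\big|_{t=0}=\xi$ a normal vector field along $\Sigma$ (for small $t$ the surfaces $\phi_t(\Sigma)$ remain symplectic). *)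

theory Defs
  imports "HOL-Analysis.Analysis"
begin

section \<open>Smooth maps\<close>

text \<open>Used only for open sets \<open>S\<close> and finite-dimensional domains, where existence and continuity of all iterated
  directional derivatives in the constant directions \<open>v\<close> is the usual notion of smoothness.\<close>

primrec C_k_on :: "nat \<Rightarrow> ('a::real_normed_vector \<Rightarrow> 'b::real_normed_vector) \<Rightarrow> 'a set \<Rightarrow> bool" where
  "C_k_on 0 f S \<longleftrightarrow> continuous_on S f"
| "C_k_on (Suc k) f S \<longleftrightarrow>
     (\<forall>x\<in>S. f differentiable (at x)) \<and> (\<forall>v. C_k_on k (\<lambda>x. frechet_derivative f (at x) v) S)"

definition smooth_on :: "('a::real_normed_vector \<Rightarrow> 'b::real_normed_vector) \<Rightarrow> 'a set \<Rightarrow> bool" where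
  "smooth_on f S \<longleftrightarrow> (\<forall>k. C_k_on k f S)"

section \<open>Manifolds\<close>

text \<open>A chart is a pair of its domain and its coordinate map (the values of the latter outside the
  domain are irrelevant). The underlying set of a manifold is a whole type; the Hausdorff and
  second countability axioms are imposed by type classes where the manifold is introduced.\<close>

type_synonym ('m, 'e) chart = "'m set \<times> ('m \<Rightarrow> 'e)"

abbreviation chart_dom :: "('m, 'e) chart \<Rightarrow> 'm set" where "chart_dom \<equiv> fst"
abbreviation chart_map :: "('m, 'e) chart \<Rightarrow> 'm \<Rightarrow> 'e" where "chart_map \<equiv> snd"

definition chart_img :: "('m, 'e) chart \<Rightarrow> 'e set" where
  "chart_img c = chart_map c ` chart_dom c"

definition chart_inv :: "('m, 'e) chart \<Rightarrow> 'e \<Rightarrow> 'm" where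
  "chart_inv c = inv_into (chart_dom c) (chart_map c)"

definition is_chart :: "('m::topological_space, 'e::euclidean_space) chart \<Rightarrow> bool" where
  "is_chart c \<longleftrightarrow> open (chart_dom c) \<and> open (chart_img c) \<and>
     homeomorphism (chart_dom c) (chart_img c) (chart_map c) (chart_inv c)"

definition transition :: "('m, 'e) chart \<Rightarrow> ('m, 'e) chart \<Rightarrow> 'e \<Rightarrow> 'e" where
  "transition c d = chart_map d \<circ> chart_inv c"

definition overlap :: "('m, 'e) chart \<Rightarrow> ('m, 'e) chart \<Rightarrow> 'e set" where
  "overlap c d = chart_map c ` (chart_dom c \<inter> chart_dom d)"

definition smooth_atlas :: "('m::topological_space, 'e::euclidean_space) chart set \<Rightarrow> bool" where
  "smooth_atlas \<A> \<longleftrightarrow> (\<forall>c\<in>\<A>. is_chart c) \<and> (\<Union>c\<in>\<A>. chart_dom c) = UNIV \<and>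
     (\<forall>c\<in>\<A>. \<forall>d\<in>\<A>. smooth_on (transition c d) (overlap c d))"

definition oriented_surface_atlas :: "('s::topological_space, real^2) chart set \<Rightarrow> bool" where
  "oriented_surface_atlas \<A> \<longleftrightarrow> smooth_atlas \<A> \<and>
     (\<forall>c\<in>\<A>. \<forall>d\<in>\<A>. \<forall>x\<in>overlap c d. det (matrix (frechet_derivative (transition c d) (at x))) > 0)"

text \<open>The complex structure of a complex surface acts in every holomorphic chart as multiplication
  by the imaginary unit.\<close>

definition cplx_str :: "complex^2 \<Rightarrow> complex^2" where
  "cplx_str v = \<i> *s v"

text \<open>Holomorphic: smooth with complex linear differential (Cauchy-Riemann equations).\<close>

definition holomorphic_map_on :: "(complex^2 \<Rightarrow> complex^2) \<Rightarrow> (complex^2) set \<Rightarrow> bool" where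
  "holomorphic_map_on f S \<longleftrightarrow> smooth_on f S \<and>
     (\<forall>x\<in>S. \<forall>v. frechet_derivative f (at x) (cplx_str v) = cplx_str (frechet_derivative f (at x) v))"

definition complex_surface_atlas :: "('m::topological_space, complex^2) chart set \<Rightarrow> bool" where
  "complex_surface_atlas \<B> \<longleftrightarrow> smooth_atlas \<B> \<and>
     (\<forall>C\<in>\<B>. \<forall>D\<in>\<B>. holomorphic_map_on (transition C D) (overlap C D))"

text \<open>An arbitrary chart of the atlas around \<open>p\<close>, for quantities independent of that choice.\<close>

definition chart_at :: "('m, 'e) chart set \<Rightarrow> 'm \<Rightarrow> ('m, 'e) chart" where
  "chart_at \<A> p = (SOME c. c \<in> \<A> \<and> p \<in> chart_dom c)"

section \<open>Riemannian metrics and the Levi-Civita connection\<close>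

text \<open>Tensors are given by their components: a tangent vector at \<open>p\<close> is described, in a chart \<open>c\<close>
  around \<open>p\<close>, by an element of the model space, and \<open>g c p u v\<close> is the inner product of the
  tangent vectors at \<open>p\<close> with components \<open>u\<close> and \<open>v\<close> in the chart \<open>c\<close>. The last condition is the
  transformation law under change of charts.\<close>

type_synonym ('m, 'e) metric_tensor = "('m, 'e) chart \<Rightarrow> 'm \<Rightarrow> 'e \<Rightarrow> 'e \<Rightarrow> real"

definition riemannian_metric ::
  "('m::topological_space, 'e::euclidean_space) chart set \<Rightarrow> ('m, 'e) metric_tensor \<Rightarrow> bool" where
  "riemannian_metric \<A> g \<longleftrightarrow>
     (\<forall>c\<in>\<A>. \<forall>u v. smooth_on (\<lambda>x. g c (chart_inv c x) u v) (chart_img c)) \<and>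
     (\<forall>c\<in>\<A>. \<forall>p\<in>chart_dom c. bilinear (g c p) \<and>
        (\<forall>u v. g c p u v = g c p v u) \<and> (\<forall>u. u \<noteq> 0 \<longrightarrow> g c p u u > 0)) \<and>
     (\<forall>c\<in>\<A>. \<forall>d\<in>\<A>. \<forall>p\<in>chart_dom c \<inter> chart_dom d. \<forall>u v.
        g c p u v = g d p (frechet_derivative (transition c d) (at (chart_map c p)) u)
                          (frechet_derivative (transition c d) (at (chart_map c p)) v))"

definition hermite_surface ::
  "('m::topological_space, complex^2) chart set \<Rightarrow> ('m, complex^2) metric_tensor \<Rightarrow> bool" where
  "hermite_surface \<B> G \<longleftrightarrow> complex_surface_atlas \<B> \<and> riemannian_metric \<B> G \<and>
     (\<forall>C\<in>\<B>. \<forall>q\<in>chart_dom C. \<forall>u v. G C q (cplx_str u) (cplx_str v) = G C q u v)"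

definition kahler_form :: "('m, complex^2) metric_tensor \<Rightarrow> ('m, complex^2) metric_tensor" where
  "kahler_form G C q u v = G C q (cplx_str u) v"

text \<open>The connection form (Christoffel symbols) at \<open>p\<close> in the chart \<open>c\<close> of the torsion-free metric
  connection: for constant \<open>u\<close>, \<open>v\<close>, the covariant derivative of the field with constant
  components \<open>v\<close> in direction \<open>u\<close>. Since coordinate fields commute, torsion-freeness is symmetry;
  the last condition is compatibility with the metric.\<close>

definition levi_civita ::
  "('m, 'e::euclidean_space) metric_tensor \<Rightarrow> ('m, 'e) chart \<Rightarrow> 'm \<Rightarrow> 'e \<Rightarrow> 'e \<Rightarrow> 'e" where
  "levi_civita g c p = (THE \<Gamma>. bilinear \<Gamma> \<and> (\<forall>u v. \<Gamma> u v = \<Gamma> v u) \<and>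
     (\<forall>w u v. frechet_derivative (\<lambda>x. g c (chart_inv c x) u v) (at (chart_map c p)) w
        = g c p (\<Gamma> w u) v + g c p u (\<Gamma> w v)))"

text \<open>Covariant derivative at \<open>p\<close> in direction \<open>u\<close> of the vector field with components \<open>Y\<close> in the
  chart \<open>c\<close>.\<close>

definition cov_deriv :: "('m, 'e::euclidean_space) metric_tensor \<Rightarrow> ('m, 'e) chart \<Rightarrow> 'm \<Rightarrow>
    'e \<Rightarrow> ('m \<Rightarrow> 'e) \<Rightarrow> 'e" where
  "cov_deriv g c p u Y =
     frechet_derivative (\<lambda>x. Y (chart_inv c x)) (at (chart_map c p)) u + levi_civita g c p u (Y p)"

text \<open>The tensor \<open>(\<nabla>\<^sub>U J) V = \<nabla>\<^sub>U (J V) - J (\<nabla>\<^sub>U V)\<close>, evaluated with the extension of the vector \<open>v\<close>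
  by constant components.\<close>

definition nabla_J :: "('m, complex^2) metric_tensor \<Rightarrow> ('m, complex^2) chart \<Rightarrow> 'm \<Rightarrow>
    complex^2 \<Rightarrow> complex^2 \<Rightarrow> complex^2" where
  "nabla_J G C q u v =
     cov_deriv G C q u (\<lambda>_. cplx_str v) - cplx_str (cov_deriv G C q u (\<lambda>_. v))"

section \<open>Immersions\<close>

definition local_rep :: "('s, 'd) chart \<Rightarrow> ('m, 'e) chart \<Rightarrow> ('s \<Rightarrow> 'm) \<Rightarrow> 'd \<Rightarrow> 'e" where
  "local_rep c C F = chart_map C \<circ> F \<circ> chart_inv c"

text \<open>The differential of \<open>F\<close> at \<open>p\<close>, in components with respect to charts \<open>c\<close> around \<open>p\<close> and
  \<open>C\<close> around \<open>F p\<close>.\<close>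

definition dmap :: "('s, 'd::euclidean_space) chart \<Rightarrow> ('m, 'e::euclidean_space) chart \<Rightarrow>
    ('s \<Rightarrow> 'm) \<Rightarrow> 's \<Rightarrow> 'd \<Rightarrow> 'e" where
  "dmap c C F p = frechet_derivative (local_rep c C F) (at (chart_map c p))"

definition immersion :: "('s::topological_space, 'd::euclidean_space) chart set \<Rightarrow>
    ('m::topological_space, 'e::euclidean_space) chart set \<Rightarrow> ('s \<Rightarrow> 'm) \<Rightarrow> bool" where
  "immersion \<A> \<B> F \<longleftrightarrow> continuous_on UNIV F \<and>
     (\<forall>c\<in>\<A>. \<forall>C\<in>\<B>.
        smooth_on (local_rep c C F) (chart_map c ` (chart_dom c \<inter> F -` chart_dom C)) \<and>
        (\<forall>p\<in>chart_dom c \<inter> F -` chart_dom C. inj (dmap c C F p)))"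

definition induced_metric :: "('m, 'e::euclidean_space) chart set \<Rightarrow> ('m, 'e) metric_tensor \<Rightarrow>
    ('s \<Rightarrow> 'm) \<Rightarrow> ('s, 'd::euclidean_space) metric_tensor" where
  "induced_metric \<B> G F c p u v =
     (let C = chart_at \<B> (F p) in G C (F p) (dmap c C F p u) (dmap c C F p v))"

definition gradient :: "('s, 'd::euclidean_space) metric_tensor \<Rightarrow> ('s, 'd) chart \<Rightarrow> 's \<Rightarrow>
    ('s \<Rightarrow> real) \<Rightarrow> 'd" where
  "gradient g c p f =
     (THE w. \<forall>u. g c p w u = frechet_derivative (\<lambda>x. f (chart_inv c x)) (at (chart_map c p)) u)"

text \<open>Normal vectors of \<open>F\<close> at \<open>p\<close> and the two orthogonal projections, in components in \<open>C\<close>.\<close>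

definition normal_vec :: "('m, 'e::euclidean_space) metric_tensor \<Rightarrow> ('s, 'd::euclidean_space) chart \<Rightarrow>
    ('m, 'e) chart \<Rightarrow> ('s \<Rightarrow> 'm) \<Rightarrow> 's \<Rightarrow> 'e \<Rightarrow> bool" where
  "normal_vec G c C F p \<xi> \<longleftrightarrow> (\<forall>u. G C (F p) \<xi> (dmap c C F p u) = 0)"

definition tangent_proj :: "('m, 'e::euclidean_space) metric_tensor \<Rightarrow> ('s, 'd::euclidean_space) chart \<Rightarrow>
    ('m, 'e) chart \<Rightarrow> ('s \<Rightarrow> 'm) \<Rightarrow> 's \<Rightarrow> 'e \<Rightarrow> 'e" where
  "tangent_proj G c C F p v = (THE w. w \<in> range (dmap c C F p) \<and> normal_vec G c C F p (v - w))"

definition normal_proj :: "('m, 'e::euclidean_space) metric_tensor \<Rightarrow> ('s, 'd::euclidean_space) chart \<Rightarrow>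
    ('m, 'e) chart \<Rightarrow> ('s \<Rightarrow> 'm) \<Rightarrow> 's \<Rightarrow> 'e \<Rightarrow> 'e" where
  "normal_proj G c C F p v = v - tangent_proj G c C F p v"

text \<open>Covariant derivative, in direction of the vector with components \<open>u\<close> in \<open>c\<close>, of a vector field
  along \<open>F\<close> with components \<open>Y\<close> in \<open>C\<close>.\<close>

definition cov_deriv_along :: "('m, 'e::euclidean_space) metric_tensor \<Rightarrow>
    ('s, 'd::euclidean_space) chart \<Rightarrow> ('m, 'e) chart \<Rightarrow> ('s \<Rightarrow> 'm) \<Rightarrow> 's \<Rightarrow> 'd \<Rightarrow> ('s \<Rightarrow> 'e) \<Rightarrow> 'e" where
  "cov_deriv_along G c C F p u Y =
     frechet_derivative (\<lambda>x. Y (chart_inv c x)) (at (chart_map c p)) u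
       + levi_civita G C (F p) (dmap c C F p u) (Y p)"

text \<open>The second argument \<open>v\<close> is extended to the tangent field with constant components in \<open>c\<close>.\<close>

definition second_ff :: "('m, 'e::euclidean_space) metric_tensor \<Rightarrow> ('s, 'd::euclidean_space) chart \<Rightarrow>
    ('m, 'e) chart \<Rightarrow> ('s \<Rightarrow> 'm) \<Rightarrow> 's \<Rightarrow> 'd \<Rightarrow> 'd \<Rightarrow> 'e" where
  "second_ff G c C F p u v =
     normal_proj G c C F p (cov_deriv_along G c C F p u (\<lambda>q. dmap c C F q v))"

definition mean_curvature :: "('m, 'e::euclidean_space) metric_tensor \<Rightarrow> ('s, real^2) chart \<Rightarrow>
    ('m, 'e) chart \<Rightarrow> ('s \<Rightarrow> 'm) \<Rightarrow> 's \<Rightarrow> 'e" where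
  "mean_curvature G c C F p = (THE h. \<forall>e1 e2.
     G C (F p) (dmap c C F p e1) (dmap c C F p e1) = 1 \<and>
     G C (F p) (dmap c C F p e2) (dmap c C F p e2) = 1 \<and>
     G C (F p) (dmap c C F p e1) (dmap c C F p e2) = 0 \<longrightarrow>
     h = second_ff G c C F p e1 e1 + second_ff G c C F p e2 e2)"

section \<open>Area, Kaehler angle and the functional\<close>

definition area_density :: "('s, real^2) metric_tensor \<Rightarrow> ('s, real^2) chart \<Rightarrow> 's \<Rightarrow> real" where
  "area_density g c p =
     sqrt (g c p (axis 1 1) (axis 1 1) * g c p (axis 2 1) (axis 2 1) - (g c p (axis 1 1) (axis 2 1))\<^sup>2)"

text \<open>The area element as a 2-form, in the charts of an oriented atlas.\<close>

definition area_form :: "('s, real^2) metric_tensor \<Rightarrow> ('s, real^2) metric_tensor" where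
  "area_form g c p u v = area_density g c p * (u $ 1 * v $ 2 - u $ 2 * v $ 1)"

text \<open>The area element as a measure: the unique Borel measure given by the density in each chart.\<close>

definition area_measure :: "('s::topological_space, real^2) chart set \<Rightarrow>
    ('s, real^2) metric_tensor \<Rightarrow> 's measure" where
  "area_measure \<A> g = (THE \<mu>. sets \<mu> = sets borel \<and>
     (\<forall>c\<in>\<A>. \<forall>A\<in>sets borel. A \<subseteq> chart_dom c \<longrightarrow>
        emeasure \<mu> A =
          set_nn_integral lborel (chart_map c ` A) (\<lambda>x. ennreal (area_density g c (chart_inv c x)))))"

definition kahler_angle :: "('s, real^2) chart set \<Rightarrow> ('m, complex^2) chart set \<Rightarrow>
    ('m, complex^2) metric_tensor \<Rightarrow> ('s \<Rightarrow> 'm) \<Rightarrow> 's \<Rightarrow> real" where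
  "kahler_angle \<A> \<B> G F p = (THE \<alpha>. 0 \<le> \<alpha> \<and> \<alpha> \<le> pi \<and>
     (\<forall>c\<in>\<A>. \<forall>C\<in>\<B>. p \<in> chart_dom c \<and> F p \<in> chart_dom C \<longrightarrow>
       (\<forall>u v. kahler_form G C (F p) (dmap c C F p u) (dmap c C F p v)
          = cos \<alpha> * area_form (induced_metric \<B> G F) c p u v)))"

definition L_functional :: "('s::topological_space, real^2) chart set \<Rightarrow> ('m, complex^2) chart set \<Rightarrow>
    ('m, complex^2) metric_tensor \<Rightarrow> real \<Rightarrow> ('s \<Rightarrow> 'm) \<Rightarrow> real" where
  "L_functional \<A> \<B> G \<beta> F =
     integral\<^sup>L (area_measure \<A> (induced_metric \<B> G F)) (\<lambda>p. 1 / cos (kahler_angle \<A> \<B> G F p) powr \<beta>)"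

text \<open>Smooth families of immersions \<open>\<Phi> t\<close>, for \<open>t\<close> near 0, with normal variational field.\<close>

definition normal_variation :: "('s::topological_space, real^2) chart set \<Rightarrow>
    ('m::topological_space, complex^2) chart set \<Rightarrow> ('m, complex^2) metric_tensor \<Rightarrow> ('s \<Rightarrow> 'm) \<Rightarrow>
    (real \<Rightarrow> 's \<Rightarrow> 'm) \<Rightarrow> bool" where
  "normal_variation \<A> \<B> G F \<Phi> \<longleftrightarrow> \<Phi> 0 = F \<and>
     (\<exists>\<epsilon>>0.
        continuous_on ({-\<epsilon><..<\<epsilon>} \<times> UNIV) (\<lambda>(t, p). \<Phi> t p) \<and>
        (\<forall>c\<in>\<A>. \<forall>C\<in>\<B>. smooth_on (\<lambda>(t, x). local_rep c C (\<Phi> t) x)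
           {(t, x). t \<in> {-\<epsilon><..<\<epsilon>} \<and> x \<in> chart_img c \<and> \<Phi> t (chart_inv c x) \<in> chart_dom C}) \<and>
        (\<forall>t\<in>{-\<epsilon><..<\<epsilon>}. immersion \<A> \<B> (\<Phi> t))) \<and>
     (\<forall>c\<in>\<A>. \<forall>C\<in>\<B>. \<forall>p\<in>chart_dom c \<inter> F -` chart_dom C.
        normal_vec G c C F p (vector_derivative (\<lambda>t. chart_map C (\<Phi> t p)) (at 0)))"

definition L_critical :: "('s::topological_space, real^2) chart set \<Rightarrow>
    ('m::topological_space, complex^2) chart set \<Rightarrow> ('m, complex^2) metric_tensor \<Rightarrow> real \<Rightarrow>
    ('s \<Rightarrow> 'm) \<Rightarrow> bool" where
  "L_critical \<A> \<B> G \<beta> F \<longleftrightarrow> (\<forall>\<Phi>. normal_variation \<A> \<B> G F \<Phi> \<longrightarrow>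
     ((\<lambda>t. L_functional \<A> \<B> G \<beta> (\<Phi> t)) has_real_derivative 0) (at 0))"

end

theory Submission
  imports Defs
begin

text \<open>In a chart with coordinate fields \<open>F\<^sub>1\<close>, \<open>F\<^sub>2\<close> the integrand of the functional is the density
  \<open>\<ell> = A powr (\<beta>+1) * f powr (-\<beta>)\<close>, where \<open>A\<close> is the area density, \<open>f = \<omega>(F\<^sub>1, F\<^sub>2)\<close> and
  \<open>cos \<alpha> = f / A\<close>. Let \<open>\<xi>\<close> be a normal variational field. The area density changes by
  \<open>- A \<langle>H, \<xi>\<rangle>\<close> (\<open>area_variation\<close>). By Cartan's formula \<open>f\<close> changes by the sum of
  \<open>d\<omega>(\<xi>, F\<^sub>1, F\<^sub>2)\<close> and the exterior derivative of the one-form \<open>\<eta> = \<omega>(\<xi>, \<cdot>)\<close>. The cyclic sum of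
  \<open>\<nabla>J\<close> in the hypothesis is \<open>d\<omega>\<close> (\<open>cyclic_nabla_J\<close>), hence only the second term remains
  (\<open>kaehler_variation\<close>). Moving the derivative from \<open>\<eta>\<close> to the power of the cosine in front of it gives
  \<open>\<partial>\<^sub>t \<ell> = d\<theta> - (\<beta>+1) cos\<^bsup>-\<beta>-3\<^esup>\<alpha> A \<langle>E, \<xi>\<rangle>\<close> with a one-form \<open>\<theta>\<close> that is a multiple of \<open>\<eta>\<close>
  (\<open>density_variation\<close>). Here \<open>E = cos\<^sup>3\<alpha> H - \<beta> (J(J\<nabla>cos \<alpha>)\<^sup>\<top>)\<^sup>\<bottom>\<close>: the second term of \<open>E\<close> arises
  because, on the tangent plane, \<open>J\<close> followed by the tangential projection is \<open>cos \<alpha>\<close> times the rotation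
  by a right angle (\<open>tangential_J_gradient\<close>, \<open>EL_component_eq\<close>).

  It remains to integrate. The area measures of the family are multiples of the initial one, so that
  the functional is an integral over one fixed finite measure space, and compactness justifies
  differentiation under the integral (\<open>L_functional_derivative\<close>).

  If \<open>E = 0\<close>, the derivative of the functional is the integral of \<open>d\<theta>\<close>, which vanishes by Stokes'
  theorem (\<open>stokes\<close>). This is proved with a partition of unity \<open>\<rho>\<close>; only the wedge products
  \<open>d\<rho> \<and> \<theta>\<close>, which are of first order in the coordinate change, have to be compared between charts.

  Conversely, if \<open>E\<close> does not vanish at a point, the vector \<open>E\<close> at that point is extended to a normal
  field and multiplied by a smooth cut-off function with support near the point. Moving along
  this field in a chart of the ambient surface is an admissible variation
  (\<open>normal_variation_Phi\<close>). The exact term integrates to zero within a single chart, and the derivative of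
  the functional is \<open>-(\<beta>+1)\<close> times a positive number (\<open>derivative_of_local_variation\<close>,
  \<open>critical_imp_EL\<close>); this is where \<open>\<beta> \<noteq> -1\<close> enters.\<close>

section \<open>Calculus of smooth maps\<close>

lemma frechet_derivative_eq: "(f has_derivative D) (at x) \<Longrightarrow> frechet_derivative f (at x) v = D v"
  using frechet_derivative_at[of f D x] by simp

lemma C_k_on_cong:
  assumes "open S" "\<And>x. x \<in> S \<Longrightarrow> f x = g x"
  shows "C_k_on k f S \<longleftrightarrow> C_k_on k g S"
  using assms(2)
proof (induction k arbitrary: f g)
  case 0
  then show ?case by (auto cong: continuous_on_cong)
next
  case (Suc k)
  have imp: "C_k_on (Suc k) v S" if uv: "\<And>x. x \<in> S \<Longrightarrow> u x = v x" and u: "C_k_on (Suc k) u S" for u v :: "'a \<Rightarrow> 'b"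
  proof -
    have d: "(v has_derivative frechet_derivative u (at x)) (at x)" if "x \<in> S" for x
      using u that uv assms(1)
      by (auto intro!: has_derivative_transform_within_open[of u _ x UNIV S v] simp: frechet_derivative_works)
    have "frechet_derivative v (at x) = frechet_derivative u (at x)" if "x \<in> S" for x
      using frechet_derivative_at[OF d[OF that]] by simp
    then have "C_k_on k (\<lambda>x. frechet_derivative v (at x) h) S" for h
      using Suc.IH[of "\<lambda>x. frechet_derivative v (at x) h" "\<lambda>x. frechet_derivative u (at x) h"] u by simp
    then show ?thesis using d by (auto simp: differentiable_def)
  qed
  show ?case using imp[of f g] imp[of g f] Suc.prems by metis
qed

lemma C_k_on_SucI:
  assumes "open S" "\<And>x. x \<in> S \<Longrightarrow> (f has_derivative f' x) (at x)" "\<And>v. C_k_on k (\<lambda>x. f' x v) S"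
  shows "C_k_on (Suc k) f S"
proof -
  have "frechet_derivative f (at x) = f' x" if "x \<in> S" for x
    using frechet_derivative_at[OF assms(2)[OF that]] by simp
  then have "C_k_on k (\<lambda>x. frechet_derivative f (at x) v) S" for v
    using C_k_on_cong[OF assms(1), of "\<lambda>x. frechet_derivative f (at x) v" "\<lambda>x. f' x v" k] assms(3) by auto
  then show ?thesis using assms(2) by (auto simp: differentiable_def)
qed

lemma C_k_on_SucD:
  assumes "C_k_on (Suc k) f S" "x \<in> S"
  shows "(f has_derivative frechet_derivative f (at x)) (at x)"
  using assms by (auto simp: frechet_derivative_works)

lemma C_k_on_pred: "C_k_on (Suc k) f S \<Longrightarrow> C_k_on k f S"
proof (induction k arbitrary: f)
  case 0
  then show ?case
    by (auto intro!: continuous_at_imp_continuous_on differentiable_imp_continuous_within)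
next
  case (Suc k)
  then show ?case by auto
qed

lemma C_k_on_subset: "C_k_on k f S \<Longrightarrow> T \<subseteq> S \<Longrightarrow> C_k_on k f T"
  by (induction k arbitrary: f) (auto intro: continuous_on_subset)

text \<open>Differentiability is a local property, because only derivatives at interior points occur. This
  allows functions on a manifold to be treated in whichever chart is convenient near each point.\<close>

lemma C_k_on_local:
  "(\<And>x. x \<in> S \<Longrightarrow> \<exists>T. open T \<and> x \<in> T \<and> C_k_on k f T) \<Longrightarrow> C_k_on k f S"
proof (induction k arbitrary: f)
  case 0
  then show ?case
    by (auto intro!: continuous_at_imp_continuous_on simp: continuous_on_eq_continuous_at) (metis continuous_on_eq_continuous_at)
next
  case (Suc k)
  have "f differentiable at x" if "x \<in> S" for x
    using Suc.prems[OF that] by auto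
  moreover have "C_k_on k (\<lambda>x. frechet_derivative f (at x) v) S" for v
    using Suc.prems by (intro Suc.IH) (metis C_k_on.simps(2))
  ultimately show ?case by simp
qed

lemma C_k_on_const: "C_k_on k (\<lambda>x. c) S"
  by (induction k arbitrary: c) auto

lemma C_k_on_bounded_linear:
  assumes "bounded_linear L"
  shows "C_k_on k L S"
proof (cases k)
  case 0
  then show ?thesis using assms by (simp add: linear_continuous_on)
next
  case (Suc n)
  have "frechet_derivative L (at x) = L" for x
    using frechet_derivative_at[OF bounded_linear_imp_has_derivative[OF assms]] by metis
  then show ?thesis
    using Suc bounded_linear_imp_differentiable[OF assms] by (simp add: C_k_on_const)
qed

lemma C_k_on_add:
  assumes "open S" "C_k_on k f S" "C_k_on k g S"
  shows "C_k_on k (\<lambda>x. f x + g x) S"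
  using assms(2,3)
proof (induction k arbitrary: f g)
  case 0
  then show ?case by (auto intro: continuous_on_add)
next
  case (Suc k)
  show ?case
  proof (rule C_k_on_SucI[OF assms(1)])
    show "((\<lambda>x. f x + g x) has_derivative (\<lambda>v. frechet_derivative f (at x) v + frechet_derivative g (at x) v)) (at x)"
      if "x \<in> S" for x
      using Suc.prems that by (intro has_derivative_add C_k_on_SucD)
    show "C_k_on k (\<lambda>x. frechet_derivative f (at x) v + frechet_derivative g (at x) v) S" for v
      using Suc.prems by (intro Suc.IH) auto
  qed
qed

lemma (in bounded_bilinear) C_k_on_prod:
  assumes "open S" "C_k_on k f S" "C_k_on k g S"
  shows "C_k_on k (\<lambda>x. prod (f x) (g x)) S"
  using assms(2,3)
proof (induction k arbitrary: f g)
  case 0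
  then show ?case by (auto intro: continuous_on)
next
  case (Suc k)
  show ?case
  proof (rule C_k_on_SucI[OF assms(1)])
    show "((\<lambda>x. prod (f x) (g x)) has_derivative
        (\<lambda>v. prod (f x) (frechet_derivative g (at x) v) + prod (frechet_derivative f (at x) v) (g x))) (at x)"
      if "x \<in> S" for x
      using Suc.prems that by (intro FDERIV C_k_on_SucD)
    show "C_k_on k (\<lambda>x. prod (f x) (frechet_derivative g (at x) v) + prod (frechet_derivative f (at x) v) (g x)) S" for v
      using Suc.prems C_k_on_pred[of k f S] C_k_on_pred[of k g S]
      by (intro C_k_on_add assms(1) Suc.IH) auto
  qed
qed

lemma C_k_on_sum:
  assumes "open S" "\<And>i. i \<in> I \<Longrightarrow> C_k_on k (f i) S"
  shows "C_k_on k (\<lambda>x. \<Sum>i\<in>I. f i x) S"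
  using assms(2)
proof (induction I rule: infinite_finite_induct)
  case (insert i I)
  then show ?case by (simp add: C_k_on_add assms(1))
qed (simp_all add: C_k_on_const)

text \<open>The derivative of a composition is a sum, over a basis of the middle space, of products of
  compositions and derivatives of lower order, so that the order of differentiability carries
  over by induction.\<close>

lemma C_k_on_compose:
  fixes g :: "'a::real_normed_vector \<Rightarrow> 'b::euclidean_space" and f :: "'b \<Rightarrow> 'c::real_normed_vector"
  assumes "open S" "open T" "g ` S \<subseteq> T" "C_k_on k f T" "C_k_on k g S"
  shows "C_k_on k (\<lambda>x. f (g x)) S"
  using assms(4,5)
proof (induction k arbitrary: f)
  case 0
  then show ?case using assms(3) by (auto intro: continuous_on_compose2)
next
  case (Suc k)
  show ?case
  proof (rule C_k_on_SucI[OF assms(1)])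
    let ?D = "\<lambda>x v. \<Sum>b\<in>Basis. (frechet_derivative g (at x) v \<bullet> b) *\<^sub>R frechet_derivative f (at (g x)) b"
    show "((\<lambda>x. f (g x)) has_derivative ?D x) (at x)" if x: "x \<in> S" for x
    proof -
      have f: "(f has_derivative frechet_derivative f (at (g x))) (at (g x))"
        using Suc.prems(1) x assms(3) by (intro C_k_on_SucD[of k _ T]) auto
      have g: "(g has_derivative frechet_derivative g (at x)) (at x)"
        using Suc.prems(2) x by (intro C_k_on_SucD[of k _ S])
      have lin: "linear (frechet_derivative f (at (g x)))"
        using f by (rule has_derivative_linear)
      have rep: "frechet_derivative f (at (g x)) w = (\<Sum>b\<in>Basis. (w \<bullet> b) *\<^sub>R frechet_derivative f (at (g x)) b)" for w
      proof -
        have "frechet_derivative f (at (g x)) w = frechet_derivative f (at (g x)) (\<Sum>b\<in>Basis. (w \<bullet> b) *\<^sub>R b)"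
          by (simp add: euclidean_representation)
        then show ?thesis by (simp add: linear_sum[OF lin] linear_scale[OF lin])
      qed
      have eq: "frechet_derivative f (at (g x)) \<circ> frechet_derivative g (at x) = ?D x"
        unfolding o_def by (rule ext) (rule rep)
      show ?thesis
        using diff_chain_at[OF g f] unfolding eq by (simp add: o_def)
    qed
    show "C_k_on k (\<lambda>x. ?D x v) S" for v
    proof (rule C_k_on_sum[OF assms(1)])
      fix b :: 'b
      have "C_k_on k (\<lambda>x. frechet_derivative f (at (g x)) b) S"
        using Suc.prems C_k_on_pred by (intro Suc.IH) auto
      moreover have "C_k_on k (\<lambda>x. frechet_derivative g (at x) v \<bullet> b) S"
        using Suc.prems by (intro bounded_bilinear.C_k_on_prod[OF bounded_bilinear_inner] assms(1) C_k_on_const) auto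
      ultimately show "C_k_on k (\<lambda>x. (frechet_derivative g (at x) v \<bullet> b) *\<^sub>R frechet_derivative f (at (g x)) b) S"
        by (intro bounded_bilinear.C_k_on_prod[OF bounded_bilinear_scaleR] assms(1))
    qed
  qed
qed

lemma smooth_on_cong: "open S \<Longrightarrow> (\<And>x. x \<in> S \<Longrightarrow> f x = g x) \<Longrightarrow> smooth_on f S \<longleftrightarrow> smooth_on g S"
  unfolding smooth_on_def using C_k_on_cong by blast

lemma smooth_on_eq: "smooth_on f S \<Longrightarrow> open S \<Longrightarrow> (\<And>x. x \<in> S \<Longrightarrow> f x = g x) \<Longrightarrow> smooth_on g S"
  using smooth_on_cong by blast

lemma smooth_on_subset: "smooth_on f S \<Longrightarrow> T \<subseteq> S \<Longrightarrow> smooth_on f T"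
  unfolding smooth_on_def using C_k_on_subset by blast

lemma smooth_on_local:
  "(\<And>x. x \<in> S \<Longrightarrow> \<exists>T. open T \<and> x \<in> T \<and> smooth_on f T) \<Longrightarrow> smooth_on f S"
  unfolding smooth_on_def by (intro allI C_k_on_local) blast

lemma smooth_on_const: "smooth_on (\<lambda>x. c) S"
  by (simp add: smooth_on_def C_k_on_const)

lemma smooth_on_bounded_linear: "bounded_linear L \<Longrightarrow> smooth_on L S"
  by (simp add: smooth_on_def C_k_on_bounded_linear)

lemma smooth_on_id: "smooth_on (\<lambda>x. x) S"
  by (simp add: smooth_on_bounded_linear bounded_linear_ident)

lemma smooth_on_add: "open S \<Longrightarrow> smooth_on f S \<Longrightarrow> smooth_on g S \<Longrightarrow> smooth_on (\<lambda>x. f x + g x) S"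
  by (simp add: smooth_on_def C_k_on_add)

lemma (in bounded_bilinear) smooth_on_prod:
  "open S \<Longrightarrow> smooth_on f S \<Longrightarrow> smooth_on g S \<Longrightarrow> smooth_on (\<lambda>x. prod (f x) (g x)) S"
  by (simp add: smooth_on_def C_k_on_prod)

lemmas smooth_on_scaleR = bounded_bilinear.smooth_on_prod[OF bounded_bilinear_scaleR]
lemmas smooth_on_inner = bounded_bilinear.smooth_on_prod[OF bounded_bilinear_inner]

lemma smooth_on_mult: "open S \<Longrightarrow> smooth_on f S \<Longrightarrow> smooth_on g S \<Longrightarrow> smooth_on (\<lambda>x. f x * g x :: real) S"
  by (rule bounded_bilinear.smooth_on_prod[OF bounded_bilinear_mult])

lemma smooth_on_minus: "open S \<Longrightarrow> smooth_on f S \<Longrightarrow> smooth_on (\<lambda>x. - f x) S"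
  using smooth_on_scaleR[OF _ smooth_on_const[of "-1"]] by simp

lemma smooth_on_diff: "open S \<Longrightarrow> smooth_on f S \<Longrightarrow> smooth_on g S \<Longrightarrow> smooth_on (\<lambda>x. f x - g x) S"
  using smooth_on_add[of S f "\<lambda>x. - g x"] smooth_on_minus[of S g] by simp

lemma smooth_on_sum: "open S \<Longrightarrow> (\<And>i. i \<in> I \<Longrightarrow> smooth_on (f i) S) \<Longrightarrow> smooth_on (\<lambda>x. \<Sum>i\<in>I. f i x) S"
  by (simp add: smooth_on_def C_k_on_sum)

lemma smooth_on_power2: "open S \<Longrightarrow> smooth_on f S \<Longrightarrow> smooth_on (\<lambda>x. (f x :: real)\<^sup>2) S"
  by (simp add: power2_eq_square smooth_on_mult)

lemma smooth_on_compose: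
  fixes g :: "'a::real_normed_vector \<Rightarrow> 'b::euclidean_space"
  shows "open S \<Longrightarrow> open T \<Longrightarrow> g ` S \<subseteq> T \<Longrightarrow> smooth_on f T \<Longrightarrow> smooth_on g S \<Longrightarrow> smooth_on (\<lambda>x. f (g x)) S"
  by (simp add: smooth_on_def C_k_on_compose)

lemma smooth_on_linear_compose:
  fixes g :: "'a::real_normed_vector \<Rightarrow> 'b::euclidean_space"
  assumes "open S" "linear L" "smooth_on g S"
  shows "smooth_on (\<lambda>x. L (g x)) S"
  by (rule smooth_on_compose[OF assms(1) open_UNIV _ _ assms(3)])
     (auto intro: smooth_on_bounded_linear linear_conv_bounded_linear[THEN iffD1] assms)

lemma smooth_on_has_derivative:
  assumes "smooth_on f S" "x \<in> S"
  shows "(f has_derivative frechet_derivative f (at x)) (at x)"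
  using assms C_k_on_SucD[of 0] unfolding smooth_on_def by blast

lemma smooth_on_differentiable: "smooth_on f S \<Longrightarrow> x \<in> S \<Longrightarrow> f differentiable (at x)"
  using smooth_on_has_derivative differentiable_def by blast

lemma smooth_on_linear_derivative: "smooth_on f S \<Longrightarrow> x \<in> S \<Longrightarrow> linear (frechet_derivative f (at x))"
  using smooth_on_has_derivative has_derivative_linear by blast

lemma smooth_on_continuous: "smooth_on f S \<Longrightarrow> continuous_on S f"
  unfolding smooth_on_def using C_k_on.simps(1) by blast

lemma smooth_on_derivative: "smooth_on f S \<Longrightarrow> smooth_on (\<lambda>x. frechet_derivative f (at x) v) S"
  unfolding smooth_on_def using C_k_on.simps(2) by blast

lemma smooth_on_Pair_left:
  fixes g :: "'a::real_normed_vector \<Rightarrow> 'b::euclidean_space"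
  shows "smooth_on (\<lambda>x. (c, x)) S"
proof -
  have "smooth_on (\<lambda>x. (c, 0) + (0, x)) UNIV"
    by (intro smooth_on_add smooth_on_const smooth_on_bounded_linear bounded_linear_Pair
        bounded_linear_zero bounded_linear_ident open_UNIV)
  then show ?thesis using smooth_on_subset by auto
qed

lemma smooth_on_fst: "smooth_on fst S" and smooth_on_snd: "smooth_on snd S"
  by (auto intro: smooth_on_bounded_linear bounded_linear_fst bounded_linear_snd)

lemma smooth_on_componentwise:
  fixes f :: "'a::real_normed_vector \<Rightarrow> 'b::euclidean_space"
  assumes "open S" "\<And>b. b \<in> Basis \<Longrightarrow> smooth_on (\<lambda>x. f x \<bullet> b) S"
  shows "smooth_on f S"
proof -
  have "smooth_on (\<lambda>x. \<Sum>b\<in>Basis. (f x \<bullet> b) *\<^sub>R b) S"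
    by (intro smooth_on_sum smooth_on_scaleR smooth_on_const assms)
  then show ?thesis by (simp add: euclidean_representation)
qed

lemma smooth_on_Pair:
  fixes f :: "'a::real_normed_vector \<Rightarrow> 'b::euclidean_space" and g :: "'a \<Rightarrow> 'c::euclidean_space"
  assumes "open S" "smooth_on f S" "smooth_on g S"
  shows "smooth_on (\<lambda>x. (f x, g x)) S"
  by (rule smooth_on_componentwise[OF assms(1)])
     (auto simp: Basis_prod_def inner_prod_def intro!: smooth_on_inner smooth_on_const assms)

subsection \<open>Functions of one real variable\<close>

lemma C_k_on_SucI_real:
  fixes f :: "real \<Rightarrow> real"
  assumes "open S" "\<And>x. x \<in> S \<Longrightarrow> (f has_real_derivative f' x) (at x)" "C_k_on k f' S"
  shows "C_k_on (Suc k) f S"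
  by (rule C_k_on_SucI[where f' = "\<lambda>x v. f' x * v"])
     (use assms in \<open>auto simp: has_field_derivative_def
        intro!: bounded_bilinear.C_k_on_prod[OF bounded_bilinear_mult] C_k_on_const\<close>)

lemma smooth_on_powr_real: "smooth_on (\<lambda>x::real. x powr a) {0<..}"
proof -
  have "C_k_on k (\<lambda>x::real. x powr a) {0<..}" for k
  proof (induction k arbitrary: a)
    case 0
    then show ?case by (auto intro!: continuous_intros)
  next
    case (Suc k)
    show ?case
      by (rule C_k_on_SucI_real[where f' = "\<lambda>x. a * x powr (a - 1)"])
         (auto intro!: bounded_bilinear.C_k_on_prod[OF bounded_bilinear_mult] C_k_on_const Suc
           has_real_derivative_powr)
  qed
  then show ?thesis by (simp add: smooth_on_def)
qed

lemma smooth_on_powr: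
  assumes "open S" "smooth_on f S" "\<And>x. x \<in> S \<Longrightarrow> 0 < f x"
  shows "smooth_on (\<lambda>x. f x powr a :: real) S"
  by (rule smooth_on_compose[where T = "{0<..}" and f = "\<lambda>y. y powr a", OF assms(1) open_greaterThan _
        smooth_on_powr_real assms(2)]) (use assms(3) in auto)

lemma smooth_on_divide:
  assumes "open S" "smooth_on f S" "smooth_on g S" "\<And>x. x \<in> S \<Longrightarrow> 0 < g x"
  shows "smooth_on (\<lambda>x. f x / g x :: real) S"
proof (rule smooth_on_eq)
  show "smooth_on (\<lambda>x. f x * g x powr (-1)) S"
    by (intro smooth_on_mult smooth_on_powr assms)
  show "f x * g x powr (-1) = f x / g x" if "x \<in> S" for x
    using assms(4)[OF that] by (simp add: powr_minus divide_inverse)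
qed fact

lemma smooth_on_sqrt:
  assumes "open S" "smooth_on f S" "\<And>x. x \<in> S \<Longrightarrow> 0 < f x"
  shows "smooth_on (\<lambda>x. sqrt (f x)) S"
  by (rule smooth_on_eq[OF smooth_on_powr[OF assms, where a = "1/2"] assms(1)])
     (use assms(3) in \<open>auto simp: powr_half_sqrt less_imp_le\<close>)

text \<open>For \<open>n = 0\<close> the standard smooth function that vanishes exactly on the closed negative half-line;
  the other \<open>n\<close> occur in its derivatives.\<close>

definition flat :: "nat \<Rightarrow> real \<Rightarrow> real" where
  "flat n x = (if 0 < x then exp (- inverse x) * inverse x ^ n else 0)"

text \<open>The exponential of \<open>1/x\<close> exceeds each single term of its series.\<close>

lemma flat_le:
  assumes "0 < x"
  shows "flat n x \<le> fact (Suc (Suc n)) * x\<^sup>2"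
proof -
  have "inverse x ^ Suc (Suc n) / fact (Suc (Suc n)) \<le> exp (inverse x)"
  proof -
    have "summable (\<lambda>k. inverse x ^ k / fact k)"
      using summable_exp[of "inverse x"] by (simp add: divide_inverse mult.commute)
    then have "(\<Sum>k\<in>{Suc (Suc n)}. inverse x ^ k / fact k) \<le> (\<Sum>k. inverse x ^ k / fact k)"
      using assms by (intro sum_le_suminf) auto
    also have "\<dots> = exp (inverse x)"
      by (simp add: exp_def divide_inverse mult.commute)
    finally show ?thesis by simp
  qed
  then have "inverse x ^ Suc (Suc n) \<le> fact (Suc (Suc n)) * exp (inverse x)"
    by (simp add: divide_le_eq mult.commute del: fact_Suc)
  then have "inverse x ^ Suc (Suc n) * exp (- inverse x) * x\<^sup>2 \<le> fact (Suc (Suc n)) * exp (inverse x) * exp (- inverse x) * x\<^sup>2"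
    by (intro mult_right_mono) (auto simp del: fact_Suc)
  also have "\<dots> = fact (Suc (Suc n)) * x\<^sup>2"
    by (simp add: exp_minus del: fact_Suc)
  also have "inverse x ^ Suc (Suc n) * exp (- inverse x) * x\<^sup>2 = flat n x"
    using assms by (simp add: flat_def power2_eq_square field_simps)
  finally show ?thesis .
qed

text \<open>Derivatives of the functions \<open>flat n\<close> are linear combinations of such functions, so that smoothness
  follows by an induction over the order for all \<open>n\<close> at once. At the origin the quadratic bound gives the derivative.\<close>

lemma flat_derivative: "(flat n has_real_derivative (flat (n + 2) x - of_nat n * flat (n + 1) x)) (at x)"
proof -
  consider "x > 0" | "x < 0" | "x = 0" by linarith
  then show ?thesis
  proof cases
    case 1
    have "((\<lambda>x. exp (- inverse x) * inverse x ^ n) has_real_derivative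
       (exp (- inverse x) * (inverse x ^ 2) * inverse x ^ n
         + exp (- inverse x) * (of_nat n * (inverse x ^ (n - 1) * - (inverse x ^ 2))))) (at x)"
      using 1 by (auto intro!: derivative_eq_intros simp: power2_eq_square)
    moreover have "exp (- inverse x) * (inverse x ^ 2) * inverse x ^ n
         + exp (- inverse x) * (of_nat n * (inverse x ^ (n - 1) * - (inverse x ^ 2)))
       = flat (n + 2) x - of_nat n * flat (n + 1) x"
      using 1 by (cases n) (auto simp: flat_def power2_eq_square algebra_simps)
    ultimately have "((\<lambda>x. exp (- inverse x) * inverse x ^ n) has_real_derivative
        (flat (n + 2) x - of_nat n * flat (n + 1) x)) (at x)" by simp
    then show ?thesis
      by (rule has_field_derivative_transform_within_open[of _ _ _ "{0<..}"]) (use 1 in \<open>auto simp: flat_def\<close>)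
  next
    case 2
    have "((\<lambda>x. 0) has_real_derivative (flat (n + 2) x - of_nat n * flat (n + 1) x)) (at x)"
      using 2 by (simp add: flat_def)
    then show ?thesis
      by (rule has_field_derivative_transform_within_open[of _ _ _ "{..<0}"]) (use 2 in \<open>auto simp: flat_def\<close>)
  next
    case 3
    have "((\<lambda>h. flat n h / h) \<longlongrightarrow> 0) (at 0)"
    proof (rule tendsto_0_le[where K = 1])
      show "((\<lambda>h. fact (Suc (Suc n)) * h) \<longlongrightarrow> (0::real)) (at 0)"
        by (auto intro!: tendsto_eq_intros)
      have "norm (flat n h / h) \<le> norm (fact (Suc (Suc n)) * h)" if "h \<noteq> 0" for h
      proof (cases "h > 0")
        case True
        have "flat n h \<ge> 0" using True by (simp add: flat_def)
        then show ?thesis using True flat_le[OF True, of n]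
          by (simp add: divide_le_eq power2_eq_square mult.assoc del: fact_Suc)
      qed (simp add: flat_def)
      then show "\<forall>\<^sub>F h in at 0. norm (flat n h / h) \<le> norm (fact (Suc (Suc n)) * h) * 1"
        by (auto simp: eventually_at_filter)
    qed
    then show ?thesis using 3 by (simp add: DERIV_def flat_def)
  qed
qed

lemma smooth_on_flat: "smooth_on (flat n) S"
proof -
  have "C_k_on k (flat n) UNIV" for k n
  proof (induction k arbitrary: n)
    case 0
    then show ?case using flat_derivative by (auto intro!: continuous_at_imp_continuous_on DERIV_isCont)
  next
    case (Suc k)
    have "C_k_on k (\<lambda>x. flat (n + 2) x + (- of_nat n) * flat (n + 1) x) UNIV"
      by (intro C_k_on_add bounded_bilinear.C_k_on_prod[OF bounded_bilinear_mult] C_k_on_const Suc open_UNIV)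
    then show ?case
      using flat_derivative[of n]
      by (intro C_k_on_SucI_real[where f' = "\<lambda>x. flat (n + 2) x + (- of_nat n) * flat (n + 1) x"]) auto
  qed
  then show ?thesis using smooth_on_subset[of "flat n" UNIV S] by (simp add: smooth_on_def)
qed

lemma flat_pos_iff: "0 < flat n x \<longleftrightarrow> 0 < x" and flat_nonneg: "0 \<le> flat n x"
  and flat_eq_0_iff: "flat n x = 0 \<longleftrightarrow> x \<le> 0"
  by (auto simp: flat_def)

subsection \<open>Symmetry of second derivatives\<close>

lemma has_real_derivative_along_line:
  fixes f :: "'a::real_normed_vector \<Rightarrow> real"
  assumes "smooth_on f S" "z + s *\<^sub>R u \<in> S"
  shows "((\<lambda>s. f (z + s *\<^sub>R u)) has_real_derivative frechet_derivative f (at (z + s *\<^sub>R u)) u) (at s)"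
proof -
  have "((\<lambda>s. z + s *\<^sub>R u) has_derivative (\<lambda>h. h *\<^sub>R u)) (at s)"
    by (auto intro!: derivative_eq_intros)
  from diff_chain_at[OF this smooth_on_has_derivative[OF assms]]
  show ?thesis
    using linear_scale[OF smooth_on_linear_derivative[OF assms]]
    by (simp add: has_field_derivative_def o_def mult.commute[of _ "frechet_derivative f _ u"])
qed

text \<open>By the mean value theorem, applied once in each direction, the second difference over a
  small parallelogram is a value of the second derivative inside it.\<close>

lemma second_difference_mean_value:
  fixes f :: "'a::real_normed_vector \<Rightarrow> real"
  assumes f: "smooth_on f S" and h: "0 < h"
    and sub: "\<And>s t. 0 \<le> s \<Longrightarrow> s \<le> h \<Longrightarrow> 0 \<le> t \<Longrightarrow> t \<le> h \<Longrightarrow> z + s *\<^sub>R u + t *\<^sub>R v \<in> S"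
  obtains s t where "0 < s" "s < h" "0 < t" "t < h"
    "f (z + h *\<^sub>R u + h *\<^sub>R v) - f (z + h *\<^sub>R u) - f (z + h *\<^sub>R v) + f z
      = h\<^sup>2 * frechet_derivative (\<lambda>y. frechet_derivative f (at y) u) (at (z + s *\<^sub>R u + t *\<^sub>R v)) v"
proof -
  let ?g = "\<lambda>s. f (z + s *\<^sub>R u + h *\<^sub>R v) - f (z + s *\<^sub>R u)"
  let ?D = "\<lambda>y. frechet_derivative f (at y) u"
  have dg: "(?g has_real_derivative (?D (z + s *\<^sub>R u + h *\<^sub>R v) - ?D (z + s *\<^sub>R u))) (at s)"
    if "0 \<le> s" "s \<le> h" for s
  proof (rule DERIV_diff)
    have "((\<lambda>s. f ((z + h *\<^sub>R v) + s *\<^sub>R u)) has_real_derivative ?D ((z + h *\<^sub>R v) + s *\<^sub>R u)) (at s)"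
      using sub[of s h] that h by (intro has_real_derivative_along_line[OF f]) (auto simp: add_ac)
    then show "((\<lambda>s. f (z + s *\<^sub>R u + h *\<^sub>R v)) has_real_derivative ?D (z + s *\<^sub>R u + h *\<^sub>R v)) (at s)"
      by (simp add: add_ac)
    show "((\<lambda>s. f (z + s *\<^sub>R u)) has_real_derivative ?D (z + s *\<^sub>R u)) (at s)"
      using sub[of s 0] that h by (intro has_real_derivative_along_line[OF f]) auto
  qed
  obtain s where s: "0 < s" "s < h"
    "?g h - ?g 0 = (h - 0) * (?D (z + s *\<^sub>R u + h *\<^sub>R v) - ?D (z + s *\<^sub>R u))"
    using MVT2[OF h, of ?g "\<lambda>s. ?D (z + s *\<^sub>R u + h *\<^sub>R v) - ?D (z + s *\<^sub>R u)"] dg by auto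
  have "((\<lambda>t. ?D (z + s *\<^sub>R u + t *\<^sub>R v)) has_real_derivative
      frechet_derivative ?D (at (z + s *\<^sub>R u + t *\<^sub>R v)) v) (at t)" if "0 \<le> t" "t \<le> h" for t
    using sub[of s t] that s by (intro has_real_derivative_along_line[OF smooth_on_derivative[OF f]]) auto
  then obtain t where t: "0 < t" "t < h"
    "?D (z + s *\<^sub>R u + h *\<^sub>R v) - ?D (z + s *\<^sub>R u + 0 *\<^sub>R v)
       = (h - 0) * frechet_derivative ?D (at (z + s *\<^sub>R u + t *\<^sub>R v)) v"
    using MVT2[OF h, of "\<lambda>t. ?D (z + s *\<^sub>R u + t *\<^sub>R v)"
        "\<lambda>t. frechet_derivative ?D (at (z + s *\<^sub>R u + t *\<^sub>R v)) v"] by auto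
  have "f (z + h *\<^sub>R u + h *\<^sub>R v) - f (z + h *\<^sub>R u) - f (z + h *\<^sub>R v) + f z = ?g h - ?g 0"
    by simp
  also have "\<dots> = h\<^sup>2 * frechet_derivative ?D (at (z + s *\<^sub>R u + t *\<^sub>R v)) v"
    using s(3) t(3) by (simp add: power2_eq_square)
  finally show ?thesis using that s t by blast
qed

text \<open>Both mixed derivatives at \<open>z\<close> are limits of the second difference over the same small parallelogram,
  divided by the square of its size.\<close>

lemma second_derivative_symmetric_real:
  fixes f :: "'a::real_normed_vector \<Rightarrow> real"
  assumes f: "smooth_on f S" and S: "open S" "z \<in> S"
  shows "frechet_derivative (\<lambda>y. frechet_derivative f (at y) u) (at z) v
       = frechet_derivative (\<lambda>y. frechet_derivative f (at y) v) (at z) u"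
proof (rule ccontr)
  let ?P = "\<lambda>y. frechet_derivative (\<lambda>y. frechet_derivative f (at y) u) (at y) v"
  let ?Q = "\<lambda>y. frechet_derivative (\<lambda>y. frechet_derivative f (at y) v) (at y) u"
  assume ne: "?P z \<noteq> ?Q z"
  define e where "e = \<bar>?P z - ?Q z\<bar> / 2"
  have e: "e > 0" using ne by (simp add: e_def)
  have "isCont ?P z" "isCont ?Q z"
    using smooth_on_continuous[OF smooth_on_derivative[OF smooth_on_derivative[OF f]]] S
    by (auto simp: continuous_on_eq_continuous_at)
  then obtain d1 d2 where d: "d1 > 0" "d2 > 0"
    "\<And>y. dist y z < d1 \<Longrightarrow> dist (?P y) (?P z) < e" "\<And>y. dist y z < d2 \<Longrightarrow> dist (?Q y) (?Q z) < e"
    using e unfolding continuous_at_eps_delta by metis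
  obtain d3 where d3: "d3 > 0" "ball z d3 \<subseteq> S" using S openE by blast
  define d where "d = min d1 (min d2 d3)"
  have d0: "d > 0" using d d3 by (simp add: d_def)
  define h where "h = d / (2 * (norm u + norm v + 1))"
  have h: "h > 0" using d0 by (simp add: h_def add_nonneg_pos)
  have near: "dist (z + s *\<^sub>R u + t *\<^sub>R v) z < d" if "0 \<le> s" "s \<le> h" "0 \<le> t" "t \<le> h" for s t
  proof -
    have "dist (z + s *\<^sub>R u + t *\<^sub>R v) z = norm (s *\<^sub>R u + t *\<^sub>R v)"
      by (simp add: dist_norm)
    also have "\<dots> \<le> s * norm u + t * norm v"
      using norm_triangle_ineq[of "s *\<^sub>R u" "t *\<^sub>R v"] that by simp
    also have "\<dots> \<le> h * norm u + h * norm v"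
      using that by (intro add_mono mult_right_mono) auto
    also have "\<dots> < h * (2 * (norm u + norm v + 1))"
      using h by (simp add: distrib_left add_nonneg_pos)
    also have "\<dots> = d"
    proof -
      have "norm u + norm v + 1 \<noteq> 0" using norm_ge_zero[of u] norm_ge_zero[of v] by linarith
      then show ?thesis by (simp add: h_def)
    qed
    finally show ?thesis .
  qed
  have sub: "z + s *\<^sub>R u + t *\<^sub>R v \<in> S" if "0 \<le> s" "s \<le> h" "0 \<le> t" "t \<le> h" for s t
    using near[OF that] d3 by (auto simp: d_def dist_commute)
  have sub': "z + s *\<^sub>R v + t *\<^sub>R u \<in> S" if "0 \<le> s" "s \<le> h" "0 \<le> t" "t \<le> h" for s t
    using sub[of t s] that by (simp add: add_ac)
  obtain s t where st: "0 < s" "s < h" "0 < t" "t < h"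
    "f (z + h *\<^sub>R u + h *\<^sub>R v) - f (z + h *\<^sub>R u) - f (z + h *\<^sub>R v) + f z = h\<^sup>2 * ?P (z + s *\<^sub>R u + t *\<^sub>R v)"
    using second_difference_mean_value[OF f h, of z u v] sub by blast
  obtain s' t' where st': "0 < s'" "s' < h" "0 < t'" "t' < h"
    "f (z + h *\<^sub>R v + h *\<^sub>R u) - f (z + h *\<^sub>R v) - f (z + h *\<^sub>R u) + f z = h\<^sup>2 * ?Q (z + s' *\<^sub>R v + t' *\<^sub>R u)"
    using second_difference_mean_value[OF f h, of z v u] sub' by blast
  have "h\<^sup>2 * ?P (z + s *\<^sub>R u + t *\<^sub>R v) = h\<^sup>2 * ?Q (z + s' *\<^sub>R v + t' *\<^sub>R u)"
    using st(5) st'(5) by (simp add: algebra_simps)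
  then have "?P (z + s *\<^sub>R u + t *\<^sub>R v) = ?Q (z + t' *\<^sub>R u + s' *\<^sub>R v)"
    using h by (simp add: add_ac)
  moreover have "dist (?P (z + s *\<^sub>R u + t *\<^sub>R v)) (?P z) < e"
    using near[of s t] st by (intro d) (auto simp: d_def)
  moreover have "dist (?Q (z + t' *\<^sub>R u + s' *\<^sub>R v)) (?Q z) < e"
    using near[of t' s'] st' by (intro d) (auto simp: d_def)
  moreover have "False" if "a = b" "dist a p < \<bar>p - q\<bar> / 2" "dist b q < \<bar>p - q\<bar> / 2" for a b p q :: real
    using that dist_triangle3[of p q a] by (simp add: dist_real_def[of p q])
  ultimately show False unfolding e_def by blast
qed

lemma frechet_derivative_inner:
  fixes f :: "'a::real_normed_vector \<Rightarrow> 'b::euclidean_space"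
  assumes "f differentiable (at x)"
  shows "frechet_derivative (\<lambda>x. f x \<bullet> b) (at x) v = frechet_derivative f (at x) v \<bullet> b"
proof -
  have "((\<lambda>x. f x \<bullet> b) has_derivative (\<lambda>v. frechet_derivative f (at x) v \<bullet> b)) (at x)"
    using assms by (intro has_derivative_inner_left) (simp add: frechet_derivative_works)
  from frechet_derivative_at[OF this] show ?thesis by metis
qed

lemma frechet_derivative_cong_open:
  assumes "open S" "x \<in> S" "\<And>y. y \<in> S \<Longrightarrow> f y = g y"
  shows "frechet_derivative f (at x) = frechet_derivative g (at x)"
proof -
  have "(f has_derivative D) (at x) \<longleftrightarrow> (g has_derivative D) (at x)" for D
    using has_derivative_transform_within_open[of f D x UNIV S g]
      has_derivative_transform_within_open[of g D x UNIV S f] assms by auto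
  then show ?thesis by (simp add: frechet_derivative_def)
qed

lemma second_derivative_symmetric:
  fixes f :: "'a::real_normed_vector \<Rightarrow> 'b::euclidean_space"
  assumes f: "smooth_on f S" and S: "open S" "z \<in> S"
  shows "frechet_derivative (\<lambda>y. frechet_derivative f (at y) u) (at z) v
       = frechet_derivative (\<lambda>y. frechet_derivative f (at y) v) (at z) u"
proof (rule euclidean_eqI)
  fix b :: 'b
  have fb: "smooth_on (\<lambda>x. f x \<bullet> b) S"
    by (intro smooth_on_inner smooth_on_const f S)
  have *: "frechet_derivative (\<lambda>y. frechet_derivative f (at y) u) (at z) v \<bullet> b
      = frechet_derivative (\<lambda>y. frechet_derivative (\<lambda>x. f x \<bullet> b) (at y) u) (at z) v" for u v
  proof -
    have "frechet_derivative (\<lambda>y. frechet_derivative (\<lambda>x. f x \<bullet> b) (at y) u) (at z)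
      = frechet_derivative (\<lambda>y. frechet_derivative f (at y) u \<bullet> b) (at z)"
      using S smooth_on_differentiable[OF f]
      by (intro frechet_derivative_cong_open[of S]) (auto simp: frechet_derivative_inner)
    then show ?thesis
      using smooth_on_differentiable[OF smooth_on_derivative[OF f] S(2)]
      by (simp add: frechet_derivative_inner)
  qed
  show "frechet_derivative (\<lambda>y. frechet_derivative f (at y) u) (at z) v \<bullet> b
      = frechet_derivative (\<lambda>y. frechet_derivative f (at y) v) (at z) u \<bullet> b"
    unfolding * by (rule second_derivative_symmetric_real[OF fb S])
qed

subsection \<open>Slices of a product\<close>

lemma has_derivative_fix_fst:
  assumes "(q has_derivative L) (at (t, x))"
  shows "((\<lambda>x. q (t, x)) has_derivative (\<lambda>a. L (0, a))) (at x)"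
proof -
  have "((\<lambda>x. (t, x)) has_derivative (\<lambda>a. (0, a))) (at x)" by (auto intro!: derivative_eq_intros)
  from diff_chain_at[OF this assms] show ?thesis by (simp add: o_def)
qed

lemma has_derivative_fix_snd:
  assumes "(q has_derivative L) (at (t, x))"
  shows "((\<lambda>t. q (t, x)) has_derivative (\<lambda>h. L (h, 0))) (at t)"
proof -
  have "((\<lambda>t. (t, x)) has_derivative (\<lambda>h. (h, 0))) (at t)" by (auto intro!: derivative_eq_intros)
  from diff_chain_at[OF this assms] show ?thesis by (simp add: o_def)
qed

lemma open_fix_fst: "open W \<Longrightarrow> open {x. (t, x) \<in> W}"
  and open_fix_snd: "open W \<Longrightarrow> open {t. (t, x) \<in> W}"
  using open_vimage[of W "\<lambda>x. (t, x)"] open_vimage[of W "\<lambda>t. (t, x)"]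
  by (simp_all add: vimage_def continuous_on_Pair continuous_on_const continuous_on_id)

section \<open>Inner products on coordinate spaces\<close>

lemma bilinear_basis_expansion:
  fixes f :: "'e::euclidean_space \<Rightarrow> 'e \<Rightarrow> real"
  assumes "bilinear f"
  shows "f u v = (\<Sum>b\<in>Basis. \<Sum>b'\<in>Basis. ((u \<bullet> b) * (v \<bullet> b')) * f b b')"
proof -
  note bl = assms[unfolded bilinear_def]
  have "f u v = f (\<Sum>b\<in>Basis. (u \<bullet> b) *\<^sub>R b) (\<Sum>b'\<in>Basis. (v \<bullet> b') *\<^sub>R b')"
    by (simp add: euclidean_representation)
  also have "\<dots> = (\<Sum>b\<in>Basis. \<Sum>b'\<in>Basis. f ((u \<bullet> b) *\<^sub>R b) ((v \<bullet> b') *\<^sub>R b'))"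
    by (simp only: linear_sum[OF bl[THEN conjunct2, rule_format]] linear_sum[OF bl[THEN conjunct1, rule_format]])
       (rule sum.swap)
  finally show ?thesis by (simp add: bilinear_lmul[OF assms] bilinear_rmul[OF assms] mult_ac)
qed

locale inner_form =
  fixes B :: "'e::euclidean_space \<Rightarrow> 'e \<Rightarrow> real"
  assumes bilin: "bilinear B" and sym: "B u v = B v u" and pos: "u \<noteq> 0 \<Longrightarrow> 0 < B u u"
begin

lemma lin_right: "linear (B u)"
  using bilin by (auto simp: bilinear_def)

lemmas add_left = bilinear_ladd[OF bilin]
lemmas add_right = bilinear_radd[OF bilin]
lemmas scale_left = bilinear_lmul[OF bilin, unfolded real_scaleR_def]
lemmas scale_right = bilinear_rmul[OF bilin, unfolded real_scaleR_def]
lemmas zero_left = bilinear_lzero[OF bilin]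
lemmas zero_right = bilinear_rzero[OF bilin]
lemmas minus_left = bilinear_lneg[OF bilin]
lemmas minus_right = bilinear_rneg[OF bilin]
lemmas diff_left = bilinear_lsub[OF bilin]
lemmas diff_right = bilinear_rsub[OF bilin]
lemmas bilin_simps = add_left add_right scale_left scale_right zero_left zero_right
  minus_left minus_right diff_left diff_right

lemma nonneg: "0 \<le> B u u"
  using pos[of u] by (cases "u = 0") (auto simp: zero_left)

lemma eq_0_iff: "B u u = 0 \<longleftrightarrow> u = 0"
  using pos[of u] by (cases "u = 0") (simp_all add: zero_left)

lemma eqI: "(\<And>z. B u z = B v z) \<Longrightarrow> u = v"
  using eq_0_iff[of "u - v"] by (simp add: diff_left)

text \<open>The map sending \<open>w\<close> to the coordinates of the form \<open>B w\<close> is injective by positivity, hence onto.\<close>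

lemma riesz:
  assumes "linear l"
  shows "\<exists>!w. \<forall>z. B w z = l z"
proof -
  let ?T = "\<lambda>w. \<Sum>b\<in>Basis. B w b *\<^sub>R b"
  have expand: "k z = (\<Sum>b\<in>Basis. (z \<bullet> b) * k b)" if "linear k" for k :: "'e \<Rightarrow> real" and z
  proof -
    have "k (\<Sum>b\<in>Basis. (z \<bullet> b) *\<^sub>R b) = (\<Sum>b\<in>Basis. (z \<bullet> b) * k b)"
      by (subst linear_sum[OF that], subst linear_scale[OF that]) simp
    then show ?thesis by (simp only: euclidean_representation)
  qed
  have linT: "linear ?T"
    by (rule linearI) (simp_all add: add_left scale_left scaleR_left_distrib sum.distrib scaleR_sum_right)
  have "w = 0" if "?T w = 0" for w
  proof -
    have "B w b = 0" if "b \<in> Basis" for b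
      using arg_cong[OF \<open>?T w = 0\<close>, of "\<lambda>x. x \<bullet> b"] that by simp
    then have "B w w = 0" using expand[OF lin_right, of w w] by simp
    then show "w = 0" by (simp add: eq_0_iff)
  qed
  then have "inj ?T" using linT by (simp add: linear_injective_0)
  then have "surj ?T" using linT linear_injective_imp_surjective by blast
  from surjD[OF this, of "\<Sum>b\<in>Basis. l b *\<^sub>R b"]
  obtain w where w: "(\<Sum>b\<in>Basis. l b *\<^sub>R b) = ?T w" by blast
  have "B w b = l b" if "b \<in> Basis" for b
    using arg_cong[OF w, of "\<lambda>x. x \<bullet> b"] that by simp
  then have "B w z = l z" for z
    using expand[OF lin_right, of w z] expand[OF assms, of z] by simp
  then show ?thesis using eqI by metis
qed

lemma pullback:
  fixes D :: "'d::euclidean_space \<Rightarrow> 'e"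
  assumes "linear D" "inj D"
  shows "inner_form (\<lambda>u v. B (D u) (D v))"
proof
  show "bilinear (\<lambda>u v. B (D u) (D v))"
    using assms(1) by (auto intro!: linearI simp: bilinear_def bilin_simps linear_add[OF assms(1)] linear_scale[OF assms(1)])
  show "0 < B (D u) (D u)" if "u \<noteq> 0" for u
    using that pos[of "D u"] linear_injective_0[OF assms(1)] assms(2) by auto
qed (rule sym)

text \<open>The projection onto the image of \<open>D\<close> is \<open>D a\<close>, where \<open>a\<close> represents the form \<open>z \<mapsto> B v (D z)\<close> for the
  pulled back inner product.\<close>

lemma orthogonal_projection:
  fixes D :: "'d::euclidean_space \<Rightarrow> 'e"
  assumes "linear D" "inj D"
  shows "\<exists>!w. w \<in> range D \<and> (\<forall>u. B (v - w) (D u) = 0)"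
proof -
  interpret P: inner_form "\<lambda>u v. B (D u) (D v)" using pullback[OF assms] .
  have "linear (\<lambda>z. B v (D z))"
    using linear_compose[OF assms(1) lin_right] by (simp add: o_def)
  from P.riesz[OF this] obtain a where a: "\<And>z. B (D a) (D z) = B v (D z)" by blast
  show ?thesis
  proof (intro ex1I[of _ "D a"] conjI allI)
    show "B (v - D a) (D u) = 0" for u by (simp add: diff_left a)
    fix w assume w: "w \<in> range D \<and> (\<forall>u. B (v - w) (D u) = 0)"
    then obtain b where b: "w = D b" by blast
    have "B (D b) (D z) = B (D a) (D z)" for z
      using w a[of z] by (simp add: b diff_left)
    then show "w = D a" using P.eqI b by blast
  qed auto
qed

lemma cauchy_schwarz: "(B x y)\<^sup>2 \<le> B x x * B y y"
proof (cases "y = 0")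
  case False
  have "0 \<le> B (B y y *\<^sub>R x - B x y *\<^sub>R y) (B y y *\<^sub>R x - B x y *\<^sub>R y)"
    by (rule nonneg)
  also have "\<dots> = B y y * (B x x * B y y - (B x y)\<^sup>2)"
    by (simp add: bilin_simps sym[of y x] power2_eq_square algebra_simps)
  finally show ?thesis using pos[OF False] by (simp add: zero_le_mult_iff)
qed (simp add: bilin_simps)

text \<open>Wirtinger's inequality: in the Cauchy-Schwarz inequality for \<open>J x\<close> and \<open>y\<close>, the vector \<open>y\<close> may
  be replaced by its component orthogonal to \<open>x\<close>, because \<open>J x\<close> is orthogonal to \<open>x\<close>.\<close>

lemma wirtinger:
  assumes "\<And>u v. B (J u) (J v) = B u v" "\<And>u. J (J u) = - u"
  shows "(B (J x) y)\<^sup>2 \<le> B x x * B y y - (B x y)\<^sup>2"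
proof (cases "x = 0")
  case False
  have "B (J x) x = - B (J x) x"
    using assms(1)[of "J x" x] assms(2)[of x] by (simp add: bilin_simps sym[of x])
  then have 0: "B (J x) x = 0" by simp
  let ?y = "B x x *\<^sub>R y - B x y *\<^sub>R x"
  have "(B (J x) ?y)\<^sup>2 \<le> B (J x) (J x) * B ?y ?y" by (rule cauchy_schwarz)
  then have "(B x x)\<^sup>2 * (B (J x) y)\<^sup>2 \<le> (B x x)\<^sup>2 * (B x x * B y y - (B x y)\<^sup>2)"
    by (simp add: assms bilin_simps 0 sym[of y x] power2_eq_square algebra_simps)
  then show ?thesis using pos[OF False] by (simp add: mult_le_cancel_left)
next
  case True
  have "J 0 = 0" using assms(1)[of 0 0] by (simp add: bilin_simps eq_0_iff)
  then show ?thesis by (simp add: True bilin_simps)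
qed

end

subsection \<open>Inner products on the plane\<close>

abbreviation ex :: "real^2" where "ex \<equiv> axis 1 1"
abbreviation ey :: "real^2" where "ey \<equiv> axis 2 1"

lemma plane_expansion: "u = u $ 1 *\<^sub>R ex + u $ 2 *\<^sub>R ey"
  by (simp add: vec_eq_iff forall_2 axis_def)

lemma linear_plane:
  assumes "linear L"
  shows "L u = u $ 1 *\<^sub>R L ex + u $ 2 *\<^sub>R L ey"
  by (subst plane_expansion[of u]) (simp add: linear_add[OF assms] linear_scale[OF assms])

lemma bilinear_plane:
  assumes "bilinear S"
  shows "S u v = (u $ 1 * v $ 1) *\<^sub>R S ex ex + (u $ 1 * v $ 2) *\<^sub>R S ex ey
     + (u $ 2 * v $ 1) *\<^sub>R S ey ex + (u $ 2 * v $ 2) *\<^sub>R S ey ey"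
  by (subst plane_expansion[of u], subst plane_expansion[of v])
     (simp add: bilinear_ladd[OF assms] bilinear_radd[OF assms] bilinear_lmul[OF assms] bilinear_rmul[OF assms]
       algebra_simps)

definition gram :: "(real^2 \<Rightarrow> real^2 \<Rightarrow> real) \<Rightarrow> real" where
  "gram h = h ex ex * h ey ey - (h ex ey)\<^sup>2"

text \<open>Lagrange's identity: a change of the pair of vectors multiplies the Gram determinant by the square of the
  determinant of the change.\<close>

lemma gram_identity:
  assumes "bilinear h" "\<And>u v. h u v = h v u"
  shows "h u u * h v v - (h u v)\<^sup>2 = gram h * (u $ 1 * v $ 2 - u $ 2 * v $ 1)\<^sup>2"
  unfolding gram_def bilinear_plane[OF assms(1), of u] bilinear_plane[OF assms(1), of v]
    assms(2)[of ey ex] by (simp add: power2_eq_square algebra_simps)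

locale plane_form = inner_form h for h :: "real^2 \<Rightarrow> real^2 \<Rightarrow> real"
begin

lemma gram_pos: "0 < gram h"
proof -
  let ?w = "h ey ey *\<^sub>R ex - h ex ey *\<^sub>R ey"
  have e: "0 < h ey ey" by (rule pos) (simp add: axis_eq_0_iff)
  have "?w $ 1 \<noteq> 0" using e by (simp add: axis_def)
  then have "0 < h ?w ?w" by (intro pos) (metis zero_index)
  also have "h ?w ?w = h ey ey * gram h"
    by (simp add: bilin_simps sym[of ey ex] gram_def power2_eq_square algebra_simps)
  finally show ?thesis using e by (simp add: zero_less_mult_iff)
qed

lemma orthonormal_basis: obtains a b where "h a a = 1" "h b b = 1" "h a b = 0"
proof -
  have e: "0 < h ex ex" by (rule pos) (simp add: axis_eq_0_iff)
  let ?b = "h ex ex *\<^sub>R ey - h ex ey *\<^sub>R ex"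
  have b: "h ?b ?b = h ex ex * gram h"
    by (simp add: bilin_simps sym[of ey ex] gram_def power2_eq_square algebra_simps)
  have s: "1 / sqrt x * (1 / sqrt x * x) = 1" if "x > 0" for x
    using that by (simp add: field_simps)
  show ?thesis
  proof (rule that)
    show "h ((1 / sqrt (h ex ex)) *\<^sub>R ex) ((1 / sqrt (h ex ex)) *\<^sub>R ex) = 1"
      using s[OF e] by (simp add: bilin_simps)
    show "h ((1 / sqrt (h ?b ?b)) *\<^sub>R ?b) ((1 / sqrt (h ?b ?b)) *\<^sub>R ?b) = 1"
      using s[of "h ?b ?b"] b e gram_pos by (simp only: scale_left scale_right) simp
    show "h ((1 / sqrt (h ex ex)) *\<^sub>R ex) ((1 / sqrt (h ?b ?b)) *\<^sub>R ?b) = 0"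
      by (simp only: scale_left scale_right) (simp add: bilin_simps sym[of ey ex])
  qed
qed

text \<open>The trace of a bilinear map over an orthonormal basis is its contraction with the inverse
  metric: the vector dual to a coordinate function has that coordinate of the basis vectors as
  its coefficients.\<close>

lemma trace_orthonormal:
  fixes S :: "real^2 \<Rightarrow> real^2 \<Rightarrow> 'v::real_vector"
  assumes S: "bilinear S" and on: "h a a = 1" "h b b = 1" "h a b = 0"
  shows "S a a + S b b = (1 / gram h) *\<^sub>R (h ey ey *\<^sub>R S ex ex - h ex ey *\<^sub>R (S ex ey + S ey ex) + h ex ex *\<^sub>R S ey ey)"
proof -
  define d where "d = a $ 1 * b $ 2 - a $ 2 * b $ 1"
  have "gram h * d\<^sup>2 = 1"
    using gram_identity[OF bilin sym, of a b] on by (simp add: d_def)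
  then have d: "d \<noteq> 0" by auto
  have complete: "h z w = h z a * h w a + h z b * h w b" for z w
  proof -
    let ?r = "z - h z a *\<^sub>R a - h z b *\<^sub>R b"
    have o: "h ?r a = 0" "h ?r b = 0"
      using on by (simp_all add: bilin_simps sym[of b a])
    have "d *\<^sub>R ?r = (?r $ 1 * b $ 2 - ?r $ 2 * b $ 1) *\<^sub>R a + (a $ 1 * ?r $ 2 - a $ 2 * ?r $ 1) *\<^sub>R b"
      by (simp add: vec_eq_iff forall_2 d_def algebra_simps)
    then have "h ?r (d *\<^sub>R ?r) = 0" using o by (simp only: add_right scale_right)
    then have "?r = 0" using d eq_0_iff by (simp only: scale_right) simp
    then have "z = h z a *\<^sub>R a + h z b *\<^sub>R b" by (simp add: algebra_simps)
    then have "h z w = h (h z a *\<^sub>R a + h z b *\<^sub>R b) w" by simp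
    then show ?thesis by (simp add: bilin_simps sym[of w])
  qed
  define D where "D = gram h"
  have D: "D > 0" using gram_pos by (simp add: D_def)
  define z1 where "z1 = (1 / D) *\<^sub>R (h ey ey *\<^sub>R ex - h ex ey *\<^sub>R ey)"
  define z2 where "z2 = (1 / D) *\<^sub>R (h ex ex *\<^sub>R ey - h ex ey *\<^sub>R ex)"
  have z1: "h z1 u = u $ 1" and z2: "h z2 u = u $ 2" for u
  proof -
    have "h z1 u = u $ 1 * h z1 ex + u $ 2 * h z1 ey" "h z2 u = u $ 1 * h z2 ex + u $ 2 * h z2 ey"
      using linear_plane[OF lin_right, of z1 u] linear_plane[OF lin_right, of z2 u] by simp_all
    moreover have "h z1 ex = 1" "h z1 ey = 0" "h z2 ex = 0" "h z2 ey = 1"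
      using D by (simp_all add: z1_def z2_def bilin_simps sym[of ey ex] divide_simps)
        (simp_all add: D_def gram_def power2_eq_square algebra_simps)
    ultimately show "h z1 u = u $ 1" "h z2 u = u $ 2" by simp_all
  qed
  have "a $ 1 * a $ 1 + b $ 1 * b $ 1 = h ey ey / D"
    using complete[of z1 z1] unfolding z1 by (simp add: z1_def axis_def)
  moreover have "a $ 1 * a $ 2 + b $ 1 * b $ 2 = - h ex ey / D"
    using complete[of z1 z2] unfolding z1 z2 by (simp add: z2_def axis_def)
  moreover have "a $ 2 * a $ 2 + b $ 2 * b $ 2 = h ex ex / D"
    using complete[of z2 z2] unfolding z2 by (simp add: z2_def axis_def)
  moreover have "S a a + S b b = (a $ 1 * a $ 1 + b $ 1 * b $ 1) *\<^sub>R S ex ex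
      + (a $ 1 * a $ 2 + b $ 1 * b $ 2) *\<^sub>R (S ex ey + S ey ex) + (a $ 2 * a $ 2 + b $ 2 * b $ 2) *\<^sub>R S ey ey"
    by (subst bilinear_plane[OF S, of a], subst bilinear_plane[OF S, of b]) (simp add: algebra_simps)
  ultimately show ?thesis
    by (simp add: D_def[symmetric] scaleR_add_right scaleR_diff_right divide_inverse mult.commute)
qed

end

section \<open>Metrics in a chart and their connections\<close>

text \<open>The metric connection without torsion is forced by the Koszul formula, and the vector
  prescribed by that formula exists by the representation of linear forms.\<close>

lemma koszul:
  assumes "inner_form B"
    and K: "\<And>u v. linear (\<lambda>w. K w u v)" "\<And>w. bilinear (K w)" "\<And>w u v. K w u v = K w v u"
  shows "\<exists>!\<Gamma>. bilinear \<Gamma> \<and> (\<forall>u v. \<Gamma> u v = \<Gamma> v u) \<and> (\<forall>w u v. K w u v = B (\<Gamma> w u) v + B u (\<Gamma> w v))"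
proof -
  interpret inner_form B by fact
  have Ka: "K (x + y) u v = K x u v + K y u v" "K (r *\<^sub>R x) u v = r * K x u v" for x y r u v
    using K(1)[of u v] by (simp_all add: linear_iff)
  have Kb: "K w (x + y) v = K w x v + K w y v" "K w (r *\<^sub>R x) v = r * K w x v"
      "K w v (x + y) = K w v x + K w v y" "K w v (r *\<^sub>R x) = r * K w v x" for x y r w v
    using K(2)[of w] by (simp_all add: bilinear_def linear_iff)
  define k where "k u v z = (K u v z + K v u z - K z u v) / 2" for u v z
  have "linear (k u v)" for u v
    by (rule linearI) (simp_all add: k_def Ka Kb field_simps)
  then have ex: "\<exists>!w. \<forall>z. B w z = k u v z" for u v by (rule riesz)
  define \<Gamma> where "\<Gamma> u v = (THE w. \<forall>z. B w z = k u v z)" for u v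
  have \<Gamma>: "B (\<Gamma> u v) z = k u v z" for u v z
    unfolding \<Gamma>_def using theI'[OF ex] by blast
  show ?thesis
  proof (intro ex1I[of _ \<Gamma>] conjI allI)
    show "bilinear \<Gamma>"
      unfolding bilinear_def
      by (intro conjI allI linearI eqI) (simp_all add: bilin_simps \<Gamma> k_def Ka Kb field_simps)
    show "\<Gamma> u v = \<Gamma> v u" for u v
      by (rule eqI) (simp add: \<Gamma> k_def K(3)[of _ u v])
    show "K w u v = B (\<Gamma> w u) v + B u (\<Gamma> w v)" for w u v
    proof -
      have "B u (\<Gamma> w v) = k w v u" by (simp only: sym[of u] \<Gamma>)
      then show ?thesis unfolding \<Gamma> by (simp add: k_def K(3)[of w v u] field_simps)
    qed
    fix \<Delta> assume \<Delta>: "bilinear \<Delta> \<and> (\<forall>u v. \<Delta> u v = \<Delta> v u) \<and> (\<forall>w u v. K w u v = B (\<Delta> w u) v + B u (\<Delta> w v))"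
    have "B (\<Delta> u v) z = k u v z" for u v z
    proof -
      have "K u v z = B (\<Delta> u v) z + B v (\<Delta> u z)" "K v u z = B (\<Delta> v u) z + B u (\<Delta> v z)"
        "K z u v = B (\<Delta> z u) v + B u (\<Delta> z v)" "\<Delta> v u = \<Delta> u v" "\<Delta> z u = \<Delta> u z" "\<Delta> z v = \<Delta> v z"
        using \<Delta> by blast+
      then show ?thesis by (simp add: k_def sym[of v])
    qed
    then show "\<Delta> = \<Gamma>" by (intro ext eqI) (simp add: \<Gamma>)
  qed
qed

text \<open>The coordinate description of a Riemannian metric on an open set. The functions \<open>dg y w\<close> below are the
  derivatives of its coefficients, which form a symmetric bilinear form again.\<close>

locale metric_field =
  fixes V :: "'e::euclidean_space set" and g :: "'e \<Rightarrow> 'e \<Rightarrow> 'e \<Rightarrow> real"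
  assumes open_V: "open V" and smooth_g: "smooth_on (\<lambda>y. g y u v) V"
    and inner_g: "y \<in> V \<Longrightarrow> inner_form (g y)"
begin

definition dg :: "'e \<Rightarrow> 'e \<Rightarrow> 'e \<Rightarrow> 'e \<Rightarrow> real" where
  "dg y w u v = frechet_derivative (\<lambda>y. g y u v) (at y) w"

lemma g_derivative: "y \<in> V \<Longrightarrow> ((\<lambda>y. g y u v) has_derivative (\<lambda>w. dg y w u v)) (at y)"
  unfolding dg_def using smooth_on_has_derivative[OF smooth_g] .

lemma dg_unique: "((\<lambda>y. g y u v) has_derivative D) (at y) \<Longrightarrow> dg y w u v = D w"
  unfolding dg_def using frechet_derivative_at by metis

lemma dg_linear: "y \<in> V \<Longrightarrow> linear (\<lambda>w. dg y w u v)"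
  using g_derivative has_derivative_linear by blast

lemma dg_cong:
  assumes "y \<in> V" "((\<lambda>y. f y) has_derivative D) (at y)" "\<And>y. y \<in> V \<Longrightarrow> f y = g y u v"
  shows "dg y w u v = D w"
  by (rule dg_unique, rule has_derivative_transform_within_open[OF assms(2) open_V assms(1)]) (rule assms(3))

lemma dg_sym: "y \<in> V \<Longrightarrow> dg y w u v = dg y w v u"
  by (rule dg_cong[OF _ g_derivative]) (auto simp: inner_form.sym[OF inner_g])

lemma dg_bilinear:
  assumes y: "y \<in> V"
  shows "bilinear (dg y w)"
proof -
  have 1: "dg y w (u + u') v = dg y w u v + dg y w u' v" for u u' v
    by (rule dg_cong[OF y has_derivative_add[OF g_derivative[OF y] g_derivative[OF y]]])
       (simp add: inner_form.add_left[OF inner_g])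
  have 2: "dg y w (r *\<^sub>R u) v = r * dg y w u v" for r u v
    by (rule dg_cong[OF y has_derivative_mult_right[OF g_derivative[OF y]]])
       (simp add: inner_form.scale_left[OF inner_g])
  show ?thesis
    unfolding bilinear_def
  proof (intro conjI allI linearI)
    show "dg y w v (u + u') = dg y w v u + dg y w v u'" for u u' v
      using 1[of u u' v] dg_sym[OF y] by metis
    show "dg y w v (r *\<^sub>R u) = r *\<^sub>R dg y w v u" for r u v
      using 2[of r u v] dg_sym[OF y] by (metis real_scaleR_def)
  qed (simp_all add: 1 2)
qed

lemmas metric_expansion = bilinear_basis_expansion[OF inner_form.bilin[OF inner_g]]
lemmas dg_expansion = bilinear_basis_expansion[OF dg_bilinear]

lemma smooth_on_metric:
  fixes \<phi> u v :: "'z::real_normed_vector \<Rightarrow> 'e"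
  assumes W: "open W" and \<phi>: "smooth_on \<phi> W" "\<phi> ` W \<subseteq> V" and u: "smooth_on u W" and v: "smooth_on v W"
  shows "smooth_on (\<lambda>z. g (\<phi> z) (u z) (v z)) W"
proof (rule smooth_on_eq[OF _ W])
  have "smooth_on (\<lambda>z. g (\<phi> z) b b') W" for b b'
    by (rule smooth_on_compose[OF W open_V \<phi>(2) smooth_g \<phi>(1)])
  then show "smooth_on (\<lambda>z. \<Sum>b\<in>Basis. \<Sum>b'\<in>Basis. ((u z \<bullet> b) * (v z \<bullet> b')) * g (\<phi> z) b b') W"
    by (intro smooth_on_sum W smooth_on_mult smooth_on_inner u v smooth_on_const)
  show "(\<Sum>b\<in>Basis. \<Sum>b'\<in>Basis. ((u z \<bullet> b) * (v z \<bullet> b')) * g (\<phi> z) b b') = g (\<phi> z) (u z) (v z)"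
    if "z \<in> W" for z
    using metric_expansion[of "\<phi> z" "u z" "v z"] that \<phi>(2) by auto
qed

lemma metric_has_derivative:
  fixes \<phi> u v :: "'z::real_normed_vector \<Rightarrow> 'e"
  assumes W: "open W" "z \<in> W" "\<phi> ` W \<subseteq> V"
    and d: "(\<phi> has_derivative \<phi>') (at z)" "(u has_derivative u') (at z)" "(v has_derivative v') (at z)"
  shows "((\<lambda>z. g (\<phi> z) (u z) (v z)) has_derivative
    (\<lambda>h. dg (\<phi> z) (\<phi>' h) (u z) (v z) + g (\<phi> z) (u' h) (v z) + g (\<phi> z) (u z) (v' h))) (at z)"
proof -
  let ?y = "\<phi> z"
  have y: "?y \<in> V" using W by auto
  have G: "((\<lambda>z. g (\<phi> z) b b') has_derivative (\<lambda>h. dg ?y (\<phi>' h) b b')) (at z)" for b b'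
    using diff_chain_at[OF d(1) g_derivative[OF y]] by (simp add: o_def)
  have "((\<lambda>z. \<Sum>b\<in>Basis. \<Sum>b'\<in>Basis. ((u z \<bullet> b) * (v z \<bullet> b')) * g (\<phi> z) b b') has_derivative
     (\<lambda>h. \<Sum>b\<in>Basis. \<Sum>b'\<in>Basis. ((u z \<bullet> b) * (v z \<bullet> b')) * dg ?y (\<phi>' h) b b'
        + ((u z \<bullet> b) * (v' h \<bullet> b') + (u' h \<bullet> b) * (v z \<bullet> b')) * g ?y b b')) (at z)"
    by (intro has_derivative_sum has_derivative_mult G has_derivative_inner_left d)
  then have "((\<lambda>z. g (\<phi> z) (u z) (v z)) has_derivative
     (\<lambda>h. \<Sum>b\<in>Basis. \<Sum>b'\<in>Basis. ((u z \<bullet> b) * (v z \<bullet> b')) * dg ?y (\<phi>' h) b b'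
        + ((u z \<bullet> b) * (v' h \<bullet> b') + (u' h \<bullet> b) * (v z \<bullet> b')) * g ?y b b')) (at z)"
    by (rule has_derivative_transform_within_open[OF _ W(1,2)])
       (use W(3) metric_expansion in \<open>auto simp: image_subset_iff\<close>)
  moreover have "(\<Sum>b\<in>Basis. \<Sum>b'\<in>Basis. ((u z \<bullet> b) * (v z \<bullet> b')) * dg ?y (\<phi>' h) b b'
        + ((u z \<bullet> b) * (v' h \<bullet> b') + (u' h \<bullet> b) * (v z \<bullet> b')) * g ?y b b')
      = dg ?y (\<phi>' h) (u z) (v z) + g ?y (u' h) (v z) + g ?y (u z) (v' h)" for h
    unfolding dg_expansion[OF y, of _ "u z" "v z"] metric_expansion[OF y, of "u' h"] metric_expansion[OF y, of _ "v' h"]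
    by (simp add: sum.distrib algebra_simps)
  ultimately show ?thesis by simp
qed

lemma metric_frechet_derivative:
  fixes \<phi> u v :: "'z::real_normed_vector \<Rightarrow> 'e"
  assumes W: "open W" "z \<in> W" and \<phi>: "smooth_on \<phi> W" "\<phi> ` W \<subseteq> V" and u: "smooth_on u W" and v: "smooth_on v W"
  shows "frechet_derivative (\<lambda>z. g (\<phi> z) (u z) (v z)) (at z) h
    = dg (\<phi> z) (frechet_derivative \<phi> (at z) h) (u z) (v z)
      + g (\<phi> z) (frechet_derivative u (at z) h) (v z) + g (\<phi> z) (u z) (frechet_derivative v (at z) h)"
  by (rule frechet_derivative_eq[OF metric_has_derivative[OF W \<phi>(2)
      smooth_on_has_derivative[OF \<phi>(1) W(2)] smooth_on_has_derivative[OF u W(2)] smooth_on_has_derivative[OF v W(2)]]])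

definition christoffel :: "'e \<Rightarrow> 'e \<Rightarrow> 'e \<Rightarrow> 'e" where
  "christoffel y = (THE \<Gamma>. bilinear \<Gamma> \<and> (\<forall>u v. \<Gamma> u v = \<Gamma> v u) \<and>
     (\<forall>w u v. dg y w u v = g y (\<Gamma> w u) v + g y u (\<Gamma> w v)))"

lemma
  assumes "y \<in> V"
  shows christoffel_bilinear: "bilinear (christoffel y)"
    and christoffel_sym: "christoffel y u v = christoffel y v u"
    and christoffel_metric: "dg y w u v = g y (christoffel y w u) v + g y u (christoffel y w v)"
  using theI'[OF koszul[OF inner_g[OF assms] dg_linear[OF assms] dg_bilinear[OF assms] dg_sym[OF assms]]]
  unfolding christoffel_def by blast+

end

section \<open>The first variation of the density in coordinates\<close>

lemma cplx_str_linear: "linear cplx_str"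
  by (rule linearI) (simp_all add: cplx_str_def vec_eq_iff algebra_simps)

lemma cplx_str_square: "cplx_str (cplx_str v) = - v"
  by (simp add: cplx_str_def vec_eq_iff)

lemma linear_slice:
  fixes L :: "real \<times> 'a::real_normed_vector \<Rightarrow> 'b::real_normed_vector"
  assumes "linear L"
  shows "linear (\<lambda>a. L (0, a))"
proof -
  have "linear (\<lambda>a::'a. (0::real, a))" by (rule linearI) simp_all
  from linear_compose[OF this assms] show ?thesis by (simp add: o_def)
qed

lemma has_derivative_powr_const:
  fixes f :: "'a::real_normed_vector \<Rightarrow> real"
  assumes "(f has_derivative f') (at x)" "0 < f x"
  shows "((\<lambda>x. f x powr a) has_derivative (\<lambda>h. a * f x powr (a - 1) * f' h)) (at x)"
proof -
  have "((\<lambda>y. y powr a) has_real_derivative a * f x powr (a - 1)) (at (f x))"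
    by (rule has_real_derivative_powr[OF assms(2)])
  from diff_chain_at[OF assms(1) this[unfolded has_field_derivative_def]]
  show ?thesis by (simp add: o_def)
qed

locale hermitian_field = metric_field V g
  for V :: "(complex^2) set" and g :: "complex^2 \<Rightarrow> complex^2 \<Rightarrow> complex^2 \<Rightarrow> real" +
  assumes J_isometry: "y \<in> V \<Longrightarrow> g y (cplx_str u) (cplx_str v) = g y u v"
begin

lemma J_skew: "y \<in> V \<Longrightarrow> g y (cplx_str u) v = - g y u (cplx_str v)"
  using J_isometry[of y u "cplx_str v"] by (simp add: cplx_str_square inner_form.minus_right[OF inner_g])

text \<open>The cyclic sum of \<open>\<nabla>J\<close> is the exterior derivative of the Kaehler form: the terms with the
  connection cancel because it is symmetric and the Kaehler form is alternating.\<close>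

lemma cyclic_nabla_J:
  assumes y: "y \<in> V"
  defines "\<Gamma> \<equiv> christoffel y"
  shows "g y (\<Gamma> u (cplx_str v) - cplx_str (\<Gamma> u v)) w + g y (\<Gamma> v (cplx_str w) - cplx_str (\<Gamma> v w)) u
      + g y (\<Gamma> w (cplx_str u) - cplx_str (\<Gamma> w u)) v
    = dg y u (cplx_str v) w + dg y v (cplx_str w) u + dg y w (cplx_str u) v"
proof -
  interpret inner_form "g y" using inner_g[OF y] .
  have sk: "g y (cplx_str a) b = - g y (cplx_str b) a" for a b
    using J_skew[OF y, of a b] sym[of a] by simp
  have s: "\<Gamma> a b = \<Gamma> b a" for a b unfolding \<Gamma>_def by (rule christoffel_sym[OF y])
  have m: "dg y a (cplx_str b) e = g y (\<Gamma> a (cplx_str b)) e + g y (cplx_str b) (\<Gamma> a e)" for a b e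
    unfolding \<Gamma>_def by (rule christoffel_metric[OF y])
  show ?thesis
    unfolding m diff_left s[of w u] s[of v u] s[of w v] sk[of v "\<Gamma> u w"] sk[of w "\<Gamma> u v"] sk[of u "\<Gamma> v w"]
    by simp
qed

end

text \<open>A family of maps from a plane domain into a coordinate domain of a Hermite surface, depending on the time
  as first argument. Positivity of the Gram determinant is left to later assumptions, so that families
  that have yet to be shown to consist of immersions are covered.\<close>

locale surface_family = hermitian_field V g
  for V :: "(complex^2) set" and g :: "complex^2 \<Rightarrow> complex^2 \<Rightarrow> complex^2 \<Rightarrow> real" +
  fixes W :: "(real \<times> (real^2)) set" and \<phi> :: "real \<times> (real^2) \<Rightarrow> complex^2"
  assumes open_W: "open W" and smooth_phi: "smooth_on \<phi> W" and phi_V: "z \<in> W \<Longrightarrow> \<phi> z \<in> V"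
begin

text \<open>\<open>P a\<close> is the image of the constant field \<open>a\<close> under the differential of the map at fixed time, and \<open>T\<close> the
  variational field; \<open>E\<close> are the coefficients of the induced metric, \<open>kf\<close> is the coefficient of the pulled back
  Kaehler form \<open>\<omega>\<close>, and \<open>eta\<close> is the one-form \<open>\<omega>(T, \<cdot>)\<close>.\<close>

definition P :: "real^2 \<Rightarrow> real \<times> (real^2) \<Rightarrow> complex^2" where
  "P a z = frechet_derivative \<phi> (at z) (0, a)"
definition T :: "real \<times> (real^2) \<Rightarrow> complex^2" where
  "T z = frechet_derivative \<phi> (at z) (1, 0)"
definition E :: "real^2 \<Rightarrow> real^2 \<Rightarrow> real \<times> (real^2) \<Rightarrow> real" where
  "E a b z = g (\<phi> z) (P a z) (P b z)"
definition Gram :: "real \<times> (real^2) \<Rightarrow> real" where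
  "Gram z = gram (\<lambda>a b. E a b z)"
definition area :: "real \<times> (real^2) \<Rightarrow> real" where
  "area z = sqrt (Gram z)"
definition kf :: "real \<times> (real^2) \<Rightarrow> real" where
  "kf z = g (\<phi> z) (cplx_str (P ex z)) (P ey z)"
definition kcos :: "real \<times> (real^2) \<Rightarrow> real" where
  "kcos z = kf z / area z"
definition eta :: "real^2 \<Rightarrow> real \<times> (real^2) \<Rightarrow> real" where
  "eta a z = g (\<phi> z) (cplx_str (T z)) (P a z)"

lemma phi_image: "\<phi> ` W \<subseteq> V" using phi_V by auto

lemma P_linear: "z \<in> W \<Longrightarrow> linear (\<lambda>a. P a z)"
  unfolding P_def by (rule linear_slice[OF smooth_on_linear_derivative[OF smooth_phi]])

lemma smooth_P: "smooth_on (P a) W" and smooth_T: "smooth_on T W"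
  unfolding P_def T_def by (rule smooth_on_derivative[OF smooth_phi])+

lemma smooth_E: "smooth_on (E a b) W"
  unfolding E_def by (rule smooth_on_metric[OF open_W smooth_phi phi_image smooth_P smooth_P])

lemma smooth_Gram: "smooth_on Gram W"
  unfolding Gram_def gram_def by (intro smooth_on_diff smooth_on_mult smooth_on_power2 open_W smooth_E)

lemma smooth_kf: "smooth_on kf W"
  unfolding kf_def
  by (rule smooth_on_metric[OF open_W smooth_phi phi_image smooth_on_linear_compose[OF open_W cplx_str_linear smooth_P] smooth_P])

lemma smooth_eta: "smooth_on (eta a) W"
  unfolding eta_def
  by (rule smooth_on_metric[OF open_W smooth_phi phi_image smooth_on_linear_compose[OF open_W cplx_str_linear smooth_T] smooth_P])

lemma inner_phi: "z \<in> W \<Longrightarrow> inner_form (g (\<phi> z))"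
  using inner_g phi_V by blast

lemma E_sym: "z \<in> W \<Longrightarrow> E a b z = E b a z"
  unfolding E_def by (rule inner_form.sym[OF inner_phi])

lemma Gram_pos_imp_inj:
  assumes z: "z \<in> W" "0 < Gram z"
  shows "inj (\<lambda>a. P a z)"
proof -
  interpret inner_form "g (\<phi> z)" using inner_phi z(1) .
  have bl: "bilinear (\<lambda>a b. E a b z)"
    unfolding E_def bilinear_def
    by (auto intro!: linearI simp: bilin_simps linear_add[OF P_linear[OF z(1)]] linear_scale[OF P_linear[OF z(1)]])
  have "a = 0" if a: "P a z = 0" for a
  proof -
    have "E a b z = 0" for b :: "real^2" using a by (simp add: E_def zero_left)
    then have "Gram z * (a $ 1 * b $ 2 - a $ 2 * b $ 1)\<^sup>2 = 0" for b :: "real^2"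
      using gram_identity[OF bl E_sym[OF z(1)], of a b] by (simp add: Gram_def)
    from this[of ex] this[of ey] z(2) show "a = 0"
      by (simp add: axis_def vec_eq_iff forall_2)
  qed
  then show ?thesis using linear_injective_0[OF P_linear[OF z(1)]] by simp
qed

text \<open>The second derivative of the family is symmetric; hence so are the covariant derivatives of
  the coordinate fields, and the variational field may be differentiated in place of them.\<close>

lemma derivative_P_time: "z \<in> W \<Longrightarrow> frechet_derivative (P a) (at z) (1, 0) = frechet_derivative T (at z) (0, a)"
  unfolding P_def T_def by (rule second_derivative_symmetric[OF smooth_phi open_W])

lemma derivative_P_sym: "z \<in> W \<Longrightarrow> frechet_derivative (P a) (at z) (0, b) = frechet_derivative (P b) (at z) (0, a)"
  unfolding P_def by (rule second_derivative_symmetric[OF smooth_phi open_W])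

definition second_cov :: "real^2 \<Rightarrow> real^2 \<Rightarrow> real \<times> (real^2) \<Rightarrow> complex^2" where
  "second_cov a b z = frechet_derivative (P b) (at z) (0, a) + christoffel (\<phi> z) (P a z) (P b z)"

lemma second_cov_sym: "z \<in> W \<Longrightarrow> second_cov a b z = second_cov b a z"
  unfolding second_cov_def using derivative_P_sym christoffel_sym[OF phi_V] by simp

lemma frechet_derivative_zero_on_slice:
  fixes q :: "real \<times> (real^2) \<Rightarrow> real"
  assumes q: "smooth_on q W" and z: "(t, x) \<in> W" and 0: "\<And>x. (t, x) \<in> W \<Longrightarrow> q (t, x) = 0"
  shows "frechet_derivative q (at (t, x)) (0, a) = 0"
proof -
  note d = has_derivative_fix_fst[OF smooth_on_has_derivative[OF q z]]
  have "((\<lambda>x. 0) has_derivative (\<lambda>a. frechet_derivative q (at (t, x)) (0, a))) (at x)"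
    by (rule has_derivative_transform_within_open[OF d open_fix_fst[OF open_W]]) (use z 0 in auto)
  from has_derivative_unique[OF this has_derivative_const]
  show ?thesis by metis
qed

lemma derivative_E:
  "z \<in> W \<Longrightarrow> frechet_derivative (E a b) (at z) h
     = dg (\<phi> z) (frechet_derivative \<phi> (at z) h) (P a z) (P b z)
       + g (\<phi> z) (frechet_derivative (P a) (at z) h) (P b z) + g (\<phi> z) (P a z) (frechet_derivative (P b) (at z) h)"
  unfolding E_def by (rule metric_frechet_derivative[OF open_W _ smooth_phi phi_image smooth_P smooth_P])

text \<open>Differentiating \<open>\<langle>T, P b\<rangle> = 0\<close> along the surface moves the derivative from \<open>T\<close> to the coordinate field
  \<open>P b\<close>, where it becomes the second fundamental form; the terms with the connection match because it is
  symmetric and metric. Orthogonality is only known at one time, which suffices since it is differentiated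
  in directions of the surface.\<close>

lemma metric_variation:
  assumes z: "(t, x) \<in> W" and normal: "\<And>x a. (t, x) \<in> W \<Longrightarrow> g (\<phi> (t, x)) (T (t, x)) (P a (t, x)) = 0"
  defines "z \<equiv> (t, x)"
  shows "frechet_derivative (E a b) (at z) (1, 0) = - 2 * g (\<phi> z) (T z) (second_cov a b z)"
proof -
  have zW: "z \<in> W" using z by (simp add: z_def)
  interpret inner_form "g (\<phi> z)" using inner_phi[OF zW] .
  have *: "dg (\<phi> z) (P a z) (T z) (P b z) + g (\<phi> z) (frechet_derivative T (at z) (0, a)) (P b z)
     + g (\<phi> z) (T z) (frechet_derivative (P b) (at z) (0, a)) = 0" for a b
  proof -
    have "frechet_derivative (\<lambda>z. g (\<phi> z) (T z) (P b z)) (at z) (0, a) = 0"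
      unfolding z_def
      by (rule frechet_derivative_zero_on_slice[OF smooth_on_metric[OF open_W smooth_phi phi_image smooth_T smooth_P] z])
         (rule normal)
    then show ?thesis
      unfolding metric_frechet_derivative[OF open_W zW smooth_phi phi_image smooth_T smooth_P] by (simp add: P_def)
  qed
  note m = christoffel_metric[OF phi_V[OF zW]]
  note s = christoffel_sym[OF phi_V[OF zW]]
  have "frechet_derivative (E a b) (at z) (1, 0) = dg (\<phi> z) (T z) (P a z) (P b z)
     + g (\<phi> z) (frechet_derivative T (at z) (0, a)) (P b z) + g (\<phi> z) (frechet_derivative T (at z) (0, b)) (P a z)"
    unfolding derivative_E[OF zW] derivative_P_time[OF zW] sym[of "P a z"] by (simp add: T_def sym)
  also have "\<dots> = - g (\<phi> z) (T z) (second_cov a b z) - g (\<phi> z) (T z) (second_cov b a z)"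
    using *[of a b] *[of b a]
    unfolding m second_cov_def add_right s[of "T z"] by (simp add: sym)
  finally show ?thesis by (simp add: second_cov_sym[OF zW, of b a])
qed

text \<open>Cartan's formula for the derivative of the pulled back Kaehler form. The assumption says that the
  contraction of the exterior derivative of the Kaehler form with \<open>T\<close> vanishes on the surface; what remains is
  the exterior derivative of the contraction.\<close>

lemma kaehler_variation:
  assumes z: "z \<in> W"
    and closed: "dg (\<phi> z) (T z) (cplx_str (P ex z)) (P ey z) + dg (\<phi> z) (P ex z) (cplx_str (P ey z)) (T z)
      + dg (\<phi> z) (P ey z) (cplx_str (T z)) (P ex z) = 0"
  shows "frechet_derivative kf (at z) (1, 0)
    = frechet_derivative (eta ey) (at z) (0, ex) - frechet_derivative (eta ex) (at z) (0, ey)"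
proof -
  interpret inner_form "g (\<phi> z)" using inner_phi[OF z] .
  have J: "frechet_derivative (\<lambda>z. cplx_str (u z)) (at z) h = cplx_str (frechet_derivative u (at z) h)"
    if "smooth_on u W" for u :: "real \<times> (real^2) \<Rightarrow> complex^2" and h
  proof (rule frechet_derivative_eq)
    have "(cplx_str has_derivative cplx_str) (at (u z))"
      using cplx_str_linear by (simp add: linear_imp_has_derivative)
    from diff_chain_at[OF smooth_on_has_derivative[OF that z] this]
    show "((\<lambda>z. cplx_str (u z)) has_derivative (\<lambda>h. cplx_str (frechet_derivative u (at z) h))) (at z)"
      by (simp add: o_def)
  qed
  note sJ = smooth_on_linear_compose[OF open_W cplx_str_linear]
  have sk: "g (\<phi> z) (cplx_str a) b = - g (\<phi> z) (cplx_str b) a" for a b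
    using J_skew[OF phi_V[OF z], of a b] sym[of a] by simp
  have dsk: "dg (\<phi> z) w (cplx_str u) v = - dg (\<phi> z) w (cplx_str v) u" for w u v
  proof -
    have "dg (\<phi> z) w (cplx_str u) v = - dg (\<phi> z) w u (cplx_str v)"
      by (rule dg_cong[OF phi_V[OF z] has_derivative_minus[OF g_derivative[OF phi_V[OF z]]]]) (simp add: J_skew)
    then show ?thesis using dg_sym[OF phi_V[OF z]] by simp
  qed
  have kf: "frechet_derivative kf (at z) (1, 0) = dg (\<phi> z) (T z) (cplx_str (P ex z)) (P ey z)
      + g (\<phi> z) (cplx_str (frechet_derivative T (at z) (0, ex))) (P ey z)
      + g (\<phi> z) (cplx_str (P ex z)) (frechet_derivative T (at z) (0, ey))"
    unfolding kf_def metric_frechet_derivative[OF open_W z smooth_phi phi_image sJ[OF smooth_P] smooth_P]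
      J[OF smooth_P] derivative_P_time[OF z] by (simp add: T_def)
  have eta: "frechet_derivative (eta b) (at z) (0, a) = dg (\<phi> z) (P a z) (cplx_str (T z)) (P b z)
      + g (\<phi> z) (cplx_str (frechet_derivative T (at z) (0, a))) (P b z)
      + g (\<phi> z) (cplx_str (T z)) (frechet_derivative (P b) (at z) (0, a))" for a b
    unfolding eta_def metric_frechet_derivative[OF open_W z smooth_phi phi_image sJ[OF smooth_T] smooth_P]
      J[OF smooth_T] by (simp add: P_def)
  show ?thesis
    unfolding kf eta derivative_P_sym[OF z, of ex ey] sk[of "P ex z"]
    using closed dsk[of "P ex z" "T z" "P ey z"] by simp
qed

end

locale symplectic_family = surface_family V g W \<phi>
  for V :: "(complex^2) set" and g and W :: "(real \<times> (real^2)) set" and \<phi> +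
  fixes \<beta> :: real
  assumes Gram_pos: "z \<in> W \<Longrightarrow> 0 < Gram z" and kf_pos: "z \<in> W \<Longrightarrow> 0 < kf z"
begin

text \<open>\<open>ell\<close> is the coordinate density of the functional, written as a product of powers of positive smooth
  functions; \<open>theta\<close> is the one-form whose exterior derivative is the exact part of its variation.\<close>

definition ell :: "real \<times> (real^2) \<Rightarrow> real" where
  "ell z = area z powr (\<beta> + 1) * kf z powr (- \<beta>)"
definition theta :: "real^2 \<Rightarrow> real \<times> (real^2) \<Rightarrow> real" where
  "theta a z = - \<beta> * kcos z powr (- \<beta> - 1) * eta a z"

lemma area_pos: "z \<in> W \<Longrightarrow> 0 < area z"
  using Gram_pos by (simp add: area_def)
lemma kcos_pos: "z \<in> W \<Longrightarrow> 0 < kcos z"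
  using area_pos kf_pos by (simp add: kcos_def)
lemma smooth_area: "smooth_on area W"
  unfolding area_def by (rule smooth_on_sqrt[OF open_W smooth_Gram Gram_pos])
lemma smooth_kcos: "smooth_on kcos W"
  unfolding kcos_def by (rule smooth_on_divide[OF open_W smooth_kf smooth_area area_pos])
lemma smooth_ell: "smooth_on ell W"
  unfolding ell_def
  by (rule smooth_on_mult[OF open_W smooth_on_powr[OF open_W smooth_area area_pos] smooth_on_powr[OF open_W smooth_kf kf_pos]])
lemma smooth_theta: "smooth_on (theta a) W"
  unfolding theta_def
  by (rule smooth_on_mult[OF open_W smooth_on_mult[OF open_W smooth_on_const smooth_on_powr[OF open_W smooth_kcos kcos_pos]] smooth_eta])

lemma ell_eq: "z \<in> W \<Longrightarrow> ell z = area z * (1 / kcos z powr \<beta>)"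
  using area_pos kf_pos
  by (simp add: ell_def kcos_def powr_divide powr_add powr_minus divide_simps less_imp_le)

text \<open>The contraction of the inverse metric with the second derivatives of the map, paired with \<open>n\<close>; for normal
  \<open>n\<close> this is the inner product of \<open>n\<close> with the mean curvature vector.\<close>

definition H_component :: "real \<times> (real^2) \<Rightarrow> complex^2 \<Rightarrow> real" where
  "H_component z n = (E ey ey z * g (\<phi> z) n (second_cov ex ex z) - 2 * E ex ey z * g (\<phi> z) n (second_cov ex ey z)
     + E ex ex z * g (\<phi> z) n (second_cov ey ey z)) / Gram z"

text \<open>The logarithmic derivative of the area density is half the trace of the derivative of the metric.\<close>

lemma area_variation:
  assumes z: "(t, x) \<in> W" and normal: "\<And>x a. (t, x) \<in> W \<Longrightarrow> g (\<phi> (t, x)) (T (t, x)) (P a (t, x)) = 0"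
  defines "z \<equiv> (t, x)"
  shows "frechet_derivative area (at z) (1, 0) = - area z * H_component z (T z)"
proof -
  have zW: "z \<in> W" using z by (simp add: z_def)
  note sd = smooth_on_has_derivative[OF _ zW]
  have "(Gram has_derivative (\<lambda>h. frechet_derivative (E ex ex) (at z) h * E ey ey z
      + E ex ex z * frechet_derivative (E ey ey) (at z) h - 2 * E ex ey z * frechet_derivative (E ex ey) (at z) h)) (at z)"
    unfolding Gram_def gram_def
    by (rule has_derivative_eq_rhs[OF has_derivative_diff[OF has_derivative_mult[OF sd[OF smooth_E] sd[OF smooth_E]]
        has_derivative_power[OF sd[OF smooth_E]]]]) (auto simp: algebra_simps)
  note Gram' = frechet_derivative_eq[OF this, of "(1, 0)"]
  have mv: "frechet_derivative (E a b) (at z) (1, 0) = - 2 * g (\<phi> z) (T z) (second_cov a b z)" for a b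
    unfolding z_def by (rule metric_variation[OF z normal])
  have G: "frechet_derivative Gram (at z) (1, 0) = - 2 * Gram z * H_component z (T z)"
    using Gram_pos[OF zW]
    unfolding H_component_def Gram' mv by (simp add: field_simps)
  have "(area has_derivative (\<lambda>h. (1/2) * Gram z powr (1/2 - 1) * frechet_derivative Gram (at z) h)) (at z)"
    by (rule has_derivative_transform_within_open[OF has_derivative_powr_const[OF sd[OF smooth_Gram] Gram_pos[OF zW]] open_W zW])
       (simp add: area_def powr_half_sqrt Gram_pos less_imp_le)
  from frechet_derivative_eq[OF this, of "(1, 0)"]
  have "frechet_derivative area (at z) (1, 0) = - (Gram z powr (1/2 - 1) * Gram z) * H_component z (T z)"
    unfolding G by simp
  also have "Gram z powr (1/2 - 1) * Gram z = Gram z powr (1/2)"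
    using powr_add[of "Gram z" "1/2 - 1" 1] Gram_pos[OF zW] by simp
  also have "\<dots> = area z"
    using Gram_pos[OF zW] by (simp add: area_def powr_half_sqrt)
  finally show ?thesis .
qed

text \<open>For normal \<open>n\<close> this is the area density times the inner product of \<open>n\<close> with the Euler-Lagrange
  expression. In this form it contains no projections.\<close>

definition EL_component :: "real \<times> (real^2) \<Rightarrow> complex^2 \<Rightarrow> real" where
  "EL_component z n = kcos z ^ 3 * area z * H_component z n
     + \<beta> * kcos z * (frechet_derivative kcos (at z) (0, ex) * g (\<phi> z) (cplx_str n) (P ey z)
         - frechet_derivative kcos (at z) (0, ey) * g (\<phi> z) (cplx_str n) (P ex z))"

text \<open>Up to an exact term, the density changes by the pairing of the variational field with the
  Euler-Lagrange expression. The exact term is the exterior derivative of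
  \<open>theta\<close>, produced by moving the derivative from the contracted Kaehler form to the power of the cosine.\<close>

lemma density_variation:
  assumes z: "(t, x) \<in> W" and normal: "\<And>x a. (t, x) \<in> W \<Longrightarrow> g (\<phi> (t, x)) (T (t, x)) (P a (t, x)) = 0"
  defines "z \<equiv> (t, x)"
  assumes closed: "dg (\<phi> z) (T z) (cplx_str (P ex z)) (P ey z) + dg (\<phi> z) (P ex z) (cplx_str (P ey z)) (T z)
      + dg (\<phi> z) (P ey z) (cplx_str (T z)) (P ex z) = 0"
  shows "frechet_derivative ell (at z) (1, 0)
    = frechet_derivative (theta ey) (at z) (0, ex) - frechet_derivative (theta ex) (at z) (0, ey)
      - (\<beta> + 1) * kcos z powr (- \<beta> - 3) * EL_component z (T z)"
proof -
  have zW: "z \<in> W" using z by (simp add: z_def)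
  note sd = smooth_on_has_derivative[OF _ zW]
  let ?D = "\<lambda>q h. frechet_derivative q (at z) h"
  let ?c = "kcos z" and ?A = "area z" and ?f = "kf z"
  have pos: "0 < ?c" "0 < ?A" "0 < ?f" using kcos_pos area_pos kf_pos zW by auto
  \<comment> \<open>All powers of the cosine that occur are products of the lowest one with natural powers.\<close>
  define q where "q = ?c powr (- \<beta> - 3)"
  have q: "?c powr (- \<beta>) = q * ?c ^ 3" "?c powr (- \<beta> - 1) = q * ?c ^ 2" "?c powr (- \<beta> - 2) = q * ?c"
  proof -
    have p: "?c powr (- \<beta> - 3 + real n) = q * ?c ^ n" for n
      using pos by (simp add: q_def powr_add powr_realpow)
    have e: "- \<beta> = - \<beta> - 3 + real 3" "- \<beta> - 1 = - \<beta> - 3 + real 2" "- \<beta> - 2 = - \<beta> - 3 + real 1"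
      by simp_all
    show "?c powr (- \<beta>) = q * ?c ^ 3" by (subst e(1)) (rule p)
    show "?c powr (- \<beta> - 1) = q * ?c ^ 2" by (subst e(2)) (rule p)
    show "?c powr (- \<beta> - 2) = q * ?c" by (subst e(3)) (simp only: p power_one_right)
  qed
  have theta: "?D (theta a) h = - \<beta> * ((- \<beta> - 1) * (q * ?c) * ?D kcos h * eta a z + q * ?c\<^sup>2 * ?D (eta a) h)" for a h
  proof -
    have "(theta a has_derivative (\<lambda>h. (- \<beta> * ?c powr (- \<beta> - 1)) * ?D (eta a) h
        + (- \<beta> * ((- \<beta> - 1) * ?c powr (- \<beta> - 1 - 1) * ?D kcos h)) * eta a z)) (at z)"
      unfolding theta_def
      by (rule has_derivative_mult[OF has_derivative_mult_right[OF has_derivative_powr_const[OF sd[OF smooth_kcos] pos(1)]] sd[OF smooth_eta]])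
    from frechet_derivative_eq[OF this] show ?thesis using q by (simp add: algebra_simps)
  qed
  have ell: "?D ell (1, 0) = (\<beta> + 1) * (q * ?c ^ 3) * ?D area (1, 0) - \<beta> * (q * ?c\<^sup>2) * ?D kf (1, 0)"
  proof -
    have d: "(ell has_derivative (\<lambda>h. ?A powr (\<beta> + 1) * ((- \<beta>) * ?f powr (- \<beta> - 1) * ?D kf h)
        + ((\<beta> + 1) * ?A powr (\<beta> + 1 - 1) * ?D area h) * ?f powr (- \<beta>))) (at z)"
      unfolding ell_def
      by (rule has_derivative_mult[OF has_derivative_powr_const[OF sd[OF smooth_area] pos(2)]
            has_derivative_powr_const[OF sd[OF smooth_kf] pos(3)]])
    have p: "?A powr (\<beta> + 1) * ?f powr (- \<beta> - 1) = q * ?c\<^sup>2" "?A powr \<beta> * ?f powr (- \<beta>) = q * ?c ^ 3"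
      unfolding q[symmetric] unfolding kcos_def using pos
      by (simp_all add: powr_divide powr_diff powr_add powr_minus divide_simps less_imp_le)
    have "?D ell (1, 0) = (?A powr (\<beta> + 1) * ?f powr (- \<beta> - 1)) * (- \<beta> * ?D kf (1, 0))
        + (?A powr \<beta> * ?f powr (- \<beta>)) * ((\<beta> + 1) * ?D area (1, 0))"
      using frechet_derivative_eq[OF d, of "(1, 0)"] by (simp add: algebra_simps)
    then show ?thesis unfolding p by simp
  qed
  have av: "?D area (1, 0) = - ?A * H_component z (T z)"
    unfolding z_def by (rule area_variation[OF z normal])
  show ?thesis
    unfolding ell theta kaehler_variation[OF zW closed] q_def[symmetric] EL_component_def eta_def[symmetric] av
    by (simp add: power2_eq_square power3_eq_cube algebra_simps)
qed

text \<open>This identifies the tangential part of \<open>J\<close> applied to the gradient, with components \<open>a\<close>, of a function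
  with partial derivatives \<open>k ex\<close> and \<open>k ey\<close>: on the tangent plane the Kaehler form is \<open>cos \<alpha>\<close> times the area form, so that
  \<open>J\<close> followed by the tangential projection is \<open>cos \<alpha>\<close> times the rotation by a right angle.\<close>

lemma tangential_J_gradient:
  assumes z: "z \<in> W" and w: "\<And>b. E a b z = k b"
  shows "g (\<phi> z) (cplx_str (P a z) - (kf z / Gram z) *\<^sub>R (k ex *\<^sub>R P ey z - k ey *\<^sub>R P ex z)) (P b z) = 0"
proof -
  interpret inner_form "g (\<phi> z)" using inner_phi[OF z] .
  have lin: "P c z = c $ 1 *\<^sub>R P ex z + c $ 2 *\<^sub>R P ey z" for c
    by (rule linear_plane[OF P_linear[OF z]])
  have sk: "g (\<phi> z) (cplx_str a) b = - g (\<phi> z) (cplx_str b) a" for a b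
    using J_skew[OF phi_V[OF z], of a b] sym[of a] by simp
  have J0: "g (\<phi> z) (cplx_str a) a = 0" for a using sk[of a a] by simp
  have k: "k b = a $ 1 * E ex b z + a $ 2 * E ey b z" for b
    using w[of b] lin[of a] by (simp add: E_def bilin_simps)
  have G: "Gram z = E ex ex z * E ey ey z - E ex ey z * E ex ey z" "Gram z \<noteq> 0"
    using Gram_pos[OF z] by (auto simp: Gram_def gram_def power2_eq_square)
  have J: "g (\<phi> z) (cplx_str (P a z)) (P ex z) = - a $ 2 * kf z"
    "g (\<phi> z) (cplx_str (P a z)) (P ey z) = a $ 1 * kf z"
    unfolding lin[of a] linear_add[OF cplx_str_linear] linear_scale[OF cplx_str_linear] kf_def
    using sk[of "P ey z" "P ex z"] by (simp_all add: bilin_simps J0)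
  let ?R = "\<lambda>b. g (\<phi> z) (cplx_str (P a z) - (kf z / Gram z) *\<^sub>R (k ex *\<^sub>R P ey z - k ey *\<^sub>R P ex z)) (P b z)"
  have "?R ex = - a $ 2 * kf z - kf z / Gram z * (- a $ 2 * Gram z)"
    unfolding diff_left scale_left J k E_def[symmetric] using E_sym[OF z, of ey ex]
    by (simp add: G(1) algebra_simps)
  moreover have "?R ey = a $ 1 * kf z - kf z / Gram z * (a $ 1 * Gram z)"
    unfolding diff_left scale_left J k E_def[symmetric] using E_sym[OF z, of ey ex]
    by (simp add: G(1) algebra_simps)
  ultimately have "?R ex = 0" "?R ey = 0" using G(2) by simp_all
  then show ?thesis unfolding lin[of b] add_right scale_right by simp
qed

end

section \<open>Charts and change of coordinates\<close>

lemma
  assumes "is_chart c"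
  shows open_chart_dom: "open (chart_dom c)" and open_chart_img: "open (chart_img c)"
    and chart_inv_chart: "p \<in> chart_dom c \<Longrightarrow> chart_inv c (chart_map c p) = p"
    and chart_chart_inv: "x \<in> chart_img c \<Longrightarrow> chart_map c (chart_inv c x) = x"
    and chart_map_in: "p \<in> chart_dom c \<Longrightarrow> chart_map c p \<in> chart_img c"
    and chart_inv_in: "x \<in> chart_img c \<Longrightarrow> chart_inv c x \<in> chart_dom c"
    and continuous_chart_map: "continuous_on (chart_dom c) (chart_map c)"
    and continuous_chart_inv: "continuous_on (chart_img c) (chart_inv c)"
proof -
  have h: "homeomorphism (chart_dom c) (chart_img c) (chart_map c) (chart_inv c)"
    and o: "open (chart_dom c)" "open (chart_img c)"
    using assms unfolding is_chart_def by blast+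
  show "open (chart_dom c)" "open (chart_img c)" by (rule o)+
  show "continuous_on (chart_dom c) (chart_map c)" "continuous_on (chart_img c) (chart_inv c)"
    by (rule homeomorphism_cont1[OF h], rule homeomorphism_cont2[OF h])
  show "chart_inv c (chart_map c p) = p" if "p \<in> chart_dom c"
    by (rule homeomorphism_apply1[OF h that])
  show "chart_map c (chart_inv c x) = x" if "x \<in> chart_img c"
    by (rule homeomorphism_apply2[OF h that])
  show "chart_map c p \<in> chart_img c" if "p \<in> chart_dom c"
    using that by (simp add: chart_img_def)
  show "chart_inv c x \<in> chart_dom c" if "x \<in> chart_img c"
    using homeomorphism_image2[OF h] that by blast
qed

lemma inj_on_chart_map: "is_chart c \<Longrightarrow> inj_on (chart_map c) (chart_dom c)"
  by (metis inj_onI chart_inv_chart)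

lemma chart_map_image_eq:
  assumes "is_chart c" "A \<subseteq> chart_dom c"
  shows "chart_map c ` A = {x \<in> chart_img c. chart_inv c x \<in> A}"
  using assms chart_inv_chart[OF assms(1)] chart_chart_inv[OF assms(1)] chart_map_in[OF assms(1)]
  by (auto simp: image_iff) (metis)

lemma open_chart_vimage:
  assumes "is_chart c" "open U"
  shows "open {x \<in> chart_img c. chart_inv c x \<in> U}"
  using continuous_open_preimage[OF continuous_chart_inv[OF assms(1)] open_chart_img[OF assms(1)] assms(2)]
  by (simp add: vimage_def Int_def conj_commute)

lemma overlap_eq: "is_chart c \<Longrightarrow> overlap c d = {x \<in> chart_img c. chart_inv c x \<in> chart_dom d}"
  unfolding overlap_def
  by (auto simp: image_iff chart_inv_chart chart_map_in) (metis IntI chart_chart_inv chart_inv_in)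

lemma open_overlap: "is_chart c \<Longrightarrow> is_chart d \<Longrightarrow> open (overlap c d)"
  by (simp add: overlap_eq open_chart_vimage open_chart_dom)

lemma transition_apply: "is_chart c \<Longrightarrow> p \<in> chart_dom c \<Longrightarrow> transition c d (chart_map c p) = chart_map d p"
  by (simp add: transition_def chart_inv_chart)

lemma local_rep_apply: "is_chart c \<Longrightarrow> p \<in> chart_dom c \<Longrightarrow> local_rep c C F (chart_map c p) = chart_map C (F p)"
  by (simp add: local_rep_def chart_inv_chart)

definition rep_dom :: "('s, 'd) chart \<Rightarrow> ('m, 'e) chart \<Rightarrow> ('s \<Rightarrow> 'm) \<Rightarrow> 'd set" where
  "rep_dom c C F = chart_map c ` (chart_dom c \<inter> F -` chart_dom C)"

lemma rep_dom_eq: "is_chart c \<Longrightarrow> rep_dom c C F = {x \<in> chart_img c. F (chart_inv c x) \<in> chart_dom C}"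
  unfolding rep_dom_def
  by (auto simp: image_iff chart_inv_chart chart_map_in) (metis IntI vimageI2 chart_chart_inv chart_inv_in)

lemma open_rep_dom:
  assumes "is_chart c" "is_chart C" "continuous_on UNIV F"
  shows "open (rep_dom c C F)"
proof -
  have "open (F -` chart_dom C)"
    using continuous_on_open_vimage[OF open_UNIV, of F] assms(3) open_chart_dom[OF assms(2)] by simp
  then show ?thesis
    unfolding rep_dom_eq[OF assms(1)] using open_chart_vimage[OF assms(1)] by fastforce
qed

lemma atlas_is_chart: "smooth_atlas \<A> \<Longrightarrow> c \<in> \<A> \<Longrightarrow> is_chart c"
  by (simp add: smooth_atlas_def)

lemma transition_smooth: "smooth_atlas \<A> \<Longrightarrow> c \<in> \<A> \<Longrightarrow> d \<in> \<A> \<Longrightarrow> smooth_on (transition c d) (overlap c d)"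
  by (simp add: smooth_atlas_def)

lemma chart_at:
  assumes "smooth_atlas \<A>"
  shows "chart_at \<A> p \<in> \<A>" "p \<in> chart_dom (chart_at \<A> p)"
proof -
  have "p \<in> (\<Union>c\<in>\<A>. chart_dom c)" using assms by (metis UNIV_I smooth_atlas_def)
  then have "\<exists>c. c \<in> \<A> \<and> p \<in> chart_dom c" by blast
  then show "chart_at \<A> p \<in> \<A>" "p \<in> chart_dom (chart_at \<A> p)"
    unfolding chart_at_def by (metis (mono_tags, lifting) someI_ex)+
qed

abbreviation dtrans :: "('m, 'e::euclidean_space) chart \<Rightarrow> ('m, 'e) chart \<Rightarrow> 'm \<Rightarrow> 'e \<Rightarrow> 'e" where
  "dtrans c d p \<equiv> frechet_derivative (transition c d) (at (chart_map c p))"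

lemma dtrans_has_derivative:
  assumes "smooth_atlas \<A>" "c \<in> \<A>" "d \<in> \<A>" "p \<in> chart_dom c" "p \<in> chart_dom d"
  shows "(transition c d has_derivative dtrans c d p) (at (chart_map c p))"
  using assms by (intro smooth_on_has_derivative[OF transition_smooth[of \<A>]]) (auto simp: overlap_def)

lemma dtrans_linear:
  "smooth_atlas \<A> \<Longrightarrow> c \<in> \<A> \<Longrightarrow> d \<in> \<A> \<Longrightarrow> p \<in> chart_dom c \<Longrightarrow> p \<in> chart_dom d \<Longrightarrow> linear (dtrans c d p)"
  using dtrans_has_derivative has_derivative_linear by blast

lemma dtrans_inverse:
  assumes at: "smooth_atlas \<A>" and "c \<in> \<A>" "d \<in> \<A>" "p \<in> chart_dom c" "p \<in> chart_dom d"
  shows "dtrans d c p (dtrans c d p u) = u"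
proof -
  note ch = atlas_is_chart[OF at]
  have "(transition d c \<circ> transition c d has_derivative dtrans d c p \<circ> dtrans c d p) (at (chart_map c p))"
    using dtrans_has_derivative[OF at assms(2-5)] dtrans_has_derivative[OF at assms(3,2,5,4)]
    by (intro diff_chain_at) (simp_all add: transition_apply ch assms)
  moreover have "(transition d c \<circ> transition c d has_derivative id) (at (chart_map c p))"
  proof (rule has_derivative_transform_within_open[OF has_derivative_id open_overlap[of c d]])
    show "id x = (transition d c \<circ> transition c d) x" if "x \<in> overlap c d" for x
      using that transition_apply[OF ch[OF assms(2)], where d = d] transition_apply[OF ch[OF assms(3)], where d = c]
      by (auto simp: overlap_def)
  qed (use ch assms in \<open>auto simp: overlap_def\<close>)
  ultimately have "dtrans d c p \<circ> dtrans c d p = id" by (rule has_derivative_unique)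
  then show ?thesis by (simp add: fun_eq_iff)
qed

lemma det_matrix_plane: "det (matrix L) = L ex $ 1 * L ey $ 2 - L ex $ 2 * L ey $ 1"
  for L :: "real^2 \<Rightarrow> real^2"
  by (simp add: det_2 matrix_def mult.commute)

lemma alternating_plane:
  fixes k :: "real^2 \<Rightarrow> real^2 \<Rightarrow> real"
  assumes "bilinear k" "\<And>u. k u u = 0"
  shows "k u v = (u $ 1 * v $ 2 - u $ 2 * v $ 1) * k ex ey"
proof -
  have "k ey ex = - k ex ey"
    using assms(2)[of "ex + ey"]
    unfolding bilinear_ladd[OF assms(1)] bilinear_radd[OF assms(1)] assms(2)[of ex] assms(2)[of ey] by simp
  then show ?thesis
    unfolding bilinear_plane[OF assms(1), of u v] by (simp add: assms(2) algebra_simps)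
qed

section \<open>Immersed surfaces and the Kaehler angle\<close>

text \<open>The ambient data without the immersion, because a variation involves many immersions.\<close>

locale surface_in_hermite =
  fixes \<A> :: "('s::{t2_space, second_countable_topology}, real^2) chart set"
    and \<B> :: "('m::{t2_space, second_countable_topology}, complex^2) chart set"
    and G :: "('m, complex^2) metric_tensor"
  assumes hermite: "hermite_surface \<B> G" and oriented: "oriented_surface_atlas \<A>"
    and compact_surface: "compact (UNIV :: 's set)"
begin

lemma atlas_A: "smooth_atlas \<A>"
  using oriented by (simp add: oriented_surface_atlas_def)
lemma atlas_B: "smooth_atlas \<B>"
  using hermite by (simp add: hermite_surface_def complex_surface_atlas_def)

lemmas chart_A = atlas_is_chart[OF atlas_A]
lemmas chart_B = atlas_is_chart[OF atlas_B]

lemma metric: "riemannian_metric \<B> G"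
  using hermite by (simp add: hermite_surface_def)

lemma metric_inner_form: "C \<in> \<B> \<Longrightarrow> q \<in> chart_dom C \<Longrightarrow> inner_form (G C q)"
  using metric unfolding riemannian_metric_def inner_form_def by blast

lemma metric_change:
  "C \<in> \<B> \<Longrightarrow> D \<in> \<B> \<Longrightarrow> q \<in> chart_dom C \<Longrightarrow> q \<in> chart_dom D \<Longrightarrow>
    G C q u v = G D q (dtrans C D q u) (dtrans C D q v)"
  using metric unfolding riemannian_metric_def by blast

lemma metric_J: "C \<in> \<B> \<Longrightarrow> q \<in> chart_dom C \<Longrightarrow> G C q (cplx_str u) (cplx_str v) = G C q u v"
  using hermite unfolding hermite_surface_def by blast

lemma dtrans_J:
  "C \<in> \<B> \<Longrightarrow> D \<in> \<B> \<Longrightarrow> q \<in> chart_dom C \<Longrightarrow> q \<in> chart_dom D \<Longrightarrow>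
    dtrans C D q (cplx_str u) = cplx_str (dtrans C D q u)"
  using hermite unfolding hermite_surface_def complex_surface_atlas_def holomorphic_map_on_def overlap_def by blast

lemma hermitian_chart:
  assumes "C \<in> \<B>"
  shows "hermitian_field (chart_img C) (\<lambda>y. G C (chart_inv C y))"
proof -
  have "smooth_on (\<lambda>y. G C (chart_inv C y) u v) (chart_img C)" for u v
    using metric assms unfolding riemannian_metric_def by blast
  then show ?thesis
    using chart_B[OF assms] metric_inner_form[OF assms] metric_J[OF assms]
    by unfold_locales (auto simp: open_chart_img chart_inv_in inner_form.bilin inner_form.sym inner_form.pos)
qed

lemma dtrans_A_det: "c \<in> \<A> \<Longrightarrow> d \<in> \<A> \<Longrightarrow> p \<in> chart_dom c \<Longrightarrow> p \<in> chart_dom d \<Longrightarrow> 0 < det (matrix (dtrans c d p))"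
  using oriented unfolding oriented_surface_atlas_def overlap_def by blast

lemma kahler_change:
  "C \<in> \<B> \<Longrightarrow> D \<in> \<B> \<Longrightarrow> q \<in> chart_dom C \<Longrightarrow> q \<in> chart_dom D \<Longrightarrow>
    kahler_form G C q u v = kahler_form G D q (dtrans C D q u) (dtrans C D q v)"
  unfolding kahler_form_def by (simp add: metric_change[of C D] dtrans_J)

lemma kahler_form_bilinear: "C \<in> \<B> \<Longrightarrow> q \<in> chart_dom C \<Longrightarrow> bilinear (kahler_form G C q)"
  using inner_form.bilin[OF metric_inner_form] unfolding kahler_form_def bilinear_def
  by (auto simp: linear_iff linear_add[OF cplx_str_linear] linear_scale[OF cplx_str_linear])

lemma kahler_form_alternating:
  assumes "C \<in> \<B>" "q \<in> chart_dom C"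
  shows "kahler_form G C q u u = 0"
proof -
  interpret inner_form "G C q" by (rule metric_inner_form[OF assms])
  show ?thesis
    using metric_J[OF assms, of "cplx_str u" u] sym[of u "cplx_str u"]
    by (simp add: kahler_form_def cplx_str_square minus_left)
qed

subsection \<open>Differentials in different charts\<close>

lemma immersion_smooth:
  "immersion \<A> \<B> F \<Longrightarrow> c \<in> \<A> \<Longrightarrow> C \<in> \<B> \<Longrightarrow> smooth_on (local_rep c C F) (rep_dom c C F)"
  by (simp add: immersion_def rep_dom_def)

lemma immersion_continuous: "immersion \<A> \<B> F \<Longrightarrow> continuous_on UNIV F"
  by (simp add: immersion_def)

lemma immersion_rep_open: "immersion \<A> \<B> F \<Longrightarrow> c \<in> \<A> \<Longrightarrow> C \<in> \<B> \<Longrightarrow> open (rep_dom c C F)"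
  using open_rep_dom[OF chart_A chart_B immersion_continuous] .

lemma dmap_has_derivative:
  assumes "immersion \<A> \<B> F" "c \<in> \<A>" "C \<in> \<B>" "p \<in> chart_dom c" "F p \<in> chart_dom C"
  shows "(local_rep c C F has_derivative dmap c C F p) (at (chart_map c p))"
  unfolding dmap_def
  by (rule smooth_on_has_derivative[OF immersion_smooth[OF assms(1-3)]]) (use assms in \<open>auto simp: rep_dom_def\<close>)

lemma dmap_linear:
  "immersion \<A> \<B> F \<Longrightarrow> c \<in> \<A> \<Longrightarrow> C \<in> \<B> \<Longrightarrow> p \<in> chart_dom c \<Longrightarrow> F p \<in> chart_dom C \<Longrightarrow> linear (dmap c C F p)"
  using dmap_has_derivative has_derivative_linear by blast

lemma dmap_inj:
  "immersion \<A> \<B> F \<Longrightarrow> c \<in> \<A> \<Longrightarrow> C \<in> \<B> \<Longrightarrow> p \<in> chart_dom c \<Longrightarrow> F p \<in> chart_dom C \<Longrightarrow> inj (dmap c C F p)"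
  unfolding immersion_def by auto

text \<open>Stated for a map that is only known to be differentiable in one pair of charts, so that it can
  also serve to establish that a map is an immersion.\<close>

lemma local_rep_change:
  assumes F: "continuous_on UNIV F" and c: "c \<in> \<A>" "d \<in> \<A>" "p \<in> chart_dom c" "p \<in> chart_dom d"
    and C: "C \<in> \<B>" "D \<in> \<B>" "F p \<in> chart_dom C" "F p \<in> chart_dom D"
    and L: "(local_rep c C F has_derivative L) (at (chart_map c p))"
  shows "(local_rep d D F has_derivative (\<lambda>u. dtrans C D (F p) (L (dtrans d c p u)))) (at (chart_map d p))"
proof -
  note chs = chart_A[OF c(1)] chart_A[OF c(2)] chart_B[OF C(1)] chart_B[OF C(2)]
  have "(local_rep c C F \<circ> transition d c has_derivative L \<circ> dtrans d c p) (at (chart_map d p))"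
    using dtrans_has_derivative[OF atlas_A c(2,1,4,3)] L
    by (intro diff_chain_at) (simp_all add: transition_apply chs c)
  then have "(transition C D \<circ> (local_rep c C F \<circ> transition d c) has_derivative dtrans C D (F p) \<circ> (L \<circ> dtrans d c p))
      (at (chart_map d p))"
  proof (rule diff_chain_at)
    have "(local_rep c C F \<circ> transition d c) (chart_map d p) = chart_map C (F p)"
      by (simp add: transition_apply local_rep_apply chs c)
    then show "(transition C D has_derivative dtrans C D (F p)) (at ((local_rep c C F \<circ> transition d c) (chart_map d p)))"
      using dtrans_has_derivative[OF atlas_B C] by simp
  qed
  then have "(local_rep d D F has_derivative dtrans C D (F p) \<circ> (L \<circ> dtrans d c p)) (at (chart_map d p))"
  proof (rule has_derivative_transform_within_open)
    let ?S = "overlap d c \<inter> rep_dom d C F \<inter> rep_dom d D F"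
    show "open ?S" by (intro open_Int open_overlap open_rep_dom chs F)
    show "chart_map d p \<in> ?S" using c C by (auto simp: overlap_def rep_dom_def)
    show "(transition C D \<circ> (local_rep c C F \<circ> transition d c)) x = local_rep d D F x" if x: "x \<in> ?S" for x
    proof -
      define q where "q = chart_inv d x"
      have q: "q \<in> chart_dom d" "q \<in> chart_dom c" "F q \<in> chart_dom C" "F q \<in> chart_dom D" "x = chart_map d q"
        using x by (auto simp: overlap_eq[OF chs(2)] rep_dom_eq[OF chs(2)] q_def chart_inv_in[OF chs(2)] chart_chart_inv[OF chs(2)])
      show ?thesis unfolding q(5) using q by (simp add: transition_apply local_rep_apply chs)
    qed
  qed
  then show ?thesis by (simp add: o_def)
qed

lemma dmap_change:
  assumes F: "immersion \<A> \<B> F" and c: "c \<in> \<A>" "d \<in> \<A>" "p \<in> chart_dom c" "p \<in> chart_dom d"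
    and C: "C \<in> \<B>" "D \<in> \<B>" "F p \<in> chart_dom C" "F p \<in> chart_dom D"
  shows "dmap d D F p u = dtrans C D (F p) (dmap c C F p (dtrans d c p u))"
  unfolding dmap_def[of d]
  by (rule frechet_derivative_eq[OF local_rep_change[OF immersion_continuous[OF F] c C dmap_has_derivative[OF F c(1) C(1) c(3) C(3)]]])

lemma dtrans_refl:
  assumes "smooth_atlas \<C>" "c \<in> \<C>" "p \<in> chart_dom c"
  shows "dtrans c c p u = u"
proof -
  note ch = atlas_is_chart[OF assms(1,2)]
  have "(transition c c has_derivative id) (at (chart_map c p))"
    by (rule has_derivative_transform_within_open[OF has_derivative_id open_chart_img[OF ch]])
       (simp_all add: assms(3) chart_map_in[OF ch] transition_def chart_chart_inv[OF ch])
  from frechet_derivative_eq[OF this] show ?thesis by simp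
qed

lemma dmap_change_target:
  assumes "immersion \<A> \<B> F" "c \<in> \<A>" "p \<in> chart_dom c" "C \<in> \<B>" "D \<in> \<B>" "F p \<in> chart_dom C" "F p \<in> chart_dom D"
  shows "dmap c D F p u = dtrans C D (F p) (dmap c C F p u)"
  using dmap_change[OF assms(1) assms(2,2,3,3) assms(4-7)] dtrans_refl[OF atlas_A assms(2,3)] by simp

lemma dmap_change_source:
  assumes "immersion \<A> \<B> F" "c \<in> \<A>" "d \<in> \<A>" "p \<in> chart_dom c" "p \<in> chart_dom d" "C \<in> \<B>" "F p \<in> chart_dom C"
  shows "dmap d C F p u = dmap c C F p (dtrans d c p u)"
  using dmap_change[OF assms(1-5) assms(6,6,7,7)] dtrans_refl[OF atlas_B assms(6,7)] by simp

lemma induced_metric_eq: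
  assumes "immersion \<A> \<B> F" "c \<in> \<A>" "p \<in> chart_dom c" "C \<in> \<B>" "F p \<in> chart_dom C"
  shows "induced_metric \<B> G F c p u v = G C (F p) (dmap c C F p u) (dmap c C F p v)"
proof -
  note ca = chart_at[OF atlas_B, of "F p"]
  show ?thesis
    unfolding induced_metric_def Let_def
      dmap_change_target[OF assms(1-4) ca(1) assms(5) ca(2)]
    by (rule metric_change[OF assms(4) ca(1) assms(5) ca(2), symmetric])
qed

lemma induced_metric_change:
  assumes "immersion \<A> \<B> F" "c \<in> \<A>" "d \<in> \<A>" "p \<in> chart_dom c" "p \<in> chart_dom d"
  shows "induced_metric \<B> G F d p u v = induced_metric \<B> G F c p (dtrans d c p u) (dtrans d c p v)"
  unfolding induced_metric_def Let_def
  using dmap_change_source[OF assms chart_at[OF atlas_B]] by simp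

lemma induced_plane_form:
  assumes "immersion \<A> \<B> F" "c \<in> \<A>" "p \<in> chart_dom c"
  shows "plane_form (induced_metric \<B> G F c p)"
proof -
  note ca = chart_at[OF atlas_B, of "F p"]
  have "induced_metric \<B> G F c p = (\<lambda>u v. G (chart_at \<B> (F p)) (F p) (dmap c (chart_at \<B> (F p)) F p u) (dmap c (chart_at \<B> (F p)) F p v))"
    by (intro ext) (simp add: induced_metric_def Let_def)
  then show ?thesis
    unfolding plane_form_def
    using inner_form.pullback[OF metric_inner_form[OF ca] dmap_linear[OF assms(1,2) ca(1) assms(3) ca(2)]
        dmap_inj[OF assms(1,2) ca(1) assms(3) ca(2)]] by simp
qed

lemma area_density_gram: "area_density g c p = sqrt (gram (g c p))"
  by (simp add: area_density_def gram_def)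

lemma area_density_pos:
  "immersion \<A> \<B> F \<Longrightarrow> c \<in> \<A> \<Longrightarrow> p \<in> chart_dom c \<Longrightarrow> 0 < area_density (induced_metric \<B> G F) c p"
  using plane_form.gram_pos[OF induced_plane_form] by (simp add: area_density_gram)

lemma area_density_change:
  assumes "immersion \<A> \<B> F" "c \<in> \<A>" "d \<in> \<A>" "p \<in> chart_dom c" "p \<in> chart_dom d"
  shows "area_density (induced_metric \<B> G F) d p
    = det (matrix (dtrans d c p)) * area_density (induced_metric \<B> G F) c p"
proof -
  interpret plane_form "induced_metric \<B> G F c p" by (rule induced_plane_form[OF assms(1,2,4)])
  have "gram (induced_metric \<B> G F d p) = gram (induced_metric \<B> G F c p) * (det (matrix (dtrans d c p)))\<^sup>2"
    using gram_identity[OF bilin sym, of "dtrans d c p ex" "dtrans d c p ey"]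
    by (simp add: gram_def[of "induced_metric \<B> G F d p"] induced_metric_change[OF assms] det_matrix_plane)
  then show ?thesis
    using dtrans_A_det[OF assms(3,2,5,4)] by (simp add: area_density_gram real_sqrt_mult mult.commute)
qed

text \<open>The coefficient of the pulled back Kaehler form in a chart of the surface. The chart of the ambient
  surface is an arbitrary one, since holomorphic coordinate changes preserve the Kaehler form.\<close>

definition kahler_density :: "('s \<Rightarrow> 'm) \<Rightarrow> ('s, real^2) chart \<Rightarrow> 's \<Rightarrow> real" where
  "kahler_density F c p = (let C = chart_at \<B> (F p) in kahler_form G C (F p) (dmap c C F p ex) (dmap c C F p ey))"

lemma kahler_density_eq:
  assumes "immersion \<A> \<B> F" "c \<in> \<A>" "p \<in> chart_dom c" "C \<in> \<B>" "F p \<in> chart_dom C"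
  shows "kahler_form G C (F p) (dmap c C F p u) (dmap c C F p v) = kahler_density F c p * (u $ 1 * v $ 2 - u $ 2 * v $ 1)"
proof -
  note ca = chart_at[OF atlas_B, of "F p"]
  let ?D = "chart_at \<B> (F p)"
  let ?k = "\<lambda>u v. kahler_form G ?D (F p) (dmap c ?D F p u) (dmap c ?D F p v)"
  have "kahler_form G C (F p) (dmap c C F p u) (dmap c C F p v) = ?k u v"
    unfolding kahler_change[OF assms(4) ca(1) assms(5) ca(2)] dmap_change_target[OF assms(1-4) ca(1) assms(5) ca(2)] ..
  also have "\<dots> = (u $ 1 * v $ 2 - u $ 2 * v $ 1) * ?k ex ey"
  proof (rule alternating_plane)
    note lin = dmap_linear[OF assms(1,2) ca(1) assms(3) ca(2)]
    show "bilinear ?k"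
      using kahler_form_bilinear[OF ca]
      by (auto simp: bilinear_def linear_iff linear_add[OF lin] linear_scale[OF lin])
  qed (rule kahler_form_alternating[OF ca])
  finally show ?thesis by (simp add: kahler_density_def Let_def mult.commute)
qed

lemma kahler_density_change:
  assumes "immersion \<A> \<B> F" "c \<in> \<A>" "d \<in> \<A>" "p \<in> chart_dom c" "p \<in> chart_dom d"
  shows "kahler_density F d p = det (matrix (dtrans d c p)) * kahler_density F c p"
proof -
  note ca = chart_at[OF atlas_B, of "F p"]
  let ?D = "chart_at \<B> (F p)"
  have "kahler_density F d p = kahler_form G ?D (F p) (dmap d ?D F p ex) (dmap d ?D F p ey)"
    by (simp add: kahler_density_def Let_def)
  also have "\<dots> = kahler_density F c p * det (matrix (dtrans d c p))"
    unfolding dmap_change_source[OF assms ca] kahler_density_eq[OF assms(1,2,4) ca] det_matrix_plane ..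
  finally show ?thesis by simp
qed

lemma kahler_density_bound:
  assumes "immersion \<A> \<B> F" "c \<in> \<A>" "p \<in> chart_dom c"
  shows "\<bar>kahler_density F c p\<bar> \<le> area_density (induced_metric \<B> G F) c p"
proof -
  note ca = chart_at[OF atlas_B, of "F p"]
  let ?D = "chart_at \<B> (F p)"
  have "(kahler_density F c p)\<^sup>2 \<le> gram (induced_metric \<B> G F c p)"
    unfolding kahler_density_def Let_def gram_def induced_metric_eq[OF assms ca] kahler_form_def
    by (rule inner_form.wirtinger[OF metric_inner_form[OF ca] metric_J[OF ca] cplx_str_square])
  then show ?thesis
    unfolding area_density_gram by (metis real_sqrt_abs real_sqrt_le_iff)
qed

text \<open>The quotient of the two densities is the same in all charts and lies between \<open>-1\<close> and \<open>1\<close> by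
  Wirtinger's inequality; so it is the cosine of a unique angle.\<close>

lemma cos_kahler_angle:
  assumes "immersion \<A> \<B> F" "c \<in> \<A>" "p \<in> chart_dom c"
  shows "kahler_density F c p = cos (kahler_angle \<A> \<B> G F p) * area_density (induced_metric \<B> G F) c p"
proof -
  let ?a = "area_density (induced_metric \<B> G F)"
  let ?k = "kahler_density F"
  let ?P = "\<lambda>\<alpha>. 0 \<le> \<alpha> \<and> \<alpha> \<le> pi \<and> (\<forall>c\<in>\<A>. \<forall>C\<in>\<B>. p \<in> chart_dom c \<and> F p \<in> chart_dom C \<longrightarrow>
       (\<forall>u v. kahler_form G C (F p) (dmap c C F p u) (dmap c C F p v) = cos \<alpha> * area_form (induced_metric \<B> G F) c p u v))"
  note F = assms(1)
  define \<alpha> where "\<alpha> = arccos (?k c p / ?a c p)"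
  have a: "0 < ?a c p" by (rule area_density_pos[OF assms])
  then have q: "- 1 \<le> ?k c p / ?a c p" "?k c p / ?a c p \<le> 1"
    using kahler_density_bound[OF assms] by (auto simp: abs_le_iff divide_simps)
  then have \<alpha>: "0 \<le> \<alpha>" "\<alpha> \<le> pi" "cos \<alpha> = ?k c p / ?a c p"
    unfolding \<alpha>_def using arccos_lbound[OF q] arccos_ubound[OF q] cos_arccos[OF q] by simp_all
  have ex: "?P \<alpha>"
  proof (intro conjI ballI impI allI \<alpha>(1,2))
    fix d C u v assume d: "d \<in> \<A>" "C \<in> \<B>" "p \<in> chart_dom d \<and> F p \<in> chart_dom C"
    have "?k d p = cos \<alpha> * ?a d p"
      unfolding \<alpha>(3) using a kahler_density_change[OF F assms(2) d(1) assms(3)] area_density_change[OF F assms(2) d(1) assms(3)] d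
      by simp
    then show "kahler_form G C (F p) (dmap d C F p u) (dmap d C F p v) = cos \<alpha> * area_form (induced_metric \<B> G F) d p u v"
      using d by (simp add: kahler_density_eq[OF F] area_form_def)
  qed
  have val: "cos \<gamma> = ?k c p / ?a c p" if "?P \<gamma>" for \<gamma>
  proof -
    note ca = chart_at[OF atlas_B, of "F p"]
    have "kahler_form G (chart_at \<B> (F p)) (F p) (dmap c (chart_at \<B> (F p)) F p ex) (dmap c (chart_at \<B> (F p)) F p ey)
      = cos \<gamma> * area_form (induced_metric \<B> G F) c p ex ey"
      using that assms ca by blast
    then have "?k c p = cos \<gamma> * ?a c p"
      by (simp add: kahler_density_eq[OF assms ca] area_form_def) (simp add: axis_def)
    then show ?thesis using a by simp
  qed
  have "kahler_angle \<A> \<B> G F p = \<alpha>"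
    unfolding kahler_angle_def
  proof (rule the_equality[of ?P, OF ex])
    fix \<gamma> assume g: "?P \<gamma>"
    show "\<gamma> = \<alpha>"
      by (rule cos_inj_pi[OF g[THEN conjunct1] g[THEN conjunct2, THEN conjunct1] \<alpha>(1,2)]) (simp only: val[OF g] \<alpha>(3))
  qed
  then show ?thesis using \<alpha>(3) a by simp
qed

end

section \<open>Measures given by densities in charts\<close>

lemma nn_integral_absolutely_integrable:
  fixes f :: "real^2 \<Rightarrow> real"
  assumes "f absolutely_integrable_on S" "\<And>x. x \<in> S \<Longrightarrow> 0 \<le> f x"
  shows "set_nn_integral lborel S (\<lambda>x. ennreal (f x)) = ennreal (integral S f)"
proof -
  have int: "integrable lebesgue (\<lambda>x. indicator S x *\<^sub>R f x)"
    using assms(1) by (simp add: set_integrable_def)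
  have "set_nn_integral lborel S (\<lambda>x. ennreal (f x)) = (\<integral>\<^sup>+x. ennreal (indicator S x *\<^sub>R f x) \<partial>lebesgue)"
    by (subst nn_integral_completion) (auto intro!: nn_integral_cong simp: indicator_def)
  also have "\<dots> = ennreal (integral\<^sup>L lebesgue (\<lambda>x. indicator S x *\<^sub>R f x))"
    by (rule nn_integral_eq_integral[OF int]) (use assms(2) in \<open>auto simp: indicator_def\<close>)
  also have "integral\<^sup>L lebesgue (\<lambda>x. indicator S x *\<^sub>R f x) = integral S f"
    using set_lebesgue_integral_eq_integral(2)[OF assms(1)] by (simp add: set_lebesgue_integral_def)
  finally show ?thesis .
qed

text \<open>The change of variables formula for densities that need not be integrable: it is applied on
  the bounded sets where the density is bounded.\<close>

lemma nn_integral_change_of_variables: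
  fixes \<tau> :: "real^2 \<Rightarrow> real^2" and f :: "real^2 \<Rightarrow> real"
  assumes U: "open U" "open (\<tau> ` U)" and \<tau>: "smooth_on \<tau> U"
    and h: "\<And>x. x \<in> U \<Longrightarrow> h (\<tau> x) = x" "continuous_on (\<tau> ` U) h"
    and f: "continuous_on (\<tau> ` U) f" "\<And>y. y \<in> \<tau> ` U \<Longrightarrow> 0 \<le> f y"
    and B: "B \<in> sets borel" "B \<subseteq> U"
  shows "set_nn_integral lborel (\<tau> ` B) (\<lambda>y. ennreal (f y))
    = set_nn_integral lborel B (\<lambda>x. ennreal (\<bar>det (matrix (frechet_derivative \<tau> (at x)))\<bar> * f (\<tau> x)))"
proof -
  let ?D = "\<lambda>x. \<bar>det (matrix (frechet_derivative \<tau> (at x)))\<bar> * f (\<tau> x)"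
  have contD: "continuous_on U ?D"
    unfolding det_matrix_plane
    using smooth_on_continuous[OF smooth_on_derivative[OF \<tau>]]
      continuous_on_compose2[OF f(1) smooth_on_continuous[OF \<tau>]]
    by (intro continuous_intros) auto
  have image: "\<tau> ` S = h -` S \<inter> \<tau> ` U" if "S \<subseteq> U" for S
    using that h(1) by (auto simp: image_iff)
  have image_borel: "\<tau> ` S \<in> sets borel" if S: "S \<in> sets borel" "S \<subseteq> U" for S
  proof -
    have "h -` S \<inter> space (restrict_space borel (\<tau> ` U)) \<in> sets (restrict_space borel (\<tau> ` U))"
      by (rule measurable_sets[OF borel_measurable_continuous_on_restrict[OF h(2)] S(1)])
    then show ?thesis
      using U(2) by (simp add: image[OF S(2)] space_restrict_space sets_restrict_space_iff)
  qed
  define N1 where "N1 = density lborel (\<lambda>y. ennreal (f y) * indicator (\<tau> ` U) y)"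
  define N2 where "N2 = density lborel (\<lambda>x. ennreal (?D x) * indicator U x)"
  have m: "(\<lambda>y. ennreal (k y) * indicator S y) \<in> borel_measurable lborel"
    if "continuous_on S k" "open S" for k :: "real^2 \<Rightarrow> real" and S
  proof -
    have "(\<lambda>y. indicator S y *\<^sub>R k y) \<in> borel_measurable borel"
      by (rule borel_measurable_continuous_on_indicator[OF _ that(1)]) (use that in auto)
    then have "(\<lambda>y. ennreal (indicator S y *\<^sub>R k y)) \<in> borel_measurable borel" by measurable
    moreover have "(\<lambda>y. ennreal (indicator S y *\<^sub>R k y)) = (\<lambda>y. ennreal (k y) * indicator S y)"
      by (auto simp: indicator_def)
    ultimately show ?thesis by simp
  qed
  have N1: "emeasure N1 (\<tau> ` S) = set_nn_integral lborel (\<tau> ` S) (\<lambda>y. ennreal (f y))" if "S \<in> sets borel" "S \<subseteq> U" for S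
  proof -
    have "ennreal (f y) * indicator (\<tau> ` U) y * indicator (\<tau> ` S) y = ennreal (f y) * indicator (\<tau> ` S) y" for y
      using subsetD[OF image_mono[OF that(2)], of y \<tau>] by (cases "y \<in> \<tau> ` S") simp_all
    then show ?thesis
      unfolding N1_def using image_borel[OF that] by (subst emeasure_density[OF m[OF f(1) U(2)]]) simp_all
  qed
  have N2: "emeasure N2 S = set_nn_integral lborel S (\<lambda>x. ennreal (?D x))" if "S \<in> sets borel" "S \<subseteq> U" for S
    unfolding N2_def
    by (subst emeasure_density[OF m[OF contD U(1)]])
       (use that in \<open>auto intro!: nn_integral_cong simp: indicator_def\<close>)
  define Bn where "Bn n = B \<inter> (cball 0 (real n) \<inter> {x \<in> U. ?D x \<le> real n})" for n
  have Bn: "Bn n \<in> sets borel" "Bn n \<subseteq> U" "Bn n \<subseteq> B" for n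
  proof -
    have "{x \<in> U. ?D x \<le> real n} = U - {x \<in> U. ?D x \<in> {real n<..}}" by auto
    moreover have "open {x \<in> U. ?D x \<in> {real n<..}}"
      using continuous_open_preimage[OF contD U(1) open_greaterThan, of "real n"]
      by (simp add: vimage_def Int_def conj_commute)
    ultimately have "{x \<in> U. ?D x \<le> real n} \<in> sets borel" using U(1) by auto
    then show "Bn n \<in> sets borel" unfolding Bn_def using B(1) by auto
  qed (use B in \<open>auto simp: Bn_def\<close>)
  have inc: "incseq Bn" by (auto simp: incseq_def Bn_def intro: order_trans)
  have un: "(\<Union>n. Bn n) = B"
  proof -
    have "\<exists>n. x \<in> Bn n" if "x \<in> B" for x
    proof -
      obtain n where "max (norm x) (?D x) \<le> real n" using real_arch_simple by blast
      then show ?thesis using that B(2) by (auto simp: Bn_def)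
    qed
    then show ?thesis using Bn(3) by blast
  qed
  have eq: "emeasure N1 (\<tau> ` Bn n) = emeasure N2 (Bn n)" for n
  proof -
    have fm: "Bn n \<in> lmeasurable"
      by (rule bounded_set_imp_lmeasurable)
         (use Bn(1)[of n] in \<open>auto simp: Bn_def intro: bounded_subset[OF bounded_cball]\<close>)
    have Dint: "?D absolutely_integrable_on Bn n"
    proof (rule measurable_bounded_by_integrable_imp_absolutely_integrable)
      show "?D \<in> borel_measurable (lebesgue_on (Bn n))"
        using fm by (intro continuous_imp_measurable_on_sets_lebesgue continuous_on_subset[OF contD Bn(2)]) auto
      show "Bn n \<in> sets lebesgue" using fm by auto
      show "(\<lambda>x. real n) integrable_on Bn n" using fm by (simp add: integrable_on_const)
      show "norm (?D x) \<le> real n" if "x \<in> Bn n" for x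
        using that f(2) by (auto simp: Bn_def)
    qed
    have "(\<lambda>x. \<bar>det (matrix (frechet_derivative \<tau> (at x)))\<bar> *\<^sub>R vec (f (\<tau> x)) :: real^1) absolutely_integrable_on Bn n \<and>
        integral (Bn n) (\<lambda>x. \<bar>det (matrix (frechet_derivative \<tau> (at x)))\<bar> *\<^sub>R vec (f (\<tau> x))) = (vec b :: real^1) \<longleftrightarrow>
        (\<lambda>x. vec (f x) :: real^1) absolutely_integrable_on \<tau> ` Bn n \<and>
        integral (\<tau> ` Bn n) (\<lambda>x. vec (f x)) = (vec b :: real^1)" for b
    proof (rule has_absolute_integral_change_of_variables_invertible)
      show "(\<tau> has_derivative frechet_derivative \<tau> (at x)) (at x within Bn n)" if "x \<in> Bn n" for x
        using smooth_on_has_derivative[OF \<tau>, of x] Bn(2) that has_derivative_at_withinI by blast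
      show "h (\<tau> x) = x" if "x \<in> Bn n" for x using Bn(2) that h(1) by blast
      show "continuous_on (\<tau> ` Bn n) h" using Bn(2) by (intro continuous_on_subset[OF h(2)]) blast
    qed
    from this[of "integral (Bn n) ?D"] have "f absolutely_integrable_on \<tau> ` Bn n \<and> integral (\<tau> ` Bn n) f = integral (Bn n) ?D"
      using Dint by (simp add: absolutely_integrable_on_1_iff integral_on_1_eq)
    moreover have "emeasure N2 (Bn n) = ennreal (integral (Bn n) ?D)"
      unfolding N2[OF Bn(1,2)] using Bn(2)[of n]
      by (intro nn_integral_absolutely_integrable Dint) (auto intro!: mult_nonneg_nonneg f(2))
    moreover have "emeasure N1 (\<tau> ` Bn n) = ennreal (integral (\<tau> ` Bn n) f)"
      unfolding N1[OF Bn(1,2)] using calculation(1) Bn(2) f(2) by (intro nn_integral_absolutely_integrable) auto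
    ultimately show ?thesis by simp
  qed
  have "emeasure N1 (\<tau> ` B) = (SUP n. emeasure N1 (\<tau> ` Bn n))"
  proof -
    have "incseq (\<lambda>n. \<tau> ` Bn n)" using inc by (auto simp: incseq_def)
    moreover have "range (\<lambda>n. \<tau> ` Bn n) \<subseteq> sets N1" using image_borel Bn by (auto simp: N1_def)
    moreover have "(\<Union>n. \<tau> ` Bn n) = \<tau> ` B" using un by auto
    ultimately show ?thesis using SUP_emeasure_incseq[of "\<lambda>n. \<tau> ` Bn n" N1] by simp
  qed
  also have "\<dots> = (SUP n. emeasure N2 (Bn n))" by (simp add: eq)
  also have "\<dots> = emeasure N2 B"
    using SUP_emeasure_incseq[of Bn N2] inc Bn(1) un by (auto simp: N2_def)
  finally show ?thesis using N1[OF B] N2[OF B] by simp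
qed


text \<open>A positive density on a compact surface: a function in each chart that is multiplied by the Jacobian
  determinant under a change of charts.\<close>

locale chart_density =
  fixes \<A> :: "('s::{t2_space, second_countable_topology}, real^2) chart set"
    and a :: "('s, real^2) chart \<Rightarrow> 's \<Rightarrow> real"
  assumes atlas: "smooth_atlas \<A>" and compact_UNIV: "compact (UNIV :: 's set)"
    and cont: "c \<in> \<A> \<Longrightarrow> continuous_on (chart_dom c) (a c)"
    and pos: "c \<in> \<A> \<Longrightarrow> p \<in> chart_dom c \<Longrightarrow> 0 < a c p"
    and change: "c \<in> \<A> \<Longrightarrow> d \<in> \<A> \<Longrightarrow> p \<in> chart_dom c \<Longrightarrow> p \<in> chart_dom d \<Longrightarrow>
      a d p = det (matrix (dtrans d c p)) * a c p"
begin

lemmas chart = atlas_is_chart[OF atlas]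

definition chart_mass :: "('s, real^2) chart \<Rightarrow> 's set \<Rightarrow> ennreal" where
  "chart_mass c S = set_nn_integral lborel (chart_map c ` S) (\<lambda>x. ennreal (a c (chart_inv c x)))"

definition chart_measure :: "('s, real^2) chart \<Rightarrow> (real^2) measure" where
  "chart_measure c = density lborel (\<lambda>x. ennreal (a c (chart_inv c x)) * indicator (chart_img c) x)"

definition is_area_measure :: "'s measure \<Rightarrow> bool" where
  "is_area_measure \<mu> \<longleftrightarrow> sets \<mu> = sets borel \<and>
     (\<forall>c\<in>\<A>. \<forall>S\<in>sets borel. S \<subseteq> chart_dom c \<longrightarrow> emeasure \<mu> S = chart_mass c S)"

lemma chart_image_borel:
  assumes "c \<in> \<A>" "S \<in> sets borel" "S \<subseteq> chart_dom c"
  shows "chart_map c ` S \<in> sets borel"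
proof -
  note ch = chart[OF assms(1)]
  have "chart_inv c -` S \<inter> space (restrict_space borel (chart_img c)) \<in> sets (restrict_space borel (chart_img c))"
    by (rule measurable_sets[OF borel_measurable_continuous_on_restrict[OF continuous_chart_inv[OF ch]] assms(2)])
  moreover have "chart_inv c -` S \<inter> chart_img c = chart_map c ` S"
    unfolding chart_map_image_eq[OF ch assms(3)] by auto
  ultimately show ?thesis
    using open_chart_img[OF ch] by (simp add: space_restrict_space sets_restrict_space_iff)
qed

lemma continuous_density: "c \<in> \<A> \<Longrightarrow> continuous_on (chart_img c) (\<lambda>x. a c (chart_inv c x))"
  using continuous_on_compose2[OF cont continuous_chart_inv[OF chart]] chart_inv_in[OF chart] by blast

lemma measurable_on_chart:
  fixes k :: "real^2 \<Rightarrow> 'b::real_normed_vector"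
  assumes "c \<in> \<A>" "continuous_on (chart_img c) k"
  shows "(\<lambda>x. indicator (chart_img c) x *\<^sub>R k x) \<in> borel_measurable borel"
  by (rule borel_measurable_continuous_on_indicator[OF _ assms(2)]) (use open_chart_img[OF chart[OF assms(1)]] in auto)

lemma measurable_density:
  assumes "c \<in> \<A>"
  shows "(\<lambda>x. ennreal (a c (chart_inv c x)) * indicator (chart_img c) x) \<in> borel_measurable borel"
proof -
  have "(\<lambda>x. ennreal (indicator (chart_img c) x *\<^sub>R a c (chart_inv c x))) \<in> borel_measurable borel"
    using measurable_on_chart[OF assms continuous_density[OF assms]] by measurable
  also have "(\<lambda>x. ennreal (indicator (chart_img c) x *\<^sub>R a c (chart_inv c x)))
      = (\<lambda>x. ennreal (a c (chart_inv c x)) * indicator (chart_img c) x)"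
    by (auto simp: indicator_def)
  finally show ?thesis .
qed

lemma chart_mass_eq:
  assumes "c \<in> \<A>" "S \<in> sets borel" "S \<subseteq> chart_dom c"
  shows "chart_mass c S = emeasure (chart_measure c) (chart_map c ` S)"
proof -
  have sub: "chart_map c ` S \<subseteq> chart_img c" using assms(3) by (auto simp: chart_img_def)
  have "ennreal (a c (chart_inv c x)) * indicator (chart_img c) x * indicator (chart_map c ` S) x
      = ennreal (a c (chart_inv c x)) * indicator (chart_map c ` S) x" for x
    using subsetD[OF sub, of x] by (cases "x \<in> chart_map c ` S") simp_all
  then show ?thesis
    unfolding chart_mass_def chart_measure_def
    using measurable_density[OF assms(1)] chart_image_borel[OF assms]
    by (subst emeasure_density) simp_all
qed

text \<open>The transformation law of the density compensates the change of variables. The quotient of two positive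
  densities is positive, so that the absolute value of the Jacobian causes no sign.\<close>

lemma chart_mass_change:
  assumes c: "c \<in> \<A>" "d \<in> \<A>" and S: "S \<in> sets borel" "S \<subseteq> chart_dom c" "S \<subseteq> chart_dom d"
  shows "chart_mass c S = chart_mass d S"
proof -
  let ?\<tau> = "transition c d" and ?U = "overlap c d" and ?f = "\<lambda>y. a d (chart_inv d y)"
  note chc = chart[OF c(1)] and chd = chart[OF c(2)]
  have U: "\<exists>p. p \<in> chart_dom c \<and> p \<in> chart_dom d \<and> x = chart_map c p" if "x \<in> ?U" for x
    using that by (auto simp: overlap_def)
  have tU: "?\<tau> ` ?U = overlap d c"
    unfolding overlap_def image_image Int_commute[of "chart_dom d"]
    by (rule image_cong) (simp_all add: transition_apply[OF chc])
  have tS: "?\<tau> ` (chart_map c ` S) = chart_map d ` S"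
    unfolding image_image using S by (intro image_cong) (auto simp: transition_apply[OF chc])
  have sub: "chart_map c ` S \<subseteq> ?U" using S by (auto simp: overlap_def)
  have "overlap d c \<subseteq> chart_img d" by (auto simp: overlap_eq[OF chd])
  then have "continuous_on (?\<tau> ` ?U) ?f" unfolding tU by (rule continuous_on_subset[OF continuous_density[OF c(2)]])
  moreover have "continuous_on (?\<tau> ` ?U) (transition d c)"
    unfolding tU by (rule smooth_on_continuous[OF transition_smooth[OF atlas c(2,1)]])
  moreover have "transition d c (?\<tau> x) = x" if x: "x \<in> ?U" for x
    using U[OF x] by (auto simp: transition_apply[OF chc] transition_apply[OF chd])
  moreover have "0 \<le> ?f y" if "y \<in> ?\<tau> ` ?U" for y
    using that pos[OF c(2), of "chart_inv d y"] unfolding tU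
    by (auto simp: overlap_eq[OF chd] chart_inv_in[OF chd] less_imp_le)
  ultimately have "chart_mass d S = set_nn_integral lborel (chart_map c ` S)
      (\<lambda>x. ennreal (\<bar>det (matrix (frechet_derivative ?\<tau> (at x)))\<bar> * ?f (?\<tau> x)))"
    unfolding chart_mass_def tS[symmetric]
    by (intro nn_integral_change_of_variables[where U = ?U and h = "transition d c"] open_overlap chc chd
        transition_smooth[OF atlas c] chart_image_borel[OF c(1) S(1,2)] sub) (auto simp: tU intro: open_overlap chc chd)
  also have "\<dots> = chart_mass c S"
    unfolding chart_mass_def
  proof (rule nn_integral_cong)
    fix x
    have "\<bar>det (matrix (frechet_derivative ?\<tau> (at x)))\<bar> * ?f (?\<tau> x) = a c (chart_inv c x)" if "x \<in> ?U"
    proof -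
      obtain p where p: "p \<in> chart_dom c" "p \<in> chart_dom d" "x = chart_map c p" using U \<open>x \<in> ?U\<close> by blast
      have e: "a c p = det (matrix (dtrans c d p)) * a d p" by (rule change[OF c(2,1) p(2,1)])
      then have "0 < det (matrix (dtrans c d p))"
        using pos[OF c(1) p(1)] pos[OF c(2) p(2)] by (simp add: zero_less_mult_iff)
      then show ?thesis
        using e by (simp add: p(3) transition_apply[OF chc p(1)] chart_inv_chart[OF chd p(2)] chart_inv_chart[OF chc p(1)])
    qed
    then show "ennreal (\<bar>det (matrix (frechet_derivative ?\<tau> (at x)))\<bar> * ?f (?\<tau> x)) * indicator (chart_map c ` S) x
      = ennreal (a c (chart_inv c x)) * indicator (chart_map c ` S) x"
      using sub by (auto simp: indicator_def)
  qed
  finally show ?thesis ..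
qed

lemma finite_chart_partition:
  "\<exists>(n::nat) cs D. (\<forall>i<n. cs i \<in> \<A> \<and> D i \<subseteq> chart_dom (cs i)) \<and> (\<forall>i. D i \<in> sets borel) \<and>
    disjoint_family D \<and> (\<Union>i<n. D i) = UNIV"
proof -
  have "\<forall>U\<in>chart_dom ` \<A>. open U" using open_chart_dom[OF chart] by blast
  moreover have "UNIV \<subseteq> \<Union>(chart_dom ` \<A>)" using atlas unfolding smooth_atlas_def by blast
  ultimately obtain \<U> where \<U>: "\<U> \<subseteq> chart_dom ` \<A>" "finite \<U>" "UNIV \<subseteq> \<Union>\<U>"
    using compact_UNIV unfolding compact_eq_Heine_Borel by meson
  then obtain \<C> where \<C>: "\<C> \<subseteq> \<A>" "finite \<C>" "\<U> = chart_dom ` \<C>"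
    using finite_subset_image by metis
  obtain cs where cs: "set cs = \<C>" using finite_list[OF \<C>(2)] by blast
  define X where "X i = (if i < length cs then chart_dom (cs ! i) else {})" for i
  have X: "X i \<in> sets borel" for i
  proof (cases "i < length cs")
    case True
    then have "cs ! i \<in> \<A>" using \<C>(1) cs nth_mem by blast
    then show ?thesis using True by (simp add: X_def borel_open open_chart_dom[OF chart])
  qed (simp add: X_def)
  have un: "(\<Union>i. X i) = UNIV"
  proof -
    have "\<exists>i. p \<in> X i" for p
    proof -
      obtain c where "c \<in> set cs" "p \<in> chart_dom c" using \<U>(3) \<C>(3) cs by blast
      then show ?thesis by (metis X_def in_set_conv_nth)
    qed
    then show ?thesis by blast
  qed
  show ?thesis
  proof (intro exI[of _ "length cs"] exI[of _ "\<lambda>i. cs ! i"] exI[of _ "disjointed X"] conjI allI impI)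
    show "cs ! i \<in> \<A>" if "i < length cs" for i using that cs \<C>(1) by auto
    show "disjointed X i \<subseteq> chart_dom (cs ! i)" if "i < length cs" for i
      using disjointed_subset[of X i] that by (simp add: X_def)
    show "disjointed X i \<in> sets borel" for i
      using sets.range_disjointed_sets[of X borel] X by blast
    show "disjoint_family (disjointed X)" by (rule disjoint_family_disjointed)
    have "disjointed X i = {}" if "\<not> i < length cs" for i
      using disjointed_subset[of X i] that by (simp add: X_def)
    then have "(\<Union>i<length cs. disjointed X i) = (\<Union>i. disjointed X i)" by auto
    then show "(\<Union>i<length cs. disjointed X i) = UNIV" by (simp add: UN_disjointed_eq un)
  qed
qed

text \<open>The measure of a set is the sum of the masses of its parts in a finite disjoint partition, each part being
  measured in a chart that contains it. This agrees with the mass in any other chart by the change of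
  variables, and it is forced by additivity.\<close>

lemma area_measure_ex1: "\<exists>!\<mu>. is_area_measure \<mu>"
proof -
  obtain n :: nat and cs D where cs: "\<And>i. i < n \<Longrightarrow> cs i \<in> \<A>" and D: "\<And>i. i < n \<Longrightarrow> D i \<subseteq> chart_dom (cs i)"
    "\<And>i. D i \<in> sets borel" "disjoint_family D" "(\<Union>i<n. D i) = UNIV"
    using finite_chart_partition by blast
  define m where "m S = (\<Sum>i<n. chart_mass (cs i) (S \<inter> D i))" for S
  have split: "emeasure M S = (\<Sum>i<n. emeasure M (S \<inter> D i))" if "sets M = sets borel" "S \<in> sets borel" for M S
  proof -
    have "(\<Sum>i<n. emeasure M (S \<inter> D i)) = emeasure M (\<Union>i<n. S \<inter> D i)"
      using D that by (intro sum_emeasure) (auto simp: disjoint_family_on_def, blast)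
    also have "(\<Union>i<n. S \<inter> D i) = S" using D(4) by auto
    finally show ?thesis ..
  qed
  define \<mu> where "\<mu> = measure_of UNIV (sets borel) m"
  have sets: "sets \<mu> = sets borel"
    unfolding \<mu>_def using sets.sets_measure_of_eq[of borel] by (simp add: sets_measure_of_conv sets.sigma_sets_eq[of borel, simplified])
  have cm: "chart_mass (cs i) (S \<inter> D i) = emeasure (chart_measure (cs i)) (chart_map (cs i) ` (S \<inter> D i))"
    if "i < n" "S \<in> sets borel" for i S
    using that D cs by (intro chart_mass_eq) auto
  have "countably_additive (sets borel) m"
  proof (rule countably_additiveI)
    fix S :: "nat \<Rightarrow> 's set" assume S: "range S \<subseteq> sets borel" "disjoint_family S"
    have "(\<Sum>k. m (S k)) = (\<Sum>i<n. \<Sum>k. chart_mass (cs i) (S k \<inter> D i))"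
      unfolding m_def by (rule suminf_sum) simp
    also have "\<dots> = m (\<Union>k. S k)"
      unfolding m_def
    proof (rule sum.cong[OF refl])
      fix i assume "i \<in> {..<n}"
      then have i: "i < n" by simp
      have "(\<Sum>k. emeasure (chart_measure (cs i)) (chart_map (cs i) ` (S k \<inter> D i)))
        = emeasure (chart_measure (cs i)) (\<Union>k. chart_map (cs i) ` (S k \<inter> D i))"
      proof (rule suminf_emeasure)
        show "range (\<lambda>k. chart_map (cs i) ` (S k \<inter> D i)) \<subseteq> sets (chart_measure (cs i))"
          using S(1) D(1,2) cs i by (auto simp: chart_measure_def intro!: chart_image_borel)
        show "disjoint_family (\<lambda>k. chart_map (cs i) ` (S k \<inter> D i))"
          unfolding disjoint_family_on_def
        proof (intro ballI impI)
          fix k l :: nat assume "k \<noteq> l"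
          then have "(S k \<inter> D i) \<inter> (S l \<inter> D i) = {}" using S(2) by (auto simp: disjoint_family_on_def)
          moreover have "chart_map (cs i) ` (S k \<inter> D i) \<inter> chart_map (cs i) ` (S l \<inter> D i)
            = chart_map (cs i) ` ((S k \<inter> D i) \<inter> (S l \<inter> D i))"
            using D(1)[OF i] by (intro inj_on_image_Int[OF inj_on_chart_map[OF chart[OF cs[OF i]]], symmetric]) auto
          ultimately show "chart_map (cs i) ` (S k \<inter> D i) \<inter> chart_map (cs i) ` (S l \<inter> D i) = {}" by simp
        qed
      qed
      also have "(\<Union>k. chart_map (cs i) ` (S k \<inter> D i)) = chart_map (cs i) ` ((\<Union>k. S k) \<inter> D i)" by auto
      finally show "(\<Sum>k. chart_mass (cs i) (S k \<inter> D i)) = chart_mass (cs i) ((\<Union>k. S k) \<inter> D i)"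
        using S(1) i by (subst (1 2) cm) (auto simp: cm)
    qed
    finally show "(\<Sum>k. m (S k)) = m (\<Union>k. S k)" .
  qed
  moreover have "positive (sets borel) m" by (simp add: positive_def m_def chart_mass_def)
  ultimately have em: "emeasure \<mu> S = m S" if "S \<in> sets borel" for S
    unfolding \<mu>_def using that sets.sigma_algebra_axioms[of borel]
    by (intro emeasure_measure_of_sigma) (simp_all add: sets.sigma_algebra_axioms[of borel, simplified])
  have "emeasure \<mu> S = chart_mass c S" if c: "c \<in> \<A>" and S: "S \<in> sets borel" "S \<subseteq> chart_dom c" for c S
  proof -
    have "m S = (\<Sum>i<n. chart_mass c (S \<inter> D i))"
      unfolding m_def using c S D cs by (intro sum.cong refl chart_mass_change) auto
    also have "\<dots> = (\<Sum>i<n. emeasure (chart_measure c) (chart_map c ` (S \<inter> D i)))"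
      using c S D by (intro sum.cong refl chart_mass_eq) auto
    also have "\<dots> = emeasure (chart_measure c) (\<Union>i<n. chart_map c ` (S \<inter> D i))"
    proof (rule sum_emeasure)
      show "(\<lambda>i. chart_map c ` (S \<inter> D i)) ` {..<n} \<subseteq> sets (chart_measure c)"
        using c S D(2) by (auto simp: chart_measure_def intro!: chart_image_borel)
      show "disjoint_family_on (\<lambda>i. chart_map c ` (S \<inter> D i)) {..<n}"
        unfolding disjoint_family_on_def
      proof (intro ballI impI)
        fix k l :: nat assume "k \<noteq> l"
        then have "(S \<inter> D k) \<inter> (S \<inter> D l) = {}" using D(3) by (auto simp: disjoint_family_on_def)
        moreover have "chart_map c ` (S \<inter> D k) \<inter> chart_map c ` (S \<inter> D l) = chart_map c ` ((S \<inter> D k) \<inter> (S \<inter> D l))"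
          using S(2) by (intro inj_on_image_Int[OF inj_on_chart_map[OF chart[OF c]], symmetric]) auto
        ultimately show "chart_map c ` (S \<inter> D k) \<inter> chart_map c ` (S \<inter> D l) = {}" by simp
      qed
    qed simp
    also have "(\<Union>i<n. chart_map c ` (S \<inter> D i)) = chart_map c ` S" using D(4) by blast
    finally show ?thesis using em[OF S(1)] chart_mass_eq[OF c S] by simp
  qed
  then have "is_area_measure \<mu>" by (simp add: is_area_measure_def sets)
  moreover have "\<nu> = \<mu>" if \<nu>: "is_area_measure \<nu>" for \<nu>
  proof (rule measure_eqI)
    show "sets \<nu> = sets \<mu>" using \<nu> by (simp add: is_area_measure_def sets)
    fix S assume "S \<in> sets \<nu>"
    then have S: "S \<in> sets borel" using \<nu> by (simp add: is_area_measure_def)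
    have "emeasure \<nu> S = (\<Sum>i<n. emeasure \<nu> (S \<inter> D i))" using \<nu> S by (intro split) (simp_all add: is_area_measure_def)
    also have "\<dots> = m S" unfolding m_def
    proof (rule sum.cong[OF refl])
      fix i assume "i \<in> {..<n}"
      then have "cs i \<in> \<A>" "S \<inter> D i \<in> sets borel" "S \<inter> D i \<subseteq> chart_dom (cs i)" using cs D S by auto
      then show "emeasure \<nu> (S \<inter> D i) = chart_mass (cs i) (S \<inter> D i)" using \<nu> unfolding is_area_measure_def by blast
    qed
    finally show "emeasure \<nu> S = emeasure \<mu> S" using em[OF S] by simp
  qed
  ultimately show ?thesis by blast
qed

context
  fixes \<mu> assumes \<mu>: "is_area_measure \<mu>"
begin

lemma area_sets: "sets \<mu> = sets borel"
  using \<mu> by (simp add: is_area_measure_def)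

lemma area_space: "space \<mu> = UNIV"
  using sets_eq_imp_space_eq[OF area_sets] by simp

lemma area_measurable: "measurable \<mu> N = measurable borel N"
  by (rule measurable_cong_sets[OF area_sets refl])

text \<open>The chart with its inverse transports the density on the image to the area measure on the
  domain. Outside the image, where the density is zero, the extended inverse has a default value.\<close>

lemma area_distr:
  assumes c: "c \<in> \<A>"
  defines "k \<equiv> \<lambda>x. if x \<in> chart_img c then chart_inv c x else undefined"
  shows "k \<in> borel \<rightarrow>\<^sub>M borel" "density \<mu> (indicator (chart_dom c)) = distr (chart_measure c) borel k"
proof -
  note ch = chart[OF c]
  show k: "k \<in> borel \<rightarrow>\<^sub>M borel"
    unfolding k_def
  proof (rule measurable_If_restrict_space_iff[THEN iffD2], safe)
    show "{x \<in> space borel. x \<in> chart_img c} \<in> sets borel" using open_chart_img[OF ch] by simp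
    show "chart_inv c \<in> restrict_space borel {x. x \<in> chart_img c} \<rightarrow>\<^sub>M borel"
      using borel_measurable_continuous_on_restrict[OF continuous_chart_inv[OF ch]] by simp
  qed simp
  show "density \<mu> (indicator (chart_dom c)) = distr (chart_measure c) borel k"
  proof (rule measure_eqI)
    show "sets (density \<mu> (indicator (chart_dom c))) = sets (distr (chart_measure c) borel k)"
      by (simp add: area_sets)
    fix S assume "S \<in> sets (density \<mu> (indicator (chart_dom c)))"
    then have S: "S \<in> sets borel" by (simp add: area_sets)
    have d: "chart_dom c \<in> sets borel" using open_chart_dom[OF ch] by simp
    have "emeasure (density \<mu> (indicator (chart_dom c))) S = emeasure \<mu> (S \<inter> chart_dom c)"
      using S d area_sets
      by (subst emeasure_density) (auto simp: area_measurable indicator_inter_arith[symmetric] mult.commute)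
    also have "\<dots> = emeasure (chart_measure c) (chart_map c ` (S \<inter> chart_dom c))"
      using \<mu> c S d chart_mass_eq[OF c, of "S \<inter> chart_dom c"] by (simp add: is_area_measure_def)
    also have "\<dots> = emeasure (chart_measure c) (k -` S)"
    proof -
      have "k -` S \<in> sets borel" using measurable_sets[OF k S] by simp
      moreover have "chart_map c ` (S \<inter> chart_dom c) = {x \<in> chart_img c. k x \<in> S}"
        using chart_inv_in[OF ch] by (subst chart_map_image_eq[OF ch]) (auto simp: k_def)
      moreover have "chart_map c ` (S \<inter> chart_dom c) \<in> sets borel" using S d c by (intro chart_image_borel) auto
      ultimately show ?thesis
        unfolding chart_measure_def using measurable_density[OF c]
        by (subst (1 2) emeasure_density) (auto intro!: nn_integral_cong simp: indicator_def)
    qed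
    also have "\<dots> = emeasure (distr (chart_measure c) borel k) S"
      using k S by (subst emeasure_distr) (auto simp: chart_measure_def)
    finally show "emeasure (density \<mu> (indicator (chart_dom c))) S = emeasure (distr (chart_measure c) borel k) S" .
  qed
qed

lemma nn_integral_area_chart:
  assumes c: "c \<in> \<A>" and h: "h \<in> borel_measurable borel"
  shows "(\<integral>\<^sup>+p. indicator (chart_dom c) p * h p \<partial>\<mu>)
    = (\<integral>\<^sup>+x. ennreal (a c (chart_inv c x)) * indicator (chart_img c) x * h (chart_inv c x) \<partial>lborel)"
proof -
  let ?k = "\<lambda>x. if x \<in> chart_img c then chart_inv c x else undefined"
  note k = area_distr(1)[OF c]
  have d: "chart_dom c \<in> sets borel" using open_chart_dom[OF chart[OF c]] by simp
  have "(\<integral>\<^sup>+p. indicator (chart_dom c) p * h p \<partial>\<mu>) = (\<integral>\<^sup>+p. h p \<partial>density \<mu> (indicator (chart_dom c)))"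
    using h d by (subst nn_integral_density) (auto simp: area_measurable)
  also have "\<dots> = (\<integral>\<^sup>+x. h (?k x) \<partial>chart_measure c)"
    unfolding area_distr(2)[OF c] using h k by (subst nn_integral_distr) (auto simp: chart_measure_def)
  also have "\<dots> = (\<integral>\<^sup>+x. ennreal (a c (chart_inv c x)) * indicator (chart_img c) x * h (?k x) \<partial>lborel)"
    unfolding chart_measure_def using measurable_density[OF c] measurable_compose[OF k h]
    by (subst nn_integral_density) auto
  also have "\<dots> = (\<integral>\<^sup>+x. ennreal (a c (chart_inv c x)) * indicator (chart_img c) x * h (chart_inv c x) \<partial>lborel)"
    by (rule nn_integral_cong) (simp add: indicator_def)
  finally show ?thesis .
qed

lemma integral_area_chart:
  fixes h :: "'s \<Rightarrow> real"
  assumes c: "c \<in> \<A>" and h: "h \<in> borel_measurable borel" "\<And>p. p \<notin> chart_dom c \<Longrightarrow> h p = 0"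
  shows "integral\<^sup>L \<mu> h = (\<integral>x. indicator (chart_img c) x * (a c (chart_inv c x) * h (chart_inv c x)) \<partial>lborel)"
proof -
  let ?k = "\<lambda>x. if x \<in> chart_img c then chart_inv c x else undefined"
  note k = area_distr(1)[OF c]
  have d: "chart_dom c \<in> sets borel" using open_chart_dom[OF chart[OF c]] by simp
  have w: "density \<mu> (indicator (chart_dom c)) = density \<mu> (\<lambda>p. ennreal (indicator (chart_dom c) p))"
    by (simp add: ennreal_indicator)
  have "integral\<^sup>L \<mu> h = (\<integral>p. indicator (chart_dom c) p *\<^sub>R h p \<partial>\<mu>)"
    using h(2) by (intro Bochner_Integration.integral_cong) (auto simp: indicator_def)
  also have "\<dots> = (\<integral>p. h p \<partial>density \<mu> (indicator (chart_dom c)))"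
    unfolding w using h(1) d by (subst integral_density) (auto simp: area_measurable)
  also have "\<dots> = (\<integral>x. h (?k x) \<partial>chart_measure c)"
    unfolding area_distr(2)[OF c] using h(1) k by (subst integral_distr) (auto simp: chart_measure_def)
  also have "chart_measure c = density lborel (\<lambda>x. ennreal (indicator (chart_img c) x *\<^sub>R a c (chart_inv c x)))"
    unfolding chart_measure_def by (rule arg_cong[where f = "density lborel"]) (auto simp: indicator_def)
  also have "(\<integral>x. h (?k x) \<partial>\<dots>) = (\<integral>x. (indicator (chart_img c) x *\<^sub>R a c (chart_inv c x)) *\<^sub>R h (?k x) \<partial>lborel)"
  proof (rule integral_density)
    show "(\<lambda>x. indicator (chart_img c) x *\<^sub>R a c (chart_inv c x)) \<in> borel_measurable lborel"
      using measurable_on_chart[OF c continuous_density[OF c]] by simp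
    show "(\<lambda>x. h (?k x)) \<in> borel_measurable lborel" using measurable_compose[OF k h(1)] by simp
    show "AE x in lborel. 0 \<le> indicator (chart_img c) x *\<^sub>R a c (chart_inv c x)"
      using pos[OF c] chart_inv_in[OF chart[OF c]] by (auto simp: indicator_def intro!: AE_I2 less_imp_le)
  qed
  also have "\<dots> = (\<integral>x. indicator (chart_img c) x * (a c (chart_inv c x) * h (chart_inv c x)) \<partial>lborel)"
    by (rule Bochner_Integration.integral_cong) (auto simp: indicator_def)
  finally show ?thesis .
qed

text \<open>Every point has a neighbourhood of finite measure, namely a coordinate ball on whose closure the density is
  bounded; finitely many of these cover the surface.\<close>

lemma finite_area: "finite_measure \<mu>"
proof
  have "\<exists>U. open U \<and> p \<in> U \<and> emeasure \<mu> U < \<infinity>" for p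
  proof -
    note c = chart_at[OF atlas, of p]
    let ?c = "chart_at \<A> p"
    note ch = chart[OF c(1)]
    obtain r where r: "r > 0" "cball (chart_map ?c p) r \<subseteq> chart_img ?c"
      using open_contains_cball chart_map_in[OF ch c(2)] open_chart_img[OF ch] by metis
    define U where "U = {q \<in> chart_dom ?c. chart_map ?c q \<in> ball (chart_map ?c p) r}"
    have U: "open U" "p \<in> U" "U \<subseteq> chart_dom ?c"
      using continuous_open_preimage[OF continuous_chart_map[OF ch] open_chart_dom[OF ch] open_ball, of "chart_map ?c p" r] r c
      by (auto simp: U_def vimage_def Int_def conj_commute)
    let ?b = "ball (chart_map ?c p) r" and ?K = "cball (chart_map ?c p) r"
    have "compact ((\<lambda>x. a ?c (chart_inv ?c x)) ` ?K)"
      by (intro compact_continuous_image continuous_on_subset[OF continuous_density[OF c(1)] r(2)]) simp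
    then obtain M where M: "\<And>x. x \<in> ?K \<Longrightarrow> a ?c (chart_inv ?c x) \<le> M"
      using compact_imp_bounded bounded_real by (metis abs_le_D1 imageI)
    have "emeasure \<mu> U = chart_mass ?c U" using \<mu> U c by (auto simp: is_area_measure_def)
    also have "\<dots> \<le> (\<integral>\<^sup>+x. ennreal M * indicator ?b x \<partial>lborel)"
      unfolding chart_mass_def
      by (rule nn_integral_mono) (use M in \<open>auto simp: indicator_def U_def intro!: ennreal_leI\<close>)
    also have "\<dots> = ennreal M * emeasure lborel ?b" by (simp add: nn_integral_cmult_indicator)
    also have "\<dots> < \<infinity>" using emeasure_lborel_ball_finite[of "chart_map ?c p" r] by (simp add: ennreal_mult_less_top)
    finally show ?thesis using U by blast
  qed
  then obtain U where U: "\<And>p. open (U p)" "\<And>p. p \<in> U p" "\<And>p. emeasure \<mu> (U p) < \<infinity>" by metis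
  have "\<forall>V\<in>range U. open V" "UNIV \<subseteq> \<Union>(range U)" using U by blast+
  then obtain \<V> where V: "\<V> \<subseteq> range U" "finite \<V>" "UNIV \<subseteq> \<Union>\<V>"
    using compact_UNIV unfolding compact_eq_Heine_Borel by meson
  have "emeasure \<mu> (\<Union>V\<in>\<V>. V) \<le> (\<Sum>V\<in>\<V>. emeasure \<mu> V)"
    using V U(1) by (intro emeasure_subadditive_finite) (auto simp: area_sets)
  also have "\<dots> < \<infinity>" using V U(3) by (auto simp: less_top sum_Pinfty)
  finally show "emeasure \<mu> (space \<mu>) \<noteq> \<infinity>" using V(3) by (simp add: area_space top.extremum_unique)
qed

lemma integrable_continuous_area:
  fixes h :: "'s \<Rightarrow> real"
  assumes "continuous_on UNIV h"
  shows "integrable \<mu> h"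
proof -
  have "compact (h ` UNIV)" by (rule compact_continuous_image[OF assms compact_UNIV])
  then obtain K where "\<And>p. \<bar>h p\<bar> \<le> K" using compact_imp_bounded bounded_real by (metis rangeI)
  then show ?thesis
    using borel_measurable_continuous_onI[OF assms]
    by (intro finite_measure.integrable_const_bound[OF finite_area, where B = K]) (auto simp: area_measurable)
qed

end

end

section \<open>Families of immersions and the derivative of the functional\<close>

text \<open>By the mean value theorem \<open>w\<close> dominates the difference quotients.\<close>

lemma has_real_derivative_integral:
  fixes f :: "real \<Rightarrow> 'a \<Rightarrow> real"
  assumes \<delta>: "0 < \<delta>" and int: "\<And>t. \<bar>t\<bar> < \<delta> \<Longrightarrow> integrable M (f t)"
    and deriv: "\<And>t p. \<bar>t\<bar> < \<delta> \<Longrightarrow> p \<in> space M \<Longrightarrow> ((\<lambda>s. f s p) has_real_derivative f' t p) (at t)"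
    and bound: "\<And>t p. \<bar>t\<bar> < \<delta> \<Longrightarrow> p \<in> space M \<Longrightarrow> \<bar>f' t p\<bar> \<le> w p" and w: "integrable M w"
  shows "((\<lambda>t. \<integral>p. f t p \<partial>M) has_real_derivative (\<integral>p. f' 0 p \<partial>M)) (at 0)"
proof -
  have lip: "\<bar>(f h p - f 0 p) / h\<bar> \<le> w p" if "\<bar>h\<bar> < \<delta>" "h \<noteq> 0" "p \<in> space M" for h p
  proof -
    have "norm (f h p - f 0 p) \<le> w p * norm (h - 0)"
    proof (rule field_differentiable_bound[of "{-\<delta><..<\<delta>}" "\<lambda>s. f s p" "\<lambda>t. f' t p"])
      show "((\<lambda>s. f s p) has_real_derivative f' t p) (at t within {-\<delta><..<\<delta>})" if "t \<in> {-\<delta><..<\<delta>}" for t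
      proof -
        have "\<bar>t\<bar> < \<delta>" using that by (simp add: abs_less_iff)
        from deriv[OF this \<open>p \<in> space M\<close>] show ?thesis by (rule has_field_derivative_at_within)
      qed
      show "norm (f' t p) \<le> w p" if "t \<in> {-\<delta><..<\<delta>}" for t
        using bound[of t p] that \<open>p \<in> space M\<close> by (simp add: abs_less_iff)
    qed (use that \<delta> in \<open>simp_all add: abs_less_iff\<close>)
    then show ?thesis using that(2) by (simp add: abs_divide divide_le_eq)
  qed
  have "(\<lambda>n. ((\<integral>p. f (S n) p \<partial>M) - (\<integral>p. f 0 p \<partial>M)) / S n) \<longlonglongrightarrow> (\<integral>p. f' 0 p \<partial>M)"
    if S0: "\<And>n. S n \<noteq> 0" and S: "S \<longlonglongrightarrow> 0" for S :: "nat \<Rightarrow> real"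
  proof -
    obtain N where N: "\<And>n. n \<ge> N \<Longrightarrow> \<bar>S n\<bar> < \<delta>"
      using LIMSEQ_D[OF S \<delta>] by auto
    define R where "R n = S (n + N)" for n
    have R: "R n \<noteq> 0" "\<bar>R n\<bar> < \<delta>" for n using S0 N by (auto simp: R_def)
    have "R \<longlonglongrightarrow> 0" unfolding R_def using S by (rule LIMSEQ_ignore_initial_segment)
    then have lim: "(\<lambda>n. (f (R n) p - f 0 p) / R n) \<longlonglongrightarrow> f' 0 p" if "p \<in> space M" for p
      using deriv[of 0 p] that \<delta> R(1) unfolding DERIV_def LIMSEQ_SEQ_conv[symmetric] by auto
    have m: "(\<lambda>p. (f (R n) p - f 0 p) / R n) \<in> borel_measurable M" for n
      using borel_measurable_integrable[OF int[OF R(2)]] borel_measurable_integrable[OF int[of 0]] \<delta> by auto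
    have "f' 0 \<in> borel_measurable M" by (rule borel_measurable_LIMSEQ_real[OF lim m])
    then have "(\<lambda>n. \<integral>p. (f (R n) p - f 0 p) / R n \<partial>M) \<longlonglongrightarrow> (\<integral>p. f' 0 p \<partial>M)"
      using lip[OF R(2,1)] by (intro integral_dominated_convergence[OF _ m w] AE_I2 lim) auto
    moreover have "(\<integral>p. (f (R n) p - f 0 p) / R n \<partial>M) = ((\<integral>p. f (R n) p \<partial>M) - (\<integral>p. f 0 p \<partial>M)) / R n" for n
      using int[OF R(2)] int[of 0] \<delta> by simp
    ultimately have "(\<lambda>n. ((\<integral>p. f (R n) p \<partial>M) - (\<integral>p. f 0 p \<partial>M)) / R n) \<longlonglongrightarrow> (\<integral>p. f' 0 p \<partial>M)"
      by (simp only:)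
    then show ?thesis unfolding R_def by (rule LIMSEQ_offset)
  qed
  then show ?thesis unfolding DERIV_def LIMSEQ_SEQ_conv[symmetric] by simp
qed

lemma continuous_on_local:
  fixes f :: "'a::t2_space \<Rightarrow> 'b::topological_space"
  assumes "\<And>x. x \<in> S \<Longrightarrow> \<exists>T. open T \<and> x \<in> T \<and> continuous_on T f"
  shows "continuous_on S f"
proof (intro continuous_at_imp_continuous_on ballI)
  fix x assume "x \<in> S"
  then obtain T where "open T" "x \<in> T" "continuous_on T f" using assms by blast
  then show "isCont f x" by (simp add: continuous_on_eq_continuous_at)
qed

lemma surface_family_subset:
  assumes "surface_family V g W \<phi>" "open W'" "W' \<subseteq> W"
  shows "surface_family V g W' \<phi>"
proof -
  interpret surface_family V g W \<phi> by fact
  show ?thesis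
    by unfold_locales (use assms(2,3) smooth_on_subset[OF smooth_phi] phi_V in auto)
qed

lemma (in surface_in_hermite) open_family_domain:
  fixes \<Phi> :: "real \<Rightarrow> 's \<Rightarrow> 'm"
  assumes "continuous_on ({-\<epsilon><..<\<epsilon>} \<times> UNIV) (\<lambda>(t, p). \<Phi> t p)" "c \<in> \<A>" "C \<in> \<B>"
  shows "open {(t, x). t \<in> {-\<epsilon><..<\<epsilon>} \<and> x \<in> chart_img c \<and> \<Phi> t (chart_inv c x) \<in> chart_dom C}"
proof -
  note ch = chart_A[OF assms(2)]
  let ?S = "{-\<epsilon><..<\<epsilon>} \<times> chart_img c"
  have "continuous_on ?S (\<lambda>z. (\<lambda>(t, p). \<Phi> t p) (fst z, chart_inv c (snd z)))"
    by (rule continuous_on_compose2[OF assms(1)])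
       (auto intro!: continuous_intros continuous_on_compose2[OF continuous_chart_inv[OF ch]])
  moreover have "open ?S" by (intro open_Times open_chart_img[OF ch]) simp
  ultimately have "open (?S \<inter> (\<lambda>z. (\<lambda>(t, p). \<Phi> t p) (fst z, chart_inv c (snd z))) -` chart_dom C)"
    using open_chart_dom[OF chart_B[OF assms(3)]] by (intro continuous_open_preimage)
  also have "?S \<inter> (\<lambda>z. (\<lambda>(t, p). \<Phi> t p) (fst z, chart_inv c (snd z))) -` chart_dom C
      = {(t, x). t \<in> {-\<epsilon><..<\<epsilon>} \<and> x \<in> chart_img c \<and> \<Phi> t (chart_inv c x) \<in> chart_dom C}"
    by auto
  finally show ?thesis .
qed

text \<open>Families of immersions without a condition on the variational field. A single immersion is regarded as a
  constant family, so that the relation between coordinates and geometry is established only once.\<close>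

locale immersed_family = surface_in_hermite \<A> \<B> G
  for \<A> :: "('s::{t2_space, second_countable_topology}, real^2) chart set"
    and \<B> :: "('m::{t2_space, second_countable_topology}, complex^2) chart set"
    and G :: "('m, complex^2) metric_tensor" +
  fixes \<Phi> :: "real \<Rightarrow> 's \<Rightarrow> 'm" and \<epsilon> :: real
  assumes eps: "0 < \<epsilon>"
    and cont_family: "continuous_on ({-\<epsilon><..<\<epsilon>} \<times> UNIV) (\<lambda>(t, p). \<Phi> t p)"
    and smooth_family: "c \<in> \<A> \<Longrightarrow> C \<in> \<B> \<Longrightarrow> smooth_on (\<lambda>(t, x). local_rep c C (\<Phi> t) x)
      {(t, x). t \<in> {-\<epsilon><..<\<epsilon>} \<and> x \<in> chart_img c \<and> \<Phi> t (chart_inv c x) \<in> chart_dom C}"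
    and immersion_family: "t \<in> {-\<epsilon><..<\<epsilon>} \<Longrightarrow> immersion \<A> \<B> (\<Phi> t)"
begin

definition fam_dom :: "('s, real^2) chart \<Rightarrow> ('m, complex^2) chart \<Rightarrow> (real \<times> (real^2)) set" where
  "fam_dom c C = {(t, x). t \<in> {-\<epsilon><..<\<epsilon>} \<and> x \<in> chart_img c \<and> \<Phi> t (chart_inv c x) \<in> chart_dom C}"

definition fam_rep :: "('s, real^2) chart \<Rightarrow> ('m, complex^2) chart \<Rightarrow> real \<times> (real^2) \<Rightarrow> complex^2" where
  "fam_rep c C = (\<lambda>(t, x). local_rep c C (\<Phi> t) x)"

abbreviation metric_in :: "('m, complex^2) chart \<Rightarrow> complex^2 \<Rightarrow> complex^2 \<Rightarrow> complex^2 \<Rightarrow> real" where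
  "metric_in C \<equiv> \<lambda>y. G C (chart_inv C y)"

lemma open_fam_dom: "c \<in> \<A> \<Longrightarrow> C \<in> \<B> \<Longrightarrow> open (fam_dom c C)"
  unfolding fam_dom_def by (rule open_family_domain[OF cont_family])

lemma family_in_charts:
  assumes "c \<in> \<A>" "C \<in> \<B>"
  shows "surface_family (chart_img C) (metric_in C) (fam_dom c C) (fam_rep c C)"
proof -
  interpret hermitian_field "chart_img C" "metric_in C" by (rule hermitian_chart[OF assms(2)])
  show ?thesis
  proof unfold_locales
    show "open (fam_dom c C)" by (rule open_fam_dom[OF assms])
    show "smooth_on (fam_rep c C) (fam_dom c C)"
      unfolding fam_rep_def fam_dom_def by (rule smooth_family[OF assms])
    show "fam_rep c C z \<in> chart_img C" if "z \<in> fam_dom c C" for z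
      using that chart_map_in[OF chart_B[OF assms(2)]] by (auto simp: fam_dom_def fam_rep_def local_rep_def)
  qed
qed

context
  fixes c C t x
  assumes c: "c \<in> \<A>" and C: "C \<in> \<B>" and z: "(t, x) \<in> fam_dom c C"
begin

interpretation sf: surface_family "chart_img C" "metric_in C" "fam_dom c C" "fam_rep c C"
  by (rule family_in_charts[OF c C])

lemma fam_dom_simps:
  "t \<in> {-\<epsilon><..<\<epsilon>}" "x \<in> chart_img c" "chart_inv c x \<in> chart_dom c" "\<Phi> t (chart_inv c x) \<in> chart_dom C"
  "chart_map c (chart_inv c x) = x" "immersion \<A> \<B> (\<Phi> t)"
  using z chart_inv_in[OF chart_A[OF c]] chart_chart_inv[OF chart_A[OF c]] immersion_family
  by (auto simp: fam_dom_def)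

lemma fam_rep_point: "chart_inv C (fam_rep c C (t, x)) = \<Phi> t (chart_inv c x)"
  using fam_dom_simps(4) by (simp add: fam_rep_def local_rep_def chart_inv_chart[OF chart_B[OF C]])

lemma fam_P: "surface_family.P (fam_rep c C) a (t, x) = dmap c C (\<Phi> t) (chart_inv c x) a"
proof -
  have "(local_rep c C (\<Phi> t) has_derivative (\<lambda>a. frechet_derivative (fam_rep c C) (at (t, x)) (0, a))) (at x)"
    using has_derivative_fix_fst[OF smooth_on_has_derivative[OF sf.smooth_phi z]] by (simp add: fam_rep_def)
  from frechet_derivative_eq[OF this] show ?thesis
    unfolding sf.P_def dmap_def fam_dom_simps(5) by simp
qed

lemma fam_E: "surface_family.E (metric_in C) (fam_rep c C) a b (t, x) = induced_metric \<B> G (\<Phi> t) c (chart_inv c x) a b"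
  unfolding sf.E_def fam_P fam_rep_point
  using induced_metric_eq[OF fam_dom_simps(6) c fam_dom_simps(3) C fam_dom_simps(4)] by simp

lemma fam_Gram: "surface_family.Gram (metric_in C) (fam_rep c C) (t, x) = gram (induced_metric \<B> G (\<Phi> t) c (chart_inv c x))"
  unfolding sf.Gram_def fam_E ..

lemma fam_area: "surface_family.area (metric_in C) (fam_rep c C) (t, x) = area_density (induced_metric \<B> G (\<Phi> t)) c (chart_inv c x)"
  unfolding sf.area_def fam_Gram area_density_gram ..

lemma fam_kf: "surface_family.kf (metric_in C) (fam_rep c C) (t, x) = kahler_density (\<Phi> t) c (chart_inv c x)"
  using kahler_density_eq[OF fam_dom_simps(6) c fam_dom_simps(3) C fam_dom_simps(4), of ex ey]
  unfolding sf.kf_def fam_P fam_rep_point kahler_form_def by (simp add: axis_def)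

lemma fam_kcos: "surface_family.kcos (metric_in C) (fam_rep c C) (t, x) = cos (kahler_angle \<A> \<B> G (\<Phi> t) (chart_inv c x))"
  unfolding sf.kcos_def fam_kf fam_area
  using cos_kahler_angle[OF fam_dom_simps(6) c fam_dom_simps(3)] area_density_pos[OF fam_dom_simps(6) c fam_dom_simps(3)]
  by simp

lemma fam_Gram_pos: "0 < surface_family.Gram (metric_in C) (fam_rep c C) (t, x)"
  unfolding fam_Gram by (rule plane_form.gram_pos[OF induced_plane_form[OF fam_dom_simps(6) c fam_dom_simps(3)]])

end

text \<open>The part of the coordinate domain on which the surfaces are symplectic.\<close>

definition fam_pos :: "('s, real^2) chart \<Rightarrow> ('m, complex^2) chart \<Rightarrow> (real \<times> (real^2)) set" where
  "fam_pos c C = {z \<in> fam_dom c C. 0 < cos (kahler_angle \<A> \<B> G (\<Phi> (fst z)) (chart_inv c (snd z)))}"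

lemma kcos_pos_iff:
  assumes "c \<in> \<A>" "C \<in> \<B>" "(t, x) \<in> fam_dom c C"
  shows "0 < surface_family.kf (metric_in C) (fam_rep c C) (t, x) \<longleftrightarrow> 0 < cos (kahler_angle \<A> \<B> G (\<Phi> t) (chart_inv c x))"
  unfolding fam_kf[OF assms] 
  using cos_kahler_angle[OF fam_dom_simps(6)[OF assms] assms(1) fam_dom_simps(3)[OF assms]]
    area_density_pos[OF fam_dom_simps(6)[OF assms] assms(1) fam_dom_simps(3)[OF assms]]
  by (simp add: zero_less_mult_iff)

lemma open_fam_pos:
  assumes "c \<in> \<A>" "C \<in> \<B>"
  shows "open (fam_pos c C)"
proof -
  interpret sf: surface_family "chart_img C" "metric_in C" "fam_dom c C" "fam_rep c C"
    by (rule family_in_charts[OF assms])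
  have "fam_pos c C = fam_dom c C \<inter> sf.kf -` {0<..}"
    unfolding fam_pos_def using kcos_pos_iff[OF assms] by auto
  then show ?thesis
    using continuous_open_preimage[OF smooth_on_continuous[OF sf.smooth_kf] sf.open_W open_greaterThan] by simp
qed

lemma symplectic_in_charts:
  assumes "c \<in> \<A>" "C \<in> \<B>"
  shows "symplectic_family (chart_img C) (metric_in C) (fam_pos c C) (fam_rep c C)"
proof -
  interpret sf: surface_family "chart_img C" "metric_in C" "fam_pos c C" "fam_rep c C"
    by (rule surface_family_subset[OF family_in_charts[OF assms] open_fam_pos[OF assms]]) (auto simp: fam_pos_def)
  show ?thesis
  proof unfold_locales
    fix z assume "z \<in> fam_pos c C"
    then have "(fst z, snd z) \<in> fam_dom c C" "0 < cos (kahler_angle \<A> \<B> G (\<Phi> (fst z)) (chart_inv c (snd z)))"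
      by (auto simp: fam_pos_def)
    then show "0 < sf.Gram z" "0 < sf.kf z"
      using fam_Gram_pos[OF assms] kcos_pos_iff[OF assms] by (metis prod.collapse)+
  qed
qed

text \<open>Functions given near each point by a continuous function of the coordinates of a family are continuous on
  the surface; the coordinate expression may depend on the chart of the ambient surface.\<close>

lemma continuous_in_charts:
  assumes t: "t \<in> {-\<epsilon><..<\<epsilon>}" and c: "c \<in> \<A>" and f: "\<And>C. C \<in> \<B> \<Longrightarrow> continuous_on (fam_dom c C) (h C)"
    and eq: "\<And>C x. C \<in> \<B> \<Longrightarrow> (t, x) \<in> fam_dom c C \<Longrightarrow> h C (t, x) = k (chart_inv c x)"
  shows "continuous_on (chart_dom c) k"
proof (rule continuous_on_local)
  fix p assume p: "p \<in> chart_dom c"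
  note C = chart_at[OF atlas_B, of "\<Phi> t p"]
  let ?C = "chart_at \<B> (\<Phi> t p)"
  note ch = chart_A[OF c]
  let ?T = "chart_dom c \<inter> \<Phi> t -` chart_dom ?C"
  have cont: "continuous_on UNIV (\<Phi> t)" by (rule immersion_continuous[OF immersion_family[OF t]])
  have "open ?T"
    using open_chart_dom[OF ch] open_chart_dom[OF chart_B[OF C(1)]] cont by (auto simp: continuous_on_open_vimage)
  moreover have "continuous_on ?T k"
  proof -
    have m: "(t, chart_map c q) \<in> fam_dom c ?C" if "q \<in> ?T" for q
      using that t chart_map_in[OF ch, of q] chart_inv_chart[OF ch, of q] by (auto simp: fam_dom_def)
    have "continuous_on ?T (\<lambda>q. h ?C (t, chart_map c q))"
      by (rule continuous_on_compose2[OF f[OF C(1)]])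
         (use m in \<open>auto intro!: continuous_intros continuous_on_subset[OF continuous_chart_map[OF ch]]\<close>)
    moreover have "h ?C (t, chart_map c q) = k q" if "q \<in> ?T" for q
      using eq[OF C(1) m[OF that]] that chart_inv_chart[OF ch, of q] by simp
    ultimately show ?thesis by (rule continuous_on_eq)
  qed
  ultimately show "\<exists>T. open T \<and> p \<in> T \<and> continuous_on T k" using p C by blast
qed

lemma continuous_area_density:
  assumes "t \<in> {-\<epsilon><..<\<epsilon>}" "c \<in> \<A>"
  shows "continuous_on (chart_dom c) (area_density (induced_metric \<B> G (\<Phi> t)) c)"
proof (rule continuous_in_charts[OF assms])
  fix C assume C: "C \<in> \<B>"
  interpret sf: surface_family "chart_img C" "metric_in C" "fam_dom c C" "fam_rep c C"
    by (rule family_in_charts[OF assms(2) C])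
  show "continuous_on (fam_dom c C) (surface_family.area (metric_in C) (fam_rep c C))"
    unfolding sf.area_def by (intro continuous_intros smooth_on_continuous sf.smooth_Gram)
qed (rule fam_area[OF assms(2)])

lemma continuous_cos_kahler_angle:
  assumes t: "t \<in> {-\<epsilon><..<\<epsilon>}"
  shows "continuous_on UNIV (\<lambda>p. cos (kahler_angle \<A> \<B> G (\<Phi> t) p))"
proof (rule continuous_on_local)
  fix p :: 's
  note c = chart_at[OF atlas_A, of p]
  have "continuous_on (chart_dom (chart_at \<A> p)) (\<lambda>p. cos (kahler_angle \<A> \<B> G (\<Phi> t) p))"
  proof (rule continuous_in_charts[OF t c(1)])
    fix C assume C: "C \<in> \<B>"
    interpret sf: surface_family "chart_img C" "metric_in C" "fam_dom (chart_at \<A> p) C" "fam_rep (chart_at \<A> p) C"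
      by (rule family_in_charts[OF c(1) C])
    have ca: "continuous_on (fam_dom (chart_at \<A> p) C) sf.area"
      unfolding sf.area_def by (intro continuous_on_real_sqrt smooth_on_continuous sf.smooth_Gram)
    have "sf.area z \<noteq> 0" if "z \<in> fam_dom (chart_at \<A> p) C" for z
      using fam_Gram_pos[OF c(1) C, of "fst z" "snd z"] that by (simp add: sf.area_def)
    then show "continuous_on (fam_dom (chart_at \<A> p) C) (surface_family.kcos (metric_in C) (fam_rep (chart_at \<A> p) C))"
      unfolding sf.kcos_def
      by (intro continuous_on_divide smooth_on_continuous[OF sf.smooth_kf] ca) auto
  qed (rule fam_kcos[OF c(1)])
  then show "\<exists>T. open T \<and> p \<in> T \<and> continuous_on T (\<lambda>p. cos (kahler_angle \<A> \<B> G (\<Phi> t) p))"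
    using c open_chart_dom[OF chart_A[OF c(1)]] by blast
qed

end

context surface_in_hermite
begin

lemma constant_family:
  assumes F: "immersion \<A> \<B> F"
  shows "immersed_family \<A> \<B> G (\<lambda>_. F) 1"
proof unfold_locales
  show "continuous_on ({-1<..<1::real} \<times> UNIV) (\<lambda>(t, p). F p)"
    unfolding split_beta by (rule continuous_on_compose2[OF immersion_continuous[OF F]]) (auto intro: continuous_intros)
  fix c C assume c: "c \<in> \<A>" "C \<in> \<B>"
  let ?S = "{(t, x). t \<in> {-1<..<1::real} \<and> x \<in> chart_img c \<and> F (chart_inv c x) \<in> chart_dom C}"
  have S: "?S = {-1<..<1} \<times> rep_dom c C F" by (auto simp: rep_dom_eq[OF chart_A[OF c(1)]])
  show "smooth_on (\<lambda>(t, x). local_rep c C F x) ?S"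
    unfolding S split_beta
    by (rule smooth_on_compose[OF _ immersion_rep_open[OF F c] _ immersion_smooth[OF F c] smooth_on_snd])
       (auto intro: open_Times immersion_rep_open[OF F c])
qed (use F in auto)

lemma area_chart_density:
  assumes F: "immersion \<A> \<B> F"
  shows "chart_density \<A> (area_density (induced_metric \<B> G F))"
proof
  interpret immersed_family \<A> \<B> G "\<lambda>_. F" 1 by (rule constant_family[OF F])
  show "continuous_on (chart_dom c) (area_density (induced_metric \<B> G F) c)" if "c \<in> \<A>" for c
    by (rule continuous_area_density[of 0]) (use that in auto)
  show "area_density (induced_metric \<B> G F) d p = det (matrix (dtrans d c p)) * area_density (induced_metric \<B> G F) c p"
    if "c \<in> \<A>" "d \<in> \<A>" "p \<in> chart_dom c" "p \<in> chart_dom d" for c d p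
    by (rule area_density_change[OF F that])
qed (use atlas_A compact_surface area_density_pos[OF F] in auto)

end

context surface_in_hermite
begin

abbreviation adens :: "('s \<Rightarrow> 'm) \<Rightarrow> ('s, real^2) chart \<Rightarrow> 's \<Rightarrow> real" where
  "adens F \<equiv> area_density (induced_metric \<B> G F)"

abbreviation kcosine :: "('s \<Rightarrow> 'm) \<Rightarrow> 's \<Rightarrow> real" where
  "kcosine F p \<equiv> cos (kahler_angle \<A> \<B> G F p)"

lemma area_measure_is_area_measure:
  assumes "immersion \<A> \<B> F"
  shows "chart_density.is_area_measure \<A> (adens F) (area_measure \<A> (induced_metric \<B> G F))"
    and "chart_density.is_area_measure \<A> (adens F) \<nu> \<Longrightarrow> \<nu> = area_measure \<A> (induced_metric \<B> G F)"
proof -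
  interpret chart_density \<A> "adens F" by (rule area_chart_density[OF assms])
  have eq: "area_measure \<A> (induced_metric \<B> G F) = (THE \<mu>. is_area_measure \<mu>)"
    unfolding area_measure_def is_area_measure_def chart_mass_def ..
  show "is_area_measure (area_measure \<A> (induced_metric \<B> G F))"
    unfolding eq by (rule theI'[OF area_measure_ex1])
  then show "\<nu> = area_measure \<A> (induced_metric \<B> G F)" if "is_area_measure \<nu>"
    using that area_measure_ex1 by blast
qed

end

locale symplectic_variation = immersed_family \<A> \<B> G \<Phi> \<epsilon>
  for \<A> :: "('s::{t2_space, second_countable_topology}, real^2) chart set"
    and \<B> :: "('m::{t2_space, second_countable_topology}, complex^2) chart set"
    and G :: "('m, complex^2) metric_tensor"
    and \<Phi> :: "real \<Rightarrow> 's \<Rightarrow> 'm" and \<epsilon> :: real +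
  fixes \<beta> :: real
  assumes pos0: "0 < kcosine (\<Phi> 0) p"
begin

lemma zero_time: "0 \<in> {-\<epsilon><..<\<epsilon>}" using eps by simp

lemma imm0: "immersion \<A> \<B> (\<Phi> 0)" by (rule immersion_family[OF zero_time])

sublocale area0: chart_density \<A> "adens (\<Phi> 0)" by (rule area_chart_density[OF imm0])

abbreviation mu0 :: "'s measure" where "mu0 \<equiv> area_measure \<A> (induced_metric \<B> G (\<Phi> 0))"

lemmas mu0 = area_measure_is_area_measure(1)[OF imm0]

text \<open>Since the area elements of the family are multiples of the one at time \<open>0\<close>, the functional is
  an integral over a fixed finite measure space.\<close>

definition ratio :: "real \<Rightarrow> 's \<Rightarrow> real" where
  "ratio t p = adens (\<Phi> t) (chart_at \<A> p) p / adens (\<Phi> 0) (chart_at \<A> p) p"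

definition psi :: "real \<Rightarrow> 's \<Rightarrow> real" where
  "psi t p = ratio t p * (1 / kcosine (\<Phi> t) p powr \<beta>)"

lemma ratio_eq:
  assumes "t \<in> {-\<epsilon><..<\<epsilon>}" "c \<in> \<A>" "p \<in> chart_dom c"
  shows "ratio t p = adens (\<Phi> t) c p / adens (\<Phi> 0) c p"
proof -
  note ca = chart_at[OF atlas_A, of p]
  show ?thesis
    unfolding ratio_def area_density_change[OF immersion_family[OF assms(1)] assms(2) ca(1) assms(3) ca(2)]
      area_density_change[OF imm0 assms(2) ca(1) assms(3) ca(2)]
    using dtrans_A_det[OF ca(1) assms(2) ca(2) assms(3)] by simp
qed

lemma ratio_pos: "t \<in> {-\<epsilon><..<\<epsilon>} \<Longrightarrow> 0 < ratio t p"
  unfolding ratio_def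
  using area_density_pos[OF immersion_family chart_at[OF atlas_A]] area_density_pos[OF imm0 chart_at[OF atlas_A]] by simp

lemma continuous_ratio:
  assumes "t \<in> {-\<epsilon><..<\<epsilon>}"
  shows "continuous_on UNIV (ratio t)"
proof (rule continuous_on_local)
  fix p :: 's
  note ca = chart_at[OF atlas_A, of p]
  let ?c = "chart_at \<A> p"
  have "adens (\<Phi> 0) ?c q \<noteq> 0" if "q \<in> chart_dom ?c" for q
    using area_density_pos[OF imm0 ca(1) that] by simp
  then have "continuous_on (chart_dom ?c) (\<lambda>q. adens (\<Phi> t) ?c q / adens (\<Phi> 0) ?c q)"
    by (intro continuous_on_divide continuous_area_density assms zero_time ca) auto
  then have "continuous_on (chart_dom ?c) (ratio t)"
    by (rule continuous_on_eq) (simp add: ratio_eq[OF assms ca(1)])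
  then show "\<exists>T. open T \<and> p \<in> T \<and> continuous_on T (ratio t)"
    using ca open_chart_dom[OF chart_A[OF ca(1)]] by blast
qed

lemma continuous_psi:
  assumes "t \<in> {-\<epsilon><..<\<epsilon>}" "\<And>p. 0 < kcosine (\<Phi> t) p"
  shows "continuous_on UNIV (psi t)"
  unfolding psi_def using assms(2)
  by (intro continuous_intros continuous_ratio continuous_cos_kahler_angle assms(1)) (auto simp: less_imp_neq[symmetric])

text \<open>The multiple satisfies the conditions that characterize the area measure of the deformed surface.\<close>

lemma area_measure_density:
  assumes t: "t \<in> {-\<epsilon><..<\<epsilon>}"
  shows "area_measure \<A> (induced_metric \<B> G (\<Phi> t)) = density mu0 (\<lambda>p. ennreal (ratio t p))"
proof -
  interpret areat: chart_density \<A> "adens (\<Phi> t)" by (rule area_chart_density[OF immersion_family[OF t]])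
  have rm: "(\<lambda>p. ennreal (ratio t p)) \<in> borel_measurable borel"
    using borel_measurable_continuous_onI[OF continuous_ratio[OF t]] by measurable
  have "areat.is_area_measure (density mu0 (\<lambda>p. ennreal (ratio t p)))"
    unfolding areat.is_area_measure_def
  proof (intro conjI ballI impI)
    show "sets (density mu0 (\<lambda>p. ennreal (ratio t p))) = sets borel"
      using area0.area_sets[OF mu0] by simp
    fix c S assume c: "c \<in> \<A>" and S: "S \<in> sets borel" "S \<subseteq> chart_dom c"
    note ch = chart_A[OF c]
    have "emeasure (density mu0 (\<lambda>p. ennreal (ratio t p))) S = (\<integral>\<^sup>+p. ennreal (ratio t p) * indicator S p \<partial>mu0)"
      using S rm by (subst emeasure_density) (auto simp: area0.area_measurable[OF mu0] area0.area_sets[OF mu0])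
    also have "\<dots> = (\<integral>\<^sup>+p. indicator (chart_dom c) p * (ennreal (ratio t p) * indicator S p) \<partial>mu0)"
      using S(2) by (intro nn_integral_cong) (auto simp: indicator_def)
    also have "\<dots> = (\<integral>\<^sup>+x. ennreal (adens (\<Phi> 0) c (chart_inv c x)) * indicator (chart_img c) x
        * (ennreal (ratio t (chart_inv c x)) * indicator S (chart_inv c x)) \<partial>lborel)"
      using S rm by (intro area0.nn_integral_area_chart[OF mu0 c]) auto
    also have "\<dots> = areat.chart_mass c S"
      unfolding areat.chart_mass_def
    proof (rule nn_integral_cong)
      fix x
      show "ennreal (adens (\<Phi> 0) c (chart_inv c x)) * indicator (chart_img c) x
          * (ennreal (ratio t (chart_inv c x)) * indicator S (chart_inv c x))
        = ennreal (adens (\<Phi> t) c (chart_inv c x)) * indicator (chart_map c ` S) x"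
      proof (cases "x \<in> chart_img c")
        case True
        have p: "chart_inv c x \<in> chart_dom c" by (rule chart_inv_in[OF ch True])
        have "x \<in> chart_map c ` S \<longleftrightarrow> chart_inv c x \<in> S"
          unfolding chart_map_image_eq[OF ch S(2)] using True by simp
        moreover have "ennreal (adens (\<Phi> 0) c (chart_inv c x)) * ennreal (ratio t (chart_inv c x))
            = ennreal (adens (\<Phi> t) c (chart_inv c x))"
          using area_density_pos[OF imm0 c p] ratio_pos[OF t, of "chart_inv c x"]
          by (simp add: ennreal_mult[symmetric] ratio_eq[OF t c p])
        ultimately show ?thesis using True by (simp add: indicator_def)
      next
        case False
        then have "x \<notin> chart_map c ` S" using chart_map_in[OF ch] S(2) by blast
        then show ?thesis using False by simp
      qed
    qed
    finally show "emeasure (density mu0 (\<lambda>p. ennreal (ratio t p))) S = areat.chart_mass c S" .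
  qed
  then show ?thesis using area_measure_is_area_measure(2)[OF immersion_family[OF t]] by metis
qed

lemma L_functional_psi:
  assumes "t \<in> {-\<epsilon><..<\<epsilon>}" "\<And>p. 0 < kcosine (\<Phi> t) p"
  shows "L_functional \<A> \<B> G \<beta> (\<Phi> t) = (\<integral>p. psi t p \<partial>mu0)"
proof -
  have m: "(\<lambda>p. 1 / kcosine (\<Phi> t) p powr \<beta>) \<in> borel_measurable mu0"
    unfolding area0.area_measurable[OF mu0] using assms(2)
    by (intro borel_measurable_continuous_onI continuous_intros continuous_cos_kahler_angle assms(1))
       (auto simp: less_imp_neq[symmetric])
  have "ratio t \<in> borel_measurable mu0"
    unfolding area0.area_measurable[OF mu0] by (rule borel_measurable_continuous_onI[OF continuous_ratio[OF assms(1)]])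
  then show ?thesis
    unfolding L_functional_def area_measure_density[OF assms(1)] psi_def
    using ratio_pos[OF assms(1)] by (subst integral_density[OF m]) (auto intro: less_imp_le)
qed

abbreviation fam_ell :: "('s, real^2) chart \<Rightarrow> ('m, complex^2) chart \<Rightarrow> real \<times> (real^2) \<Rightarrow> real" where
  "fam_ell c C \<equiv> symplectic_family.ell (metric_in C) (fam_rep c C) \<beta>"

lemma psi_eq_ell:
  assumes "c \<in> \<A>" "C \<in> \<B>" "(t, x) \<in> fam_pos c C"
  shows "psi t (chart_inv c x) = fam_ell c C (t, x) / adens (\<Phi> 0) c (chart_inv c x)"
proof -
  interpret sf: symplectic_family "chart_img C" "metric_in C" "fam_pos c C" "fam_rep c C" \<beta>
    by (rule symplectic_in_charts[OF assms(1,2)])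
  have z: "(t, x) \<in> fam_dom c C" using assms(3) by (simp add: fam_pos_def)
  note fd = fam_dom_simps[OF assms(1,2) z]
  show ?thesis
    unfolding psi_def ratio_eq[OF fd(1) assms(1) fd(3)] sf.ell_eq[OF assms(3)]
      fam_area[OF assms(1,2) z] fam_kcos[OF assms(1,2) z] by simp
qed

lemma psi_has_derivative:
  assumes "c \<in> \<A>" "C \<in> \<B>" "(t, x) \<in> fam_pos c C"
  shows "((\<lambda>s. psi s (chart_inv c x)) has_real_derivative
    frechet_derivative (fam_ell c C) (at (t, x)) (1, 0) / adens (\<Phi> 0) c (chart_inv c x)) (at t)"
proof -
  interpret sf: symplectic_family "chart_img C" "metric_in C" "fam_pos c C" "fam_rep c C" \<beta>
    by (rule symplectic_in_charts[OF assms(1,2)])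
  let ?D = "frechet_derivative (fam_ell c C) (at (t, x))"
  have "((\<lambda>s. fam_ell c C (s, x)) has_derivative (\<lambda>h. ?D (h, 0))) (at t)"
    by (rule has_derivative_fix_snd[OF smooth_on_has_derivative[OF sf.smooth_ell assms(3)]])
  also have "(\<lambda>h. ?D (h, 0)) = (*) (?D (1, 0))"
  proof (rule ext)
    show "?D (h, 0) = ?D (1, 0) * h" for h
      using linear_scale[OF smooth_on_linear_derivative[OF sf.smooth_ell assms(3)], of h "(1, 0)"] by simp
  qed
  finally have "((\<lambda>s. fam_ell c C (s, x)) has_real_derivative ?D (1, 0)) (at t)"
    unfolding has_field_derivative_def .
  then have d: "((\<lambda>s. fam_ell c C (s, x) / adens (\<Phi> 0) c (chart_inv c x)) has_real_derivative
      ?D (1, 0) / adens (\<Phi> 0) c (chart_inv c x)) (at t)"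
    by (rule DERIV_cdivide)
  show ?thesis
    by (rule has_field_derivative_transform_within_open[OF d open_fix_snd[OF open_fam_pos[OF assms(1,2)]]])
       (use assms(3) psi_eq_ell[OF assms(1,2)] in auto)
qed

abbreviation dpsi :: "real \<Rightarrow> 's \<Rightarrow> real" where
  "dpsi t p \<equiv> deriv (\<lambda>s. psi s p) t"

lemma dpsi_eq:
  assumes "c \<in> \<A>" "C \<in> \<B>" "(t, x) \<in> fam_pos c C"
  shows "dpsi t (chart_inv c x) = frechet_derivative (fam_ell c C) (at (t, x)) (1, 0) / adens (\<Phi> 0) c (chart_inv c x)"
  by (rule DERIV_imp_deriv[OF psi_has_derivative[OF assms]])

lemma in_fam_pos0:
  assumes "c \<in> \<A>" "C \<in> \<B>" "p \<in> chart_dom c" "\<Phi> 0 p \<in> chart_dom C"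
  shows "(0, chart_map c p) \<in> fam_pos c C"
  using assms zero_time pos0 chart_map_in[OF chart_A[OF assms(1)]] chart_inv_chart[OF chart_A[OF assms(1)]]
  by (simp add: fam_pos_def fam_dom_def)

lemma continuous_dpsi_chart:
  assumes "c \<in> \<A>" "C \<in> \<B>"
  shows "continuous_on (fam_pos c C) (\<lambda>(t, x). dpsi t (chart_inv c x))"
proof -
  interpret sf: symplectic_family "chart_img C" "metric_in C" "fam_pos c C" "fam_rep c C" \<beta>
    by (rule symplectic_in_charts[OF assms])
  have img: "snd z \<in> chart_img c" if "z \<in> fam_pos c C" for z using that by (auto simp: fam_pos_def fam_dom_def)
  have "continuous_on (fam_pos c C) (\<lambda>z. adens (\<Phi> 0) c (chart_inv c (snd z)))"
    by (rule continuous_on_compose2[OF area0.continuous_density[OF assms(1)]]) (use img in \<open>auto intro!: continuous_intros\<close>)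
  moreover have "adens (\<Phi> 0) c (chart_inv c (snd z)) \<noteq> 0" if "z \<in> fam_pos c C" for z
    using area_density_pos[OF imm0 assms(1) chart_inv_in[OF chart_A[OF assms(1)] img[OF that]]] by simp
  ultimately have "continuous_on (fam_pos c C)
      (\<lambda>z. frechet_derivative (fam_ell c C) (at z) (1, 0) / adens (\<Phi> 0) c (chart_inv c (snd z)))"
    by (intro continuous_on_divide smooth_on_continuous[OF smooth_on_derivative[OF sf.smooth_ell]]) auto
  then show ?thesis
    by (rule continuous_on_eq) (use dpsi_eq[OF assms] in auto)
qed

text \<open>Near \<open>(0, p)\<close> the family lies in one pair of charts, where everything is smooth and bounded on a small closed
  ball in space and time.\<close>

lemma locally_uniform:
  "\<exists>U \<delta> K. open U \<and> p \<in> U \<and> 0 < \<delta> \<and> (\<forall>q\<in>U. \<forall>t. \<bar>t\<bar> < \<delta> \<longrightarrow> t \<in> {-\<epsilon><..<\<epsilon>} \<and> 0 < kcosine (\<Phi> t) q \<and>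
     ((\<lambda>s. psi s q) has_real_derivative dpsi t q) (at t) \<and> \<bar>dpsi t q\<bar> \<le> K)"
proof -
  note c = chart_at[OF atlas_A, of p] and C = chart_at[OF atlas_B, of "\<Phi> 0 p"]
  let ?c = "chart_at \<A> p" and ?C = "chart_at \<B> (\<Phi> 0 p)"
  note ch = chart_A[OF c(1)]
  let ?z = "(0::real, chart_map ?c p)"
  obtain r where r: "0 < r" "cball ?z r \<subseteq> fam_pos ?c ?C"
    using open_contains_cball open_fam_pos[OF c(1) C(1)] in_fam_pos0[OF c(1) C(1) c(2) C(2)] by metis
  have "compact ((\<lambda>(t, x). dpsi t (chart_inv ?c x)) ` cball ?z r)"
    by (intro compact_continuous_image continuous_on_subset[OF continuous_dpsi_chart[OF c(1) C(1)] r(2)]) simp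
  then obtain K where K: "\<And>y. y \<in> (\<lambda>(t, x). dpsi t (chart_inv ?c x)) ` cball ?z r \<Longrightarrow> \<bar>y\<bar> \<le> K"
    using compact_imp_bounded bounded_real by metis
  define U where "U = {q \<in> chart_dom ?c. chart_map ?c q \<in> ball (chart_map ?c p) (r/2)}"
  have "open U" "p \<in> U"
    using continuous_open_preimage[OF continuous_chart_map[OF ch] open_chart_dom[OF ch] open_ball, of "chart_map ?c p" "r/2"] r c
    by (auto simp: U_def vimage_def Int_def conj_commute)
  moreover have "t \<in> {-\<epsilon><..<\<epsilon>} \<and> 0 < kcosine (\<Phi> t) q \<and>
     ((\<lambda>s. psi s q) has_real_derivative dpsi t q) (at t) \<and> \<bar>dpsi t q\<bar> \<le> K"
    if q: "q \<in> U" and t: "\<bar>t\<bar> < r/2" for q t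
  proof -
    have inv: "chart_inv ?c (chart_map ?c q) = q" using q by (simp add: U_def chart_inv_chart[OF ch])
    have "dist (t, chart_map ?c q) ?z \<le> \<bar>t\<bar> + dist (chart_map ?c q) (chart_map ?c p)"
      using sqrt_sum_squares_le_sum_abs[of t "dist (chart_map ?c q) (chart_map ?c p)"] by (simp add: dist_Pair_Pair)
    also have "\<dots> \<le> r" using t q by (simp add: U_def dist_commute)
    finally have z: "(t, chart_map ?c q) \<in> cball ?z r" by (simp add: dist_commute)
    then have zp: "(t, chart_map ?c q) \<in> fam_pos ?c ?C" using r by blast
    have "\<bar>dpsi t q\<bar> \<le> K" using K[OF imageI[OF z]] inv by simp
    moreover have "((\<lambda>s. psi s q) has_real_derivative dpsi t q) (at t)"
      using psi_has_derivative[OF c(1) C(1) zp] dpsi_eq[OF c(1) C(1) zp] inv by simp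
    ultimately show ?thesis using zp inv by (simp add: fam_pos_def fam_dom_def)
  qed
  ultimately show ?thesis using r(1) by (intro exI[of _ U] exI[of _ "r/2"] exI[of _ K]) simp
qed

lemma uniform:
  "\<exists>\<delta> K. 0 < \<delta> \<and> (\<forall>q t. \<bar>t\<bar> < \<delta> \<longrightarrow> t \<in> {-\<epsilon><..<\<epsilon>} \<and> 0 < kcosine (\<Phi> t) q \<and>
     ((\<lambda>s. psi s q) has_real_derivative dpsi t q) (at t) \<and> \<bar>dpsi t q\<bar> \<le> K)"
proof -
  define good where "good q t K \<longleftrightarrow> t \<in> {-\<epsilon><..<\<epsilon>} \<and> 0 < kcosine (\<Phi> t) q \<and>
     ((\<lambda>s. psi s q) has_real_derivative dpsi t q) (at t) \<and> \<bar>dpsi t q\<bar> \<le> K" for q t K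
  have mono: "good q t K'" if "good q t K" "K \<le> K'" for q t K K'
    using that order_trans[OF _ that(2)] unfolding good_def by simp
  have "\<exists>U \<delta> K. open U \<and> p \<in> U \<and> 0 < \<delta> \<and> (\<forall>q\<in>U. \<forall>t. \<bar>t\<bar> < \<delta> \<longrightarrow> good q t K)" for p
    unfolding good_def by (rule locally_uniform)
  then obtain U \<delta> K where U: "\<And>p. open (U p)" "\<And>p. p \<in> U p" "\<And>p. 0 < \<delta> p"
    and P: "\<And>p q t. q \<in> U p \<Longrightarrow> \<bar>t\<bar> < \<delta> p \<Longrightarrow> good q t (K p)"
    by metis
  have cover: "UNIV \<subseteq> (\<Union>p\<in>UNIV. U p)" using U(2) by auto
  obtain I where I: "finite I" "UNIV \<subseteq> (\<Union>p\<in>I. U p)"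
    by (rule compactE_image[OF compact_surface U(1) cover])
  then have ne: "I \<noteq> {}" by auto
  have "0 < Min (\<delta> ` I)" using I ne U(3) by simp
  moreover have "good q t (Max (K ` I))" if t: "\<bar>t\<bar> < Min (\<delta> ` I)" for q t
  proof -
    obtain p where p: "p \<in> I" "q \<in> U p" using I(2) by blast
    have "\<bar>t\<bar> < \<delta> p" using t p(1) I(1) by (simp add: ne)
    from mono[OF P[OF p(2) this]] show ?thesis using p(1) I(1) by simp
  qed
  ultimately have "\<exists>\<delta> K. 0 < \<delta> \<and> (\<forall>q t. \<bar>t\<bar> < \<delta> \<longrightarrow> good q t K)" by blast
  then show ?thesis unfolding good_def .
qed

lemma L_functional_derivative:
  "((\<lambda>t. L_functional \<A> \<B> G \<beta> (\<Phi> t)) has_real_derivative (\<integral>p. dpsi 0 p \<partial>mu0)) (at 0)"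
proof -
  obtain \<delta> K where \<delta>: "0 < \<delta>" and P: "\<And>q t. \<bar>t\<bar> < \<delta> \<Longrightarrow> t \<in> {-\<epsilon><..<\<epsilon>} \<and> 0 < kcosine (\<Phi> t) q \<and>
     ((\<lambda>s. psi s q) has_real_derivative dpsi t q) (at t) \<and> \<bar>dpsi t q\<bar> \<le> K"
    using uniform by blast
  interpret fm: finite_measure mu0 by (rule area0.finite_area[OF mu0])
  have "((\<lambda>t. \<integral>p. psi t p \<partial>mu0) has_real_derivative (\<integral>p. dpsi 0 p \<partial>mu0)) (at 0)"
    by (rule has_real_derivative_integral[OF \<delta>, where w = "\<lambda>_. K"])
       (use P area0.integrable_continuous_area[OF mu0 continuous_psi] in auto)
  then show ?thesis
  proof (rule has_field_derivative_transform_within_open[of _ _ _ "{-\<delta><..<\<delta>}"])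
    fix t assume "t \<in> {-\<delta><..<\<delta>}"
    then have "\<bar>t\<bar> < \<delta>" by auto
    then show "(\<integral>p. psi t p \<partial>mu0) = L_functional \<A> \<B> G \<beta> (\<Phi> t)"
      using P[of t] by (intro L_functional_psi[symmetric]) auto
  qed (use \<delta> in auto)
qed

lemma continuous_dpsi0: "continuous_on UNIV (dpsi 0)"
proof (rule continuous_on_local)
  fix p :: 's
  note c = chart_at[OF atlas_A, of p] and C = chart_at[OF atlas_B, of "\<Phi> 0 p"]
  let ?c = "chart_at \<A> p" and ?C = "chart_at \<B> (\<Phi> 0 p)"
  note ch = chart_A[OF c(1)]
  let ?T = "chart_dom ?c \<inter> \<Phi> 0 -` chart_dom ?C"
  have "open ?T"
    using open_chart_dom[OF ch] open_chart_dom[OF chart_B[OF C(1)]] immersion_continuous[OF imm0]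
    by (auto simp: continuous_on_open_vimage)
  moreover have "continuous_on ?T (\<lambda>q. (\<lambda>(t, x). dpsi t (chart_inv ?c x)) (0, chart_map ?c q))"
    by (rule continuous_on_compose2[OF continuous_dpsi_chart[OF c(1) C(1)]])
       (use in_fam_pos0[OF c(1) C(1)] in \<open>auto intro!: continuous_intros continuous_on_subset[OF continuous_chart_map[OF ch]]\<close>)
  then have "continuous_on ?T (dpsi 0)"
    by (rule continuous_on_eq) (simp add: chart_inv_chart[OF ch])
  ultimately show "\<exists>T. open T \<and> p \<in> T \<and> continuous_on T (dpsi 0)" using c C by blast
qed

end

section \<open>Partitions of unity and Stokes' theorem\<close>

lemma extend_by_zero_smooth:
  fixes q :: "'a::euclidean_space \<Rightarrow> 'b::real_normed_vector"
  assumes "open V" "compact K" "K \<subseteq> V" "smooth_on q V" "\<And>x. x \<in> V \<Longrightarrow> x \<notin> K \<Longrightarrow> q x = 0"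
  shows "smooth_on (\<lambda>x. if x \<in> V then q x else 0) UNIV"
proof (rule smooth_on_local)
  fix x :: 'a
  show "\<exists>T. open T \<and> x \<in> T \<and> smooth_on (\<lambda>x. if x \<in> V then q x else 0) T"
  proof (cases "x \<in> V")
    case True
    have "smooth_on (\<lambda>x. if x \<in> V then q x else 0) V"
      by (rule smooth_on_eq[OF assms(4,1)]) simp
    then show ?thesis using True assms(1) by blast
  next
    case False
    have o: "open (- K)" using compact_imp_closed[OF assms(2)] by (simp add: open_Compl)
    have "smooth_on (\<lambda>x. if x \<in> V then q x else 0) (- K)"
      by (rule smooth_on_eq[OF smooth_on_const[of 0] o]) (use assms(5) in auto)
    then show ?thesis using False assms(3) o by blast
  qed
qed

text \<open>The integral of a directional derivative vanishes because it is the derivative of the integral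
  along translations, which do not change it.\<close>

lemma integral_derivative_zero:
  fixes H :: "real^2 \<Rightarrow> real"
  assumes H: "smooth_on H UNIV" and K: "compact K" "\<And>x. x \<notin> K \<Longrightarrow> H x = 0"
  shows "(\<integral>x. frechet_derivative H (at x) e \<partial>lborel) = 0"
    and "integrable lborel (\<lambda>x. frechet_derivative H (at x) e)"
proof -
  let ?D = "\<lambda>x. frechet_derivative H (at x) e"
  obtain R where R: "K \<subseteq> cball 0 R" using bounded_subset_ballD[OF compact_imp_bounded[OF K(1)]] ball_subset_cball by blast
  have H0: "H x = 0" if "norm x > R" for x using K(2)[of x] subsetD[OF R, of x] that by auto
  have o: "open (- cball 0 R :: (real^2) set)" by (simp add: open_Compl)
  have D0: "?D x = 0" if "norm x > R" for x
    using frechet_derivative_cong_open[OF o, of x H "\<lambda>_. 0"] that H0 by simp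
  have cH: "continuous_on UNIV H" by (rule smooth_on_continuous[OF H])
  have cD: "continuous_on UNIV ?D" by (rule smooth_on_continuous[OF smooth_on_derivative[OF H]])
  have bounded: "\<exists>M\<ge>0. \<forall>x. \<bar>k x\<bar> \<le> M" if c: "continuous_on UNIV k" and 0: "\<And>x. norm x > R \<Longrightarrow> k x = 0"
    for k :: "real^2 \<Rightarrow> real"
  proof -
    have "compact (k ` cball 0 R)" by (intro compact_continuous_image continuous_on_subset[OF c]) auto
    then obtain M where M: "\<And>x. norm x \<le> R \<Longrightarrow> \<bar>k x\<bar> \<le> M"
      using compact_imp_bounded bounded_real by (metis imageI mem_cball_0)
    have "\<bar>k x\<bar> \<le> max M 0" for x using M[of x] 0[of x] by (cases "norm x \<le> R") auto
    then show ?thesis by (intro exI[of _ "max M 0"]) simp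
  qed
  obtain MH where MH: "0 \<le> MH" "\<And>x. \<bar>H x\<bar> \<le> MH" using bounded[OF cH H0] by blast
  obtain MD where MD: "0 \<le> MD" "\<And>x. \<bar>?D x\<bar> \<le> MD" using bounded[OF cD D0] by blast
  let ?b = "cball 0 (R + norm e) :: (real^2) set"
  have ind: "integrable lborel (\<lambda>x. M * indicator ?b x)" for M :: real
    using emeasure_lborel_cball_finite[of "0 :: real^2" "R + norm e"]
    by (intro integrable_mult_right integrable_real_indicator) auto
  have far: "norm (x + t *\<^sub>R e) > R" if "x \<notin> ?b" "\<bar>t\<bar> < 1" for x t
  proof -
    have "norm x \<le> norm (x + t *\<^sub>R e) + norm (t *\<^sub>R e)"
      using norm_triangle_ineq4[of "x + t *\<^sub>R e" "t *\<^sub>R e"] by simp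
    moreover have "norm (t *\<^sub>R e) \<le> norm e" using that(2) mult_left_le_one_le[of "norm e" "\<bar>t\<bar>"] by simp
    ultimately show ?thesis using that(1) by auto
  qed
  have "((\<lambda>t. \<integral>x. H (x + t *\<^sub>R e) \<partial>lborel) has_real_derivative (\<integral>x. ?D (x + 0 *\<^sub>R e) \<partial>lborel)) (at 0)"
  proof (rule has_real_derivative_integral[where \<delta> = 1 and w = "\<lambda>x. MD * indicator ?b x"])
    show "integrable lborel (\<lambda>x. H (x + t *\<^sub>R e))" if "\<bar>t\<bar> < 1" for t
    proof (rule Bochner_Integration.integrable_bound[OF ind[of MH]])
      have "continuous_on UNIV (\<lambda>x. H (x + t *\<^sub>R e))"
        by (rule continuous_on_compose2[OF cH]) (auto intro!: continuous_intros)
      then show "(\<lambda>x. H (x + t *\<^sub>R e)) \<in> borel_measurable lborel" by (simp add: borel_measurable_continuous_onI)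
      show "AE x in lborel. norm (H (x + t *\<^sub>R e)) \<le> norm (MH * indicator ?b x)"
        using MH H0 far that by (auto simp: indicator_def)
    qed
    show "((\<lambda>s. H (x + s *\<^sub>R e)) has_real_derivative ?D (x + t *\<^sub>R e)) (at t)" for x t
      by (rule has_real_derivative_along_line[OF H]) simp
    show "\<bar>?D (x + t *\<^sub>R e)\<bar> \<le> MD * indicator ?b x" if "\<bar>t\<bar> < 1" for t x
      using MD D0 far that by (auto simp: indicator_def)
  qed (use ind in auto)
  moreover have "(\<integral>x. H (x + t *\<^sub>R e) \<partial>lborel) = (\<integral>x. H x \<partial>lborel)" for t
  proof -
    have "(\<integral>x. H x \<partial>lborel) = (\<integral>x. H x \<partial>distr lborel borel ((+) (t *\<^sub>R e)))" by (simp add: lborel_distr_plus)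
    also have "\<dots> = (\<integral>x. H (t *\<^sub>R e + x) \<partial>lborel)"
      by (rule integral_distr) (use borel_measurable_continuous_onI[OF cH] in auto)
    finally show ?thesis by (simp add: add.commute)
  qed
  ultimately have "((\<lambda>t. \<integral>x. H x \<partial>lborel) has_real_derivative (\<integral>x. ?D x \<partial>lborel)) (at 0)" by simp
  from DERIV_unique[OF this DERIV_const] show "(\<integral>x. ?D x \<partial>lborel) = 0" .
  show "integrable lborel ?D"
  proof (rule Bochner_Integration.integrable_bound[OF ind[of MD]])
    show "?D \<in> borel_measurable lborel" using borel_measurable_continuous_onI[OF cD] by simp
    have "norm (?D x) \<le> norm (MD * indicator ?b x)" for x
      using MD D0[of x] far[of x 0] by (auto simp: indicator_def)
    then show "AE x in lborel. norm (?D x) \<le> norm (MD * indicator ?b x)" by simp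
  qed
qed

lemma frechet_derivative_mult:
  fixes f h :: "'a::real_normed_vector \<Rightarrow> real"
  assumes "smooth_on f S" "smooth_on h S" "x \<in> S"
  shows "frechet_derivative (\<lambda>x. f x * h x) (at x) v
    = f x * frechet_derivative h (at x) v + frechet_derivative f (at x) v * h x"
  by (rule frechet_derivative_eq[OF has_derivative_mult[OF smooth_on_has_derivative[OF assms(1,3)] smooth_on_has_derivative[OF assms(2,3)]]])

lemma differential_change_of_chart:
  assumes "smooth_atlas \<A>" "c \<in> \<A>" "d \<in> \<A>" "smooth_on (\<lambda>y. k (chart_inv d y)) (chart_img d)"
    and "p \<in> chart_dom c" "p \<in> chart_dom d"
  shows "frechet_derivative (\<lambda>x. k (chart_inv c x)) (at (chart_map c p)) u
    = frechet_derivative (\<lambda>y. k (chart_inv d y)) (at (chart_map d p)) (dtrans c d p u)"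
proof -
  note chc = atlas_is_chart[OF assms(1,2)] and chd = atlas_is_chart[OF assms(1,3)]
  have "((\<lambda>y. k (chart_inv d y)) has_derivative frechet_derivative (\<lambda>y. k (chart_inv d y)) (at (chart_map d p)))
      (at (transition c d (chart_map c p)))"
    using smooth_on_has_derivative[OF assms(4) chart_map_in[OF chd assms(6)]] by (simp add: transition_apply[OF chc assms(5)])
  from diff_chain_at[OF dtrans_has_derivative[OF assms(1,2,3,5,6)] this]
  have "((\<lambda>y. k (chart_inv d y)) \<circ> transition c d has_derivative
      (\<lambda>u. frechet_derivative (\<lambda>y. k (chart_inv d y)) (at (chart_map d p)) (dtrans c d p u))) (at (chart_map c p))"
    by (simp add: o_def)
  then have "((\<lambda>x. k (chart_inv c x)) has_derivative
      (\<lambda>u. frechet_derivative (\<lambda>y. k (chart_inv d y)) (at (chart_map d p)) (dtrans c d p u))) (at (chart_map c p))"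
  proof (rule has_derivative_transform_within_open[OF _ open_overlap[OF chc chd]])
    show "chart_map c p \<in> overlap c d" using assms by (auto simp: overlap_def)
    show "((\<lambda>y. k (chart_inv d y)) \<circ> transition c d) x = k (chart_inv c x)" if "x \<in> overlap c d" for x
      using that by (auto simp: overlap_def transition_apply[OF chc] chart_inv_chart[OF chc] chart_inv_chart[OF chd])
  qed
  from frechet_derivative_eq[OF this] show ?thesis .
qed

text \<open>A cut-off function on the surface: positive exactly on the preimage of a coordinate ball. It is smooth when the
  closed ball lies in the image of the chart, because the preimage of this ball is then compact and hence
  closed in the surface.\<close>

definition bump :: "('s, real^2) chart \<Rightarrow> real^2 \<Rightarrow> real \<Rightarrow> 's \<Rightarrow> real" where
  "bump c x0 r p = (if p \<in> chart_dom c then flat 0 (r\<^sup>2 - (norm (chart_map c p - x0))\<^sup>2) else 0)"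

lemma bump_nonneg: "0 \<le> bump c x0 r p"
  by (simp add: bump_def flat_nonneg)

lemma bump_pos_iff: "0 < r \<Longrightarrow> 0 < bump c x0 r p \<longleftrightarrow> p \<in> chart_dom c \<and> chart_map c p \<in> ball x0 r"
  by (auto simp: bump_def flat_pos_iff dist_norm norm_minus_commute power2_less_imp_less intro: power_strict_mono)
    
lemma bump_support: "0 < r \<Longrightarrow> bump c x0 r p \<noteq> 0 \<Longrightarrow> p \<in> chart_dom c \<and> chart_map c p \<in> cball x0 r"
  using bump_pos_iff[of r c x0 p] bump_nonneg[of c x0 r p] by (simp add: less_le)

lemma smooth_norm_bump: "smooth_on (\<lambda>x::real^2. flat 0 (r\<^sup>2 - (norm (x - x0))\<^sup>2)) UNIV"
proof -
  have "smooth_on (\<lambda>x::real^2. r\<^sup>2 - (x - x0) \<bullet> (x - x0)) UNIV"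
    by (rule smooth_on_diff[OF open_UNIV smooth_on_const smooth_on_inner[OF open_UNIV
      smooth_on_diff[OF open_UNIV smooth_on_id smooth_on_const] smooth_on_diff[OF open_UNIV smooth_on_id smooth_on_const]]])
  from smooth_on_compose[OF open_UNIV open_UNIV subset_UNIV smooth_on_flat this]
  show ?thesis by (simp add: power2_norm_eq_inner)
qed

lemma smooth_bump:
  fixes \<A> :: "('s::t2_space, real^2) chart set"
  assumes at: "smooth_atlas \<A>" and cd: "c \<in> \<A>" "d \<in> \<A>" and r: "0 < r" "cball x0 r \<subseteq> chart_img c"
  shows "smooth_on (\<lambda>x. bump c x0 r (chart_inv d x)) (chart_img d)"
proof (rule smooth_on_local)
  note chc = atlas_is_chart[OF at cd(1)] and chd = atlas_is_chart[OF at cd(2)]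
  fix x assume x: "x \<in> chart_img d"
  show "\<exists>T. open T \<and> x \<in> T \<and> smooth_on (\<lambda>x. bump c x0 r (chart_inv d x)) T"
  proof (cases "chart_inv d x \<in> chart_dom c")
    case True
    have o: "open (overlap d c)" by (rule open_overlap[OF chd chc])
    have "smooth_on (\<lambda>x. bump c x0 r (chart_inv d x)) (overlap d c)"
      by (rule smooth_on_eq[OF smooth_on_compose[OF o open_UNIV subset_UNIV smooth_norm_bump transition_smooth[OF at cd(2,1)]] o])
         (auto simp: overlap_eq[OF chd] bump_def transition_def)
    moreover have "x \<in> overlap d c" using x True by (simp add: overlap_eq[OF chd])
    ultimately show ?thesis using o by blast
  next
    case False
    let ?K = "chart_inv c ` cball x0 r"
    have "compact ?K"
      by (intro compact_continuous_image continuous_on_subset[OF continuous_chart_inv[OF chc] r(2)]) simp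
    then have oK: "open (- ?K)" by (simp add: compact_imp_closed open_Compl)
    let ?T = "{x \<in> chart_img d. chart_inv d x \<in> - ?K}"
    have o: "open ?T" by (rule open_chart_vimage[OF chd oK])
    have zero: "bump c x0 r q = 0" if "q \<notin> ?K" for q
    proof (rule ccontr)
      assume "bump c x0 r q \<noteq> 0"
      note sq = bump_support[OF r(1) this]
      have "chart_inv c (chart_map c q) \<in> ?K" by (rule imageI[OF conjunct2[OF sq]])
      then show False using that chart_inv_chart[OF chc conjunct1[OF sq]] by simp
    qed
    have "smooth_on (\<lambda>x. bump c x0 r (chart_inv d x)) ?T"
      by (rule smooth_on_eq[OF smooth_on_const[of 0] o]) (use zero in simp)
    moreover have "?K \<subseteq> chart_dom c"
      by (rule image_subsetI) (rule chart_inv_in[OF chc subsetD[OF r(2)]])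
    then have "x \<in> ?T" using False x by auto
    ultimately show ?thesis using o by (intro exI[of _ ?T]) simp
  qed
qed

context chart_density
begin

definition smooth_fun :: "('s \<Rightarrow> real) \<Rightarrow> bool" where
  "smooth_fun \<rho> \<longleftrightarrow> (\<forall>d\<in>\<A>. smooth_on (\<lambda>x. \<rho> (chart_inv d x)) (chart_img d))"

text \<open>Cut-off functions of finitely many coordinate balls that cover the surface, divided by their sum.\<close>

lemma partition_of_unity:
  "\<exists>I \<rho> K. finite I \<and> (\<forall>i\<in>I. smooth_fun (\<rho> i) \<and> compact (K i) \<and> K i \<subseteq> chart_img (chart_at \<A> i) \<and>
      (\<forall>p. \<rho> i p \<noteq> 0 \<longrightarrow> p \<in> chart_dom (chart_at \<A> i) \<and> chart_map (chart_at \<A> i) p \<in> K i)) \<and>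
     (\<forall>p. (\<Sum>i\<in>I. \<rho> i p) = 1)"
proof -
  note c = chart_at[OF atlas]
  have "\<exists>r>0. cball (chart_map (chart_at \<A> i) i) r \<subseteq> chart_img (chart_at \<A> i)" for i
    using open_contains_cball chart_map_in[OF chart[OF c(1)] c(2)] open_chart_img[OF chart[OF c(1)]] by metis
  then obtain r where r: "\<And>i. 0 < r i" "\<And>i. cball (chart_map (chart_at \<A> i) i) (r i) \<subseteq> chart_img (chart_at \<A> i)"
    by metis
  define b where "b i = bump (chart_at \<A> i) (chart_map (chart_at \<A> i) i) (r i)" for i
  define U where "U i = {p \<in> chart_dom (chart_at \<A> i). chart_map (chart_at \<A> i) p \<in> ball (chart_map (chart_at \<A> i) i) (r i)}" for i
  have U: "open (U i)" for i
    unfolding U_def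
    using continuous_open_preimage[OF continuous_chart_map[OF chart[OF c(1)]] open_chart_dom[OF chart[OF c(1)]] open_ball]
    by (simp add: vimage_def Int_def conj_commute)
  have "i \<in> U i" for i using c(2)[of i] r(1)[of i] by (simp add: U_def)
  then have cover: "UNIV \<subseteq> (\<Union>i\<in>UNIV. U i)" by auto
  obtain I where I: "finite I" "UNIV \<subseteq> (\<Union>i\<in>I. U i)"
    by (rule compactE_image[OF compact_UNIV U cover])
  define S where "S p = (\<Sum>i\<in>I. b i p)" for p
  have Spos: "0 < S p" for p
  proof -
    obtain i where i: "i \<in> I" "p \<in> U i" using I(2) by blast
    then have "0 < b i p" by (simp add: b_def U_def bump_pos_iff[OF r(1)])
    also have "b i p \<le> S p" unfolding S_def
      by (rule member_le_sum[OF i(1)]) (simp_all add: b_def bump_nonneg I(1))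
    finally show ?thesis .
  qed
  have sb: "smooth_on (\<lambda>x. b i (chart_inv d x)) (chart_img d)" if "d \<in> \<A>" for i d
    unfolding b_def by (rule smooth_bump[OF atlas c(1) that r])
  have "smooth_fun (\<lambda>p. b i p / S p)" for i
    unfolding smooth_fun_def
  proof
    fix d assume d: "d \<in> \<A>"
    have "smooth_on (\<lambda>x. S (chart_inv d x)) (chart_img d)"
      unfolding S_def by (rule smooth_on_sum[OF open_chart_img[OF chart[OF d]] sb[OF d]])
    then show "smooth_on (\<lambda>x. b i (chart_inv d x) / S (chart_inv d x)) (chart_img d)"
      by (rule smooth_on_divide[OF open_chart_img[OF chart[OF d]] sb[OF d]]) (rule Spos)
  qed
  moreover have "(\<Sum>i\<in>I. b i p / S p) = 1" for p
    using Spos[of p] by (simp add: S_def sum_divide_distrib[symmetric])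
  moreover have "p \<in> chart_dom (chart_at \<A> i) \<and>
      chart_map (chart_at \<A> i) p \<in> cball (chart_map (chart_at \<A> i) i) (r i)" if "b i p / S p \<noteq> 0" for i p
    using that unfolding b_def by (intro bump_support r(1)) simp
  ultimately show ?thesis
    using r I(1) compact_cball
    by (intro exI[of _ I] exI[of _ "\<lambda>i p. b i p / S p"] exI[of _ "\<lambda>i. cball (chart_map (chart_at \<A> i) i) (r i)"] conjI ballI allI impI)
       simp_all
qed

lemma smooth_fun_chart: "smooth_fun \<rho> \<Longrightarrow> d \<in> \<A> \<Longrightarrow> smooth_on (\<lambda>x. \<rho> (chart_inv d x)) (chart_img d)"
  by (simp add: smooth_fun_def)

text \<open>Stokes' theorem for a one-form \<open>th\<close>, given by its components in all charts. Each product with a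
  function of a partition of unity has compact support in a chart, where the theorem reduces to
  the vanishing of integrals of partial derivatives; the terms with derivatives of these
  functions add up to zero, since the functions add up to a constant.\<close>

lemma stokes:
  assumes \<mu>: "is_area_measure \<mu>"
    and th: "\<And>c u. c \<in> \<A> \<Longrightarrow> smooth_on (th c u) (chart_img c)"
    and lin: "\<And>c x. c \<in> \<A> \<Longrightarrow> x \<in> chart_img c \<Longrightarrow> linear (\<lambda>u. th c u x)"
    and th_change: "\<And>c d p u. c \<in> \<A> \<Longrightarrow> d \<in> \<A> \<Longrightarrow> p \<in> chart_dom c \<Longrightarrow> p \<in> chart_dom d \<Longrightarrow>
      th c u (chart_map c p) = th d (dtrans c d p u) (chart_map d p)"
    and s: "continuous_on UNIV s"
    and s_eq: "\<And>c x. c \<in> \<A> \<Longrightarrow> x \<in> chart_img c \<Longrightarrow> s (chart_inv c x) * a c (chart_inv c x)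
      = frechet_derivative (th c ey) (at x) ex - frechet_derivative (th c ex) (at x) ey"
  shows "integral\<^sup>L \<mu> s = 0"
proof -
  obtain I \<rho> K where I: "finite I" and \<rho>: "\<And>i. i \<in> I \<Longrightarrow> smooth_fun (\<rho> i)"
    and K: "\<And>i. i \<in> I \<Longrightarrow> compact (K i)" "\<And>i. i \<in> I \<Longrightarrow> K i \<subseteq> chart_img (chart_at \<A> i)"
    and supp: "\<And>i p. i \<in> I \<Longrightarrow> \<rho> i p \<noteq> 0 \<Longrightarrow> p \<in> chart_dom (chart_at \<A> i) \<and> chart_map (chart_at \<A> i) p \<in> K i"
    and one: "\<And>p. (\<Sum>i\<in>I. \<rho> i p) = 1"
    using partition_of_unity by blast
  note ca = chart_at[OF atlas]
  define dr where "dr i c x u = frechet_derivative (\<lambda>x. \<rho> i (chart_inv c x)) (at x) u" for i c and x u :: "real^2"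
  define wedge where "wedge i c x = dr i c x ex * th c ey x - dr i c x ey * th c ex x" for i c x
  \<comment> \<open>The quotient of \<open>d\<rho> \<and> \<theta>\<close> by the area form is a function on the surface.\<close>
  define w where "w i p = wedge i (chart_at \<A> p) (chart_map (chart_at \<A> p) p) / a (chart_at \<A> p) p" for i p
  have w: "w i p = wedge i c (chart_map c p) / a c p" if "i \<in> I" "c \<in> \<A>" "p \<in> chart_dom c" for i c p
  proof -
    let ?d = "chart_at \<A> p"
    have dr: "dr i c (chart_map c p) u = dr i ?d (chart_map ?d p) (dtrans c ?d p u)" for u
      unfolding dr_def by (rule differential_change_of_chart[OF atlas that(2) ca(1) smooth_fun_chart[OF \<rho>[OF that(1)] ca(1)] that(3) ca(2)])
    define k where "k u v = dr i ?d (chart_map ?d p) u * th ?d v (chart_map ?d p) - dr i ?d (chart_map ?d p) v * th ?d u (chart_map ?d p)" for u v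
    have img: "chart_map ?d p \<in> chart_img ?d" by (rule chart_map_in[OF chart[OF ca(1)] ca(2)])
    have l1: "linear (dr i ?d (chart_map ?d p))"
      unfolding dr_def by (rule smooth_on_linear_derivative[OF smooth_fun_chart[OF \<rho>[OF that(1)] ca(1)] img])
    note l2 = lin[OF ca(1) img]
    have "bilinear k"
      unfolding bilinear_def k_def
      by (auto intro!: linearI simp: linear_add[OF l1] linear_add[OF l2] linear_scale[OF l1] linear_scale[OF l2] algebra_simps)
    then have "k (dtrans c ?d p ex) (dtrans c ?d p ey) = det (matrix (dtrans c ?d p)) * k ex ey"
      unfolding det_matrix_plane by (rule alternating_plane) (simp add: k_def)
    then have "wedge i c (chart_map c p) = det (matrix (dtrans c ?d p)) * wedge i ?d (chart_map ?d p)"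
      unfolding wedge_def dr th_change[OF that(2) ca(1) that(3) ca(2)] k_def .
    moreover have "a c p = det (matrix (dtrans c ?d p)) * a ?d p" by (rule change[OF ca(1) that(2) ca(2) that(3)])
    moreover have "det (matrix (dtrans c ?d p)) \<noteq> 0" using calculation(2) pos[OF that(2,3)] by auto
    ultimately show ?thesis by (simp add: w_def)
  qed
  have cw: "continuous_on UNIV (w i)" if i: "i \<in> I" for i
  proof (rule continuous_on_local)
    fix p
    let ?d = "chart_at \<A> p"
    note ch = chart[OF ca(1), of p]
    have "continuous_on (chart_img ?d) (wedge i ?d)"
      unfolding wedge_def dr_def
      by (intro continuous_intros smooth_on_continuous smooth_on_derivative th smooth_fun_chart[OF \<rho>[OF i]] ca)
    then have "continuous_on (chart_dom ?d) (\<lambda>q. wedge i ?d (chart_map ?d q) / a ?d q)"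
      using pos[OF ca(1)[of p]] chart_map_in[OF ch]
      by (intro continuous_on_divide cont[OF ca(1)] continuous_on_compose2[OF _ continuous_chart_map[OF ch]])
         (auto simp: less_imp_neq[symmetric])
    then have "continuous_on (chart_dom ?d) (w i)"
      by (rule continuous_on_eq) (simp add: w[OF i ca(1)])
    then show "\<exists>T. open T \<and> p \<in> T \<and> continuous_on T (w i)" using ca(2) open_chart_dom[OF ch] by blast
  qed
  have crho: "continuous_on UNIV (\<rho> i)" if i: "i \<in> I" for i
  proof (rule continuous_on_local)
    fix p
    let ?d = "chart_at \<A> p"
    note ch = chart[OF ca(1), of p]
    have "continuous_on (chart_dom ?d) (\<lambda>q. \<rho> i (chart_inv ?d (chart_map ?d q)))"
      by (rule continuous_on_compose2[OF smooth_on_continuous[OF smooth_fun_chart[OF \<rho>[OF i] ca(1)]] continuous_chart_map[OF ch]])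
         (auto simp: chart_map_in[OF ch])
    then have "continuous_on (chart_dom ?d) (\<rho> i)"
      by (rule continuous_on_eq) (simp add: chart_inv_chart[OF ch])
    then show "\<exists>T. open T \<and> p \<in> T \<and> continuous_on T (\<rho> i)" using ca(2) open_chart_dom[OF ch] by blast
  qed
  have piece: "(\<integral>p. \<rho> i p * s p + w i p \<partial>\<mu>) = 0" if i: "i \<in> I" for i
  proof -
    let ?c = "chart_at \<A> i"
    note c = ca(1)[of i] and ch = chart[OF ca(1), of i]
    let ?V = "chart_img ?c" and ?r = "\<lambda>x. \<rho> i (chart_inv ?c x)"
    have oV: "open ?V" by (rule open_chart_img[OF ch])
    have sr: "smooth_on ?r ?V" by (rule smooth_fun_chart[OF \<rho>[OF i] c])
    have r0: "?r x = 0" if "x \<in> ?V" "x \<notin> K i" for x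
      using supp[OF i, of "chart_inv ?c x"] that chart_chart_inv[OF ch] by auto
    \<comment> \<open>The components of the one-form \<open>\<rho> \<theta>\<close>, extended by zero to the whole plane.\<close>
    define H where "H u x = (if x \<in> ?V then ?r x * th ?c u x else 0)" for u x
    have sH: "smooth_on (H u) UNIV" for u
      unfolding H_def
      by (rule extend_by_zero_smooth[OF oV K(1)[OF i] K(2)[OF i] smooth_on_mult[OF oV sr th[OF c]]]) (simp add: r0)
    have H0: "H u x = 0" if "x \<notin> K i" for u x using r0 that by (simp add: H_def)
    have oK: "open (- K i)" using compact_imp_closed[OF K(1)[OF i]] by (simp add: open_Compl)
    have dH_in: "frechet_derivative (H u) (at x) v = ?r x * frechet_derivative (th ?c u) (at x) v + dr i ?c x v * th ?c u x"
      if "x \<in> ?V" for u v x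
    proof -
      have "frechet_derivative (H u) (at x) = frechet_derivative (\<lambda>x. ?r x * th ?c u x) (at x)"
        by (rule frechet_derivative_cong_open[OF oV that]) (simp add: H_def)
      then show ?thesis using frechet_derivative_mult[OF sr th[OF c] that] by (simp add: dr_def)
    qed
    have dH_out: "frechet_derivative (H u) (at x) v = 0" if "x \<notin> ?V" for u v x
      using frechet_derivative_cong_open[OF oK, of x "H u" "\<lambda>_. 0"] contra_subsetD[OF K(2)[OF i] that] H0 by simp
    have outside: "\<rho> i p * s p + w i p = 0" if p: "p \<notin> chart_dom ?c" for p
    proof -
      let ?d = "chart_at \<A> p"
      note chd = chart[OF ca(1), of p]
      have "compact (chart_inv ?c ` K i)"
        by (intro compact_continuous_image continuous_on_subset[OF continuous_chart_inv[OF ch] K(2)[OF i]] K(1)[OF i])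
      then have o: "open {x \<in> chart_img ?d. chart_inv ?d x \<in> - chart_inv ?c ` K i}"
        by (intro open_chart_vimage[OF chd]) (simp add: compact_imp_closed open_Compl)
      have "p \<notin> chart_inv ?c ` K i" 
      proof
        assume "p \<in> chart_inv ?c ` K i"
        then obtain y where y: "y \<in> K i" "p = chart_inv ?c y" by (rule imageE) simp
        from chart_inv_in[OF ch subsetD[OF K(2)[OF i] y(1)]] p y(2) show False by simp
      qed
      then have in_o: "chart_map ?d p \<in> {x \<in> chart_img ?d. chart_inv ?d x \<in> - chart_inv ?c ` K i}"
        using chart_map_in[OF chd ca(2)] chart_inv_chart[OF chd ca(2)] by simp
      have z: "\<rho> i q = 0" if "q \<notin> chart_inv ?c ` K i" for q
      proof (rule ccontr)
        assume "\<rho> i q \<noteq> 0"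
        note sq = supp[OF i this]
        have "chart_inv ?c (chart_map ?c q) \<in> chart_inv ?c ` K i" by (rule imageI[OF conjunct2[OF sq]])
        then show False using that chart_inv_chart[OF ch conjunct1[OF sq]] by simp
      qed
      have "dr i ?d (chart_map ?d p) u = 0" for u
        unfolding dr_def using frechet_derivative_cong_open[OF o in_o, of "\<lambda>x. \<rho> i (chart_inv ?d x)" "\<lambda>_. 0"] z by simp
      then show ?thesis using supp[OF i, of p] p by (auto simp: w_def wedge_def)
    qed
    have h: "continuous_on UNIV (\<lambda>p. \<rho> i p * s p + w i p)"
      by (intro continuous_intros crho[OF i] cw[OF i] s)
    have "(\<integral>p. \<rho> i p * s p + w i p \<partial>\<mu>)
      = (\<integral>x. indicator ?V x * (a ?c (chart_inv ?c x) * (?r x * s (chart_inv ?c x) + w i (chart_inv ?c x))) \<partial>lborel)"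
      by (rule integral_area_chart[OF \<mu> c borel_measurable_continuous_onI[OF h] outside])
    also have "\<dots> = (\<integral>x. frechet_derivative (H ey) (at x) ex - frechet_derivative (H ex) (at x) ey \<partial>lborel)"
    proof (rule Bochner_Integration.integral_cong[OF refl])
      fix x
      show "indicator ?V x * (a ?c (chart_inv ?c x) * (?r x * s (chart_inv ?c x) + w i (chart_inv ?c x)))
        = frechet_derivative (H ey) (at x) ex - frechet_derivative (H ex) (at x) ey"
      proof (cases "x \<in> ?V")
        case True
        have p: "chart_inv ?c x \<in> chart_dom ?c" by (rule chart_inv_in[OF ch True])
        have "a ?c (chart_inv ?c x) * w i (chart_inv ?c x) = wedge i ?c x"
          using w[OF i c p] pos[OF c p] chart_chart_inv[OF ch True] by simp
        then have "a ?c (chart_inv ?c x) * (?r x * s (chart_inv ?c x) + w i (chart_inv ?c x))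
          = ?r x * (s (chart_inv ?c x) * a ?c (chart_inv ?c x)) + wedge i ?c x" by (simp add: algebra_simps)
        then show ?thesis
          using True by (simp add: s_eq[OF c True] dH_in wedge_def algebra_simps)
      qed (simp add: dH_out)
    qed
    also have "\<dots> = 0"
      using integral_derivative_zero[OF sH K(1)[OF i] H0]
      by (subst Bochner_Integration.integral_diff) simp_all
    finally show ?thesis .
  qed
  have w_sum: "(\<Sum>i\<in>I. w i p) = 0" for p
  proof -
    let ?d = "chart_at \<A> p"
    note chd = chart[OF ca(1), of p]
    have img: "chart_map ?d p \<in> chart_img ?d" by (rule chart_map_in[OF chd ca(2)])
    have "((\<lambda>x. \<Sum>i\<in>I. \<rho> i (chart_inv ?d x)) has_derivative (\<lambda>u. \<Sum>i\<in>I. dr i ?d (chart_map ?d p) u)) (at (chart_map ?d p))"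
      unfolding dr_def
      by (intro has_derivative_sum smooth_on_has_derivative[OF smooth_fun_chart[OF \<rho> ca(1)] img])
    then have "((\<lambda>x. 1) has_derivative (\<lambda>u. \<Sum>i\<in>I. dr i ?d (chart_map ?d p) u)) (at (chart_map ?d p))"
      by (simp add: one)
    from frechet_derivative_eq[OF this] have 0: "(\<Sum>i\<in>I. dr i ?d (chart_map ?d p) u) = 0" for u by simp
    have "(\<Sum>i\<in>I. w i p) = ((\<Sum>i\<in>I. dr i ?d (chart_map ?d p) ex) * th ?d ey (chart_map ?d p)
        - (\<Sum>i\<in>I. dr i ?d (chart_map ?d p) ey) * th ?d ex (chart_map ?d p)) / a ?d p"
      by (simp add: w_def wedge_def sum_divide_distrib[symmetric] sum_subtractf sum_distrib_right)
    then show ?thesis by (simp add: 0)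
  qed
  have "s p = (\<Sum>i\<in>I. \<rho> i p * s p + w i p)" for p
    by (simp add: sum.distrib w_sum sum_distrib_right[symmetric] one)
  then have "integral\<^sup>L \<mu> s = (\<integral>p. (\<Sum>i\<in>I. \<rho> i p * s p + w i p) \<partial>\<mu>)"
    by (rule Bochner_Integration.integral_cong[OF refl])
  also have "\<dots> = (\<Sum>i\<in>I. \<integral>p. \<rho> i p * s p + w i p \<partial>\<mu>)"
    by (rule Bochner_Integration.integral_sum)
       (intro integrable_continuous_area[OF \<mu>] continuous_intros crho cw s)
  also have "\<dots> = 0" by (simp add: piece)
  finally show ?thesis .
qed

end

section \<open>The Euler-Lagrange expression\<close>

context metric_field
begin

lemma dg_expansion3:
  assumes y: "y \<in> V"
  shows "dg y w u v = (\<Sum>k\<in>Basis. (w \<bullet> k) * (\<Sum>i\<in>Basis. \<Sum>j\<in>Basis. ((u \<bullet> i) * (v \<bullet> j)) * dg y k i j))"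
proof -
  have "dg y w u v = dg y (\<Sum>k\<in>Basis. (w \<bullet> k) *\<^sub>R k) u v" by (simp add: euclidean_representation)
  also have "\<dots> = (\<Sum>k\<in>Basis. (w \<bullet> k) * dg y k u v)"
    by (subst linear_sum[OF dg_linear[OF y]], subst linear_scale[OF dg_linear[OF y]]) simp
  also have "\<dots> = (\<Sum>k\<in>Basis. (w \<bullet> k) * (\<Sum>i\<in>Basis. \<Sum>j\<in>Basis. ((u \<bullet> i) * (v \<bullet> j)) * dg y k i j))"
    by (rule sum.cong[OF refl]) (simp only: dg_expansion[OF y, of _ u v])
  finally show ?thesis .
qed

lemma smooth_on_dg:
  fixes \<phi> u v w :: "'z::real_normed_vector \<Rightarrow> 'e"
  assumes W: "open W" and \<phi>: "smooth_on \<phi> W" "\<phi> ` W \<subseteq> V" and s: "smooth_on w W" "smooth_on u W" "smooth_on v W"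
  shows "smooth_on (\<lambda>z. dg (\<phi> z) (w z) (u z) (v z)) W"
proof (rule smooth_on_eq[OF _ W])
  have "smooth_on (\<lambda>z. dg (\<phi> z) k i j) W" for k i j
    unfolding dg_def by (rule smooth_on_compose[OF W open_V \<phi>(2) smooth_on_derivative[OF smooth_g] \<phi>(1)])
  then show "smooth_on (\<lambda>z. \<Sum>k\<in>Basis. (w z \<bullet> k) * (\<Sum>i\<in>Basis. \<Sum>j\<in>Basis. ((u z \<bullet> i) * (v z \<bullet> j)) * dg (\<phi> z) k i j)) W"
    by (intro smooth_on_sum W smooth_on_mult smooth_on_inner s smooth_on_const)
  show "(\<Sum>k\<in>Basis. (w z \<bullet> k) * (\<Sum>i\<in>Basis. \<Sum>j\<in>Basis. ((u z \<bullet> i) * (v z \<bullet> j)) * dg (\<phi> z) k i j))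
      = dg (\<phi> z) (w z) (u z) (v z)" if "z \<in> W" for z
    by (rule dg_expansion3[symmetric]) (use that \<phi>(2) in blast)
qed

text \<open>Solving the metric condition for the connection, as in the Koszul formula. It expresses components of the
  connection by derivatives of the metric and thus shows that they are smooth.\<close>

lemma christoffel_component:
  assumes "y \<in> V"
  shows "g y n (christoffel y u v) = (dg y u v n + dg y v u n - dg y n u v) / 2"
proof -
  interpret inner_form "g y" by (rule inner_g[OF assms])
  note m = christoffel_metric[OF assms] and s = christoffel_sym[OF assms]
  show ?thesis
    unfolding m s[of n] s[of v u] by (simp add: sym[of n] sym[of v])
qed

end

context surface_family
begin

lemma smooth_second_cov_component:
  assumes "smooth_on n W"
  shows "smooth_on (\<lambda>z. g (\<phi> z) (n z) (second_cov a b z)) W"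
proof (rule smooth_on_eq[OF _ open_W])
  show "smooth_on (\<lambda>z. g (\<phi> z) (n z) (frechet_derivative (P b) (at z) (0, a))
      + (1/2) * (dg (\<phi> z) (P a z) (P b z) (n z) + dg (\<phi> z) (P b z) (P a z) (n z) - dg (\<phi> z) (n z) (P a z) (P b z))) W"
    by (intro smooth_on_add smooth_on_diff smooth_on_mult smooth_on_const open_W
        smooth_on_dg[OF open_W smooth_phi phi_image] smooth_on_metric[OF open_W smooth_phi phi_image]
        smooth_on_derivative smooth_P assms)
  show "g (\<phi> z) (n z) (frechet_derivative (P b) (at z) (0, a))
      + (1/2) * (dg (\<phi> z) (P a z) (P b z) (n z) + dg (\<phi> z) (P b z) (P a z) (n z) - dg (\<phi> z) (n z) (P a z) (P b z))
    = g (\<phi> z) (n z) (second_cov a b z)" if "z \<in> W" for z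
    unfolding second_cov_def inner_form.add_right[OF inner_phi[OF that]] christoffel_component[OF phi_V[OF that]] by simp
qed

lemma second_cov_bilinear:
  assumes z: "z \<in> W"
  shows "bilinear (\<lambda>a b. second_cov a b z)"
proof -
  note ch = christoffel_bilinear[OF phi_V[OF z]] and P = P_linear[OF z]
  note D = linear_slice[OF smooth_on_linear_derivative[OF smooth_P z]]
  have l: "linear (\<lambda>a. second_cov a b z)" for b
    by (rule linearI; unfold second_cov_def)
       (simp_all add: linear_add[OF D] linear_scale[OF D] linear_add[OF P] linear_scale[OF P]
         bilinear_ladd[OF ch] bilinear_lmul[OF ch] algebra_simps)
  have "(\<lambda>b. second_cov a b z) = (\<lambda>b. second_cov b a z)" for a
    by (rule ext) (rule second_cov_sym[OF z])
  then show ?thesis unfolding bilinear_def using l by simp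
qed

text \<open>The tangential part of a vector, by the inverse of the Gram matrix.\<close>

definition tangential :: "real \<times> (real^2) \<Rightarrow> complex^2 \<Rightarrow> complex^2" where
  "tangential z w = (1 / Gram z) *\<^sub>R
     ((E ey ey z * g (\<phi> z) w (P ex z) - E ex ey z * g (\<phi> z) w (P ey z)) *\<^sub>R P ex z
      + (E ex ex z * g (\<phi> z) w (P ey z) - E ex ey z * g (\<phi> z) w (P ex z)) *\<^sub>R P ey z)"

lemma tangential_range:
  assumes "z \<in> W"
  shows "tangential z w \<in> range (\<lambda>a. P a z)"
proof -
  note P = P_linear[OF assms]
  have "r *\<^sub>R (s *\<^sub>R P ex z + t *\<^sub>R P ey z) = P (r *\<^sub>R (s *\<^sub>R ex + t *\<^sub>R ey)) z" for r s t
    by (simp add: linear_add[OF P] linear_scale[OF P])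
  then show ?thesis unfolding tangential_def by blast
qed

lemma orthogonal_to_tangent_plane:
  assumes "z \<in> W" "g (\<phi> z) n (P ex z) = 0" "g (\<phi> z) n (P ey z) = 0"
  shows "g (\<phi> z) n (P a z) = 0"
  unfolding linear_plane[OF P_linear[OF assms(1)], of a]
  by (simp add: inner_form.bilin_simps[OF inner_phi[OF assms(1)]] assms)

lemma tangential_orthogonal:
  assumes z: "z \<in> W" "Gram z \<noteq> 0"
  shows "g (\<phi> z) (w - tangential z w) (P a z) = 0"
proof (rule orthogonal_to_tangent_plane[OF z(1)])
  interpret inner_form "g (\<phi> z)" by (rule inner_phi[OF z(1)])
  have G: "Gram z = E ex ex z * E ey ey z - E ex ey z * E ex ey z"
    by (simp add: Gram_def gram_def power2_eq_square)
  note s = E_sym[OF z(1), of ey ex]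
  have 1: "(E ey ey z * k1 - E ex ey z * k2) * E ex ex z + (E ex ex z * k2 - E ex ey z * k1) * E ex ey z = Gram z * k1"
    and 2: "(E ey ey z * k1 - E ex ey z * k2) * E ex ey z + (E ex ex z * k2 - E ex ey z * k1) * E ey ey z = Gram z * k2" for k1 k2
    unfolding G by (simp_all add: algebra_simps)
  show "g (\<phi> z) (w - tangential z w) (P ex z) = 0" "g (\<phi> z) (w - tangential z w) (P ey z) = 0"
    unfolding tangential_def diff_left scale_left add_left E_def[symmetric] s 1 2 using z(2) by simp_all
qed

lemma smooth_tangential:
  assumes "\<And>z. z \<in> W \<Longrightarrow> 0 < Gram z" "smooth_on w W"
  shows "smooth_on (\<lambda>z. tangential z (w z)) W"
  unfolding tangential_def
  by (intro smooth_on_scaleR smooth_on_add smooth_on_diff smooth_on_mult smooth_on_divide smooth_on_const open_W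
      smooth_E smooth_P smooth_Gram smooth_on_metric[OF open_W smooth_phi phi_image] assms)

end

context symplectic_family
begin

lemma smooth_EL_component:
  assumes n: "smooth_on n W"
  shows "smooth_on (\<lambda>z. EL_component z (n z)) W"
proof -
  have "smooth_on (\<lambda>z. H_component z (n z)) W"
    unfolding H_component_def
    by (intro smooth_on_divide smooth_on_add smooth_on_diff smooth_on_mult smooth_on_const open_W smooth_E
        smooth_second_cov_component n smooth_Gram Gram_pos)
  moreover have "smooth_on (\<lambda>z. kcos z ^ 3) W"
    unfolding power3_eq_cube by (intro smooth_on_mult open_W smooth_kcos)
  ultimately show ?thesis
    unfolding EL_component_def
    by (intro smooth_on_add smooth_on_diff smooth_on_mult smooth_on_const open_W smooth_area smooth_kcos
        smooth_on_derivative smooth_on_metric[OF open_W smooth_phi phi_image] smooth_on_linear_compose[OF open_W cplx_str_linear]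
        smooth_P n)
qed

lemma EL_component_scale:
  assumes "z \<in> W"
  shows "EL_component z (r *\<^sub>R n) = r * EL_component z n"
proof -
  interpret inner_form "g (\<phi> z)" by (rule inner_phi[OF assms])
  show ?thesis
    unfolding EL_component_def H_component_def scale_left linear_scale[OF cplx_str_linear]
    by (simp add: algebra_simps add_divide_distrib diff_divide_distrib)
qed

end

context surface_in_hermite
begin

definition EL_vector :: "real \<Rightarrow> ('s \<Rightarrow> 'm) \<Rightarrow> ('s, real^2) chart \<Rightarrow> ('m, complex^2) chart \<Rightarrow> 's \<Rightarrow> complex^2" where
  "EL_vector \<beta> F c C p = kcosine F p ^ 3 *\<^sub>R mean_curvature G c C F p
     - \<beta> *\<^sub>R normal_proj G c C F p (cplx_str (tangent_proj G c C F p (cplx_str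
         (dmap c C F p (gradient (induced_metric \<B> G F) c p (\<lambda>q. kcosine F q))))))"

text \<open>The hypothesis on \<open>J\<close>; it says that the exterior derivative of the Kaehler form vanishes on two tangent
  vectors and one normal vector.\<close>

definition closed_along :: "('s \<Rightarrow> 'm) \<Rightarrow> bool" where
  "closed_along F \<longleftrightarrow> (\<forall>c\<in>\<A>. \<forall>C\<in>\<B>. \<forall>p\<in>chart_dom c \<inter> F -` chart_dom C.
     \<forall>X\<in>range (dmap c C F p). \<forall>Y\<in>range (dmap c C F p). \<forall>\<xi>. normal_vec G c C F p \<xi> \<longrightarrow>
       G C (F p) (nabla_J G C (F p) \<xi> X) Y + G C (F p) (nabla_J G C (F p) X Y) \<xi>
         + G C (F p) (nabla_J G C (F p) Y \<xi>) X = 0)"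

lemma tangent_proj_unique:
  assumes F: "immersion \<A> \<B> F" and c: "c \<in> \<A>" "p \<in> chart_dom c" and C: "C \<in> \<B>" "F p \<in> chart_dom C"
    and w: "w \<in> range (dmap c C F p)" "\<And>u. G C (F p) (v - w) (dmap c C F p u) = 0"
  shows "tangent_proj G c C F p v = w"
  unfolding tangent_proj_def normal_vec_def
  by (rule the1_equality[OF inner_form.orthogonal_projection[OF metric_inner_form[OF C] dmap_linear[OF F c(1) C(1) c(2) C(2)]
      dmap_inj[OF F c(1) C(1) c(2) C(2)]]]) (use w in blast)

end

context symplectic_variation
begin

context
  fixes c C x
  assumes c: "c \<in> \<A>" and C: "C \<in> \<B>" and z: "(0, x) \<in> fam_pos c C"
begin

interpretation sf: symplectic_family "chart_img C" "metric_in C" "fam_pos c C" "fam_rep c C" \<beta>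
  by (rule symplectic_in_charts[OF c C])

private abbreviation (input) "p \<equiv> chart_inv c x"
private abbreviation (input) "F \<equiv> \<Phi> 0"

lemma fam_pos_dom: "(0, x) \<in> fam_dom c C" using z by (simp add: fam_pos_def)

lemmas fd = fam_dom_simps[OF c C fam_pos_dom]
lemmas rp = fam_rep_point[OF c C fam_pos_dom]
lemmas PP = fam_P[OF c C fam_pos_dom]

text \<open>Derivatives along the initial surface are partial derivatives of functions of time and place.\<close>

lemma slice_derivative:
  fixes q :: "real \<times> (real^2) \<Rightarrow> 'b::real_normed_vector"
  assumes q: "smooth_on q (fam_pos c C)" and k: "\<And>x. (0, x) \<in> fam_pos c C \<Longrightarrow> q (0, x) = k x"
  shows "frechet_derivative k (at x) a = frechet_derivative q (at (0, x)) (0, a)"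
proof (rule frechet_derivative_eq)
  show "(k has_derivative (\<lambda>a. frechet_derivative q (at (0, x)) (0, a))) (at x)"
    by (rule has_derivative_transform_within_open[OF has_derivative_fix_fst[OF smooth_on_has_derivative[OF q z]]
          open_fix_fst[OF open_fam_pos[OF c C]]]) (use z k in auto)
qed

lemma slice_dmap:
  assumes "(0, y) \<in> fam_pos c C"
  shows "surface_family.P (fam_rep c C) v (0, y) = dmap c C (\<Phi> 0) (chart_inv c y) v"
  by (rule fam_P[OF c C]) (use assms in \<open>simp add: fam_pos_def\<close>)

lemma levi_civita_christoffel:
  "levi_civita G C (\<Phi> 0 (chart_inv c x)) = metric_field.christoffel (metric_in C) (fam_rep c C (0, x))"
proof -
  have "fam_rep c C (0, x) = chart_map C (\<Phi> 0 p)" by (simp add: fam_rep_def local_rep_def)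
  then show ?thesis
    unfolding levi_civita_def sf.christoffel_def sf.dg_def rp by simp
qed

lemma cov_deriv_dmap:
  "cov_deriv_along G c C (\<Phi> 0) (chart_inv c x) u (\<lambda>q. dmap c C (\<Phi> 0) q v)
    = surface_family.second_cov (metric_in C) (fam_rep c C) u v (0, x)"
  unfolding cov_deriv_along_def levi_civita_christoffel sf.second_cov_def PP fd(5)
  using slice_derivative[OF sf.smooth_P, of v "\<lambda>x. dmap c C F (chart_inv c x) v"] slice_dmap by simp

lemma tangent_proj_eq: "tangent_proj G c C (\<Phi> 0) (chart_inv c x) v
    = surface_family.tangential (metric_in C) (fam_rep c C) (0, x) v"
proof (rule tangent_proj_unique[OF imm0 c fd(3) C fd(4)])
  show "sf.tangential (0, x) v \<in> range (dmap c C F p)"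
    using sf.tangential_range[OF z] unfolding PP .
  show "G C (F p) (v - sf.tangential (0, x) v) (dmap c C F p u) = 0" for u
    using sf.tangential_orthogonal[OF z, of v u] sf.Gram_pos[OF z] unfolding PP rp by simp
qed

text \<open>The sum over an orthonormal basis is the same for all such bases, being the contraction with the inverse
  metric; and there is such a basis, so that the sum determines the vector.\<close>

lemma mean_curvature_eq:
  defines "B \<equiv> second_ff G c C (\<Phi> 0) (chart_inv c x)"
    and "g \<equiv> induced_metric \<B> G (\<Phi> 0) c (chart_inv c x)"
  shows "mean_curvature G c C (\<Phi> 0) (chart_inv c x)
    = (1 / gram g) *\<^sub>R (g ey ey *\<^sub>R B ex ex - g ex ey *\<^sub>R (B ex ey + B ey ex) + g ex ex *\<^sub>R B ey ey)"
proof -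
  interpret plane_form g unfolding g_def by (rule induced_plane_form[OF imm0 c fd(3)])
  have g: "g u v = G C (F p) (dmap c C F p u) (dmap c C F p v)" for u v
    unfolding g_def by (rule induced_metric_eq[OF imm0 c fd(3) C fd(4)])
  interpret I: inner_form "G C (F p)" by (rule metric_inner_form[OF C fd(4)])
  have tl: "linear (sf.tangential (0, x))"
    unfolding sf.tangential_def rp
    by (rule linearI) (simp_all add: I.add_left I.scale_left algebra_simps scaleR_add_left scaleR_diff_left)
  note sc = sf.second_cov_bilinear[OF z]
  have "bilinear B"
    unfolding bilinear_def B_def second_ff_def normal_proj_def cov_deriv_dmap tangent_proj_eq
    by (auto intro!: linearI simp: bilinear_ladd[OF sc] bilinear_radd[OF sc] bilinear_lmul[OF sc] bilinear_rmul[OF sc]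
        linear_add[OF tl] linear_scale[OF tl] scaleR_diff_right)
  note tr = trace_orthonormal[OF this]
  obtain a b where "g a a = 1" "g b b = 1" "g a b = 0" by (rule orthonormal_basis)
  then show ?thesis
    unfolding mean_curvature_def g[symmetric] B_def[symmetric] using tr
    by (intro the_equality) (metis, metis)
qed

lemma gradient_eq:
  defines "w \<equiv> gradient (induced_metric \<B> G (\<Phi> 0)) c (chart_inv c x) (kcosine (\<Phi> 0))"
  shows "induced_metric \<B> G (\<Phi> 0) c (chart_inv c x) w b
    = frechet_derivative (surface_family.kcos (metric_in C) (fam_rep c C)) (at (0, x)) (0, b)"
proof -
  interpret plane_form "induced_metric \<B> G F c p" by (rule induced_plane_form[OF imm0 c fd(3)])
  let ?k = "\<lambda>y. kcosine F (chart_inv c y)"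
  have k: "sf.kcos (0, y) = ?k y" if "(0, y) \<in> fam_pos c C" for y
    by (rule fam_kcos[OF c C]) (use that in \<open>simp add: fam_pos_def\<close>)
  have D: "frechet_derivative ?k (at x) u = frechet_derivative sf.kcos (at (0, x)) (0, u)" for u
    by (rule slice_derivative[OF sf.smooth_kcos k])
  have "linear (frechet_derivative ?k (at x))"
    using linear_slice[OF smooth_on_linear_derivative[OF sf.smooth_kcos z]] by (simp add: D[abs_def, symmetric])
  from theI'[OF riesz[OF this]] show ?thesis
    unfolding w_def gradient_def fd(5) D by blast
qed

text \<open>Pairing with a normal vector removes the normal projections. The tangential part of \<open>J\<nabla>cos \<alpha>\<close> is given by
  \<open>tangential_J_gradient\<close>, and the remaining \<open>J\<close> is moved to the normal vector.\<close>

lemma EL_component_eq: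
  assumes n: "normal_vec G c C (\<Phi> 0) (chart_inv c x) n"
  shows "symplectic_family.EL_component (metric_in C) (fam_rep c C) \<beta> (0, x) n
    = adens (\<Phi> 0) c (chart_inv c x) * G C (\<Phi> 0 (chart_inv c x)) (EL_vector \<beta> (\<Phi> 0) c C (chart_inv c x)) n"
proof -
  interpret I: inner_form "G C (F p)" by (rule metric_inner_form[OF C fd(4)])
  let ?z = "(0::real, x)" and ?g = "induced_metric \<B> G F c p"
  have nP: "G C (F p) n (sf.P a ?z) = 0" for a using n unfolding normal_vec_def PP by blast
  have nt: "G C (F p) n (normal_proj G c C F p v) = G C (F p) n v" for v
    unfolding normal_proj_def tangent_proj_eq I.diff_right sf.tangential_def by (simp add: I.bilin_simps nP)
  have E: "sf.E a b ?z = ?g a b" for a b by (rule fam_E[OF c C fam_pos_dom])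
  have Gr: "sf.Gram ?z = gram ?g" by (rule fam_Gram[OF c C fam_pos_dom])
  have A: "sf.area ?z = adens F c p" by (rule fam_area[OF c C fam_pos_dom])
  have kc: "sf.kcos ?z = kcosine F p" by (rule fam_kcos[OF c C fam_pos_dom])
  have H: "G C (F p) n (mean_curvature G c C F p) = sf.H_component ?z n"
    unfolding mean_curvature_eq I.add_right I.diff_right I.scale_right second_ff_def nt cov_deriv_dmap
      sf.H_component_def E Gr rp sf.second_cov_sym[OF z, of ey ex]
    by (simp add: algebra_simps add_divide_distrib diff_divide_distrib)
  let ?w = "gradient (induced_metric \<B> G F) c p (kcosine F)"
  let ?k = "\<lambda>b. frechet_derivative sf.kcos (at ?z) (0, b)"
  let ?v = "(sf.kf ?z / sf.Gram ?z) *\<^sub>R (?k ex *\<^sub>R sf.P ey ?z - ?k ey *\<^sub>R sf.P ex ?z)"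
  have J: "tangent_proj G c C F p (cplx_str (dmap c C F p ?w)) = ?v"
  proof (rule tangent_proj_unique[OF imm0 c fd(3) C fd(4)])
    note P = sf.P_linear[OF z]
    have "?v = sf.P ((sf.kf ?z / sf.Gram ?z) *\<^sub>R (?k ex *\<^sub>R ey - ?k ey *\<^sub>R ex)) ?z"
      by (simp only: linear_diff[OF P] linear_scale[OF P])
    then show "?v \<in> range (dmap c C F p)" unfolding PP by blast
    have "sf.E ?w b ?z = ?k b" for b unfolding E by (rule gradient_eq)
    from sf.tangential_J_gradient[OF z this]
    show "G C (F p) (cplx_str (dmap c C F p ?w) - ?v) (dmap c C F p u) = 0" for u
      unfolding PP rp .
  qed
  have pos: "0 < sf.area ?z" by (rule sf.area_pos[OF z])
  have v1: "G C (F p) (cplx_str n) ?v = (sf.kf ?z / sf.Gram ?z) *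
      (?k ex * G C (F p) (cplx_str n) (sf.P ey ?z) - ?k ey * G C (F p) (cplx_str n) (sf.P ex ?z))"
    by (simp add: I.bilin_simps)
  have v2: "sf.area ?z * (sf.kf ?z / sf.Gram ?z) = sf.kcos ?z"
  proof -
    have "sf.Gram ?z = sf.area ?z * sf.area ?z" using sf.Gram_pos[OF z] by (simp add: sf.area_def)
    then show ?thesis using pos by (simp add: sf.kcos_def)
  qed
  have v3: "G C (F p) n (cplx_str ?v) = - G C (F p) (cplx_str n) ?v"
    using sf.J_skew[OF sf.phi_V[OF z], of n ?v] unfolding rp by simp
  have Jn: "sf.area ?z * G C (F p) n (cplx_str ?v) = - sf.kcos ?z *
      (?k ex * G C (F p) (cplx_str n) (sf.P ey ?z) - ?k ey * G C (F p) (cplx_str n) (sf.P ex ?z))"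
    unfolding v3 v1 v2[symmetric] by simp
  have EV: "G C (F p) (EL_vector \<beta> F c C p) n = sf.kcos ?z ^ 3 * sf.H_component ?z n - \<beta> * G C (F p) n (cplx_str ?v)"
    unfolding EL_vector_def I.sym[of _ n] I.diff_right I.scale_right nt J H kc ..
  have "adens F c p * G C (F p) (EL_vector \<beta> F c C p) n
    = sf.kcos ?z ^ 3 * sf.area ?z * sf.H_component ?z n - \<beta> * (sf.area ?z * G C (F p) n (cplx_str ?v))"
    unfolding A[symmetric] EV by (simp only: right_diff_distrib mult.left_commute mult.assoc)
  then show ?thesis
    unfolding Jn sf.EL_component_def rp by (simp add: algebra_simps)
qed

lemma EL_vector_normal: "normal_vec G c C (\<Phi> 0) (chart_inv c x) (EL_vector \<beta> (\<Phi> 0) c C (chart_inv c x))"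
proof -
  interpret I: inner_form "G C (F p)" by (rule metric_inner_form[OF C fd(4)])
  have np: "G C (F p) (normal_proj G c C F p v) (dmap c C F p u) = 0" for u v
    using sf.tangential_orthogonal[OF z, of v u] sf.Gram_pos[OF z]
    unfolding normal_proj_def tangent_proj_eq PP rp by simp
  show ?thesis
    unfolding normal_vec_def EL_vector_def mean_curvature_eq second_ff_def by (simp add: I.bilin_simps np)
qed

lemma closed_in_chart:
  assumes cl: "closed_along (\<Phi> 0)" and n: "normal_vec G c C (\<Phi> 0) (chart_inv c x) n"
  defines "y \<equiv> fam_rep c C (0, x)" and "D \<equiv> metric_field.dg (metric_in C)"
    and "Q \<equiv> \<lambda>a. surface_family.P (fam_rep c C) a (0, x)"
  shows "D y n (cplx_str (Q ex)) (Q ey) + D y (Q ex) (cplx_str (Q ey)) n + D y (Q ey) (cplx_str n) (Q ex) = 0"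
proof -
  have nJ: "nabla_J G C (F p) u v = sf.christoffel y u (cplx_str v) - cplx_str (sf.christoffel y u v)" for u v
    unfolding nabla_J_def cov_deriv_def y_def levi_civita_christoffel by simp
  have "Q a \<in> range (dmap c C F p)" for a unfolding Q_def PP by blast
  then have "G C (F p) (nabla_J G C (F p) n (Q ex)) (Q ey) + G C (F p) (nabla_J G C (F p) (Q ex) (Q ey)) n
         + G C (F p) (nabla_J G C (F p) (Q ey) n) (Q ex) = 0"
    using cl c C fd(3,4) n unfolding closed_along_def by blast
  then show ?thesis
    unfolding nJ D_def using sf.cyclic_nabla_J[OF sf.phi_V[OF z], of n "Q ex" "Q ey"]
    unfolding y_def[symmetric] rp[folded y_def] by simp
qed

lemma fam_T: "surface_family.T (fam_rep c C) (0, x) = vector_derivative (\<lambda>t. chart_map C (\<Phi> t (chart_inv c x))) (at 0)"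
    "((\<lambda>t. chart_map C (\<Phi> t (chart_inv c x))) has_vector_derivative surface_family.T (fam_rep c C) (0, x)) (at 0)"
proof -
  have "((\<lambda>t. chart_map C (\<Phi> t p)) has_derivative (\<lambda>h. frechet_derivative (fam_rep c C) (at (0, x)) (h, 0))) (at 0)"
    using has_derivative_fix_snd[OF smooth_on_has_derivative[OF sf.smooth_phi z]] by (simp add: fam_rep_def local_rep_def)
  also have "(\<lambda>h. frechet_derivative (fam_rep c C) (at (0, x)) (h, 0)) = (\<lambda>h. h *\<^sub>R sf.T (0, x))"
  proof (rule ext)
    show "frechet_derivative (fam_rep c C) (at (0, x)) (h, 0) = h *\<^sub>R sf.T (0, x)" for h
      using linear_scale[OF smooth_on_linear_derivative[OF sf.smooth_phi z], of h "(1, 0)"] by (simp add: sf.T_def)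
  qed
  finally show d: "((\<lambda>t. chart_map C (\<Phi> t p)) has_vector_derivative sf.T (0, x)) (at 0)"
    unfolding has_vector_derivative_def .
  then show "sf.T (0, x) = vector_derivative (\<lambda>t. chart_map C (\<Phi> t p)) (at 0)"
    by (rule vector_derivative_at[symmetric])
qed

end

end

section \<open>The first variation\<close>

context symplectic_variation
begin

text \<open>\<open>xi\<close> is the variational field and \<open>th\<close> the one-form \<open>theta\<close> of the density variation, now as objects on the
  surface: \<open>th\<close> does not depend on the chart of the ambient surface, which permits an arbitrary choice of it.\<close>

definition xi :: "('m, complex^2) chart \<Rightarrow> 's \<Rightarrow> complex^2" where
  "xi C p = vector_derivative (\<lambda>t. chart_map C (\<Phi> t p)) (at 0)"

definition th :: "('s, real^2) chart \<Rightarrow> real^2 \<Rightarrow> real^2 \<Rightarrow> real" where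
  "th c u x = (let p = chart_inv c x; C = chart_at \<B> (\<Phi> 0 p) in
     - \<beta> * kcosine (\<Phi> 0) p powr (- \<beta> - 1) * kahler_form G C (\<Phi> 0 p) (xi C p) (dmap c C (\<Phi> 0) p u))"

lemma xi_change:
  assumes C: "C \<in> \<B>" "D \<in> \<B>" "\<Phi> 0 p \<in> chart_dom C" "\<Phi> 0 p \<in> chart_dom D"
  shows "xi D p = dtrans C D (\<Phi> 0 p) (xi C p)"
proof -
  let ?c = "chart_at \<A> p"
  note c = chart_at[OF atlas_A, of p]
  note chC = chart_B[OF C(1)]
  have z: "(0, chart_map ?c p) \<in> fam_pos ?c C" by (rule in_fam_pos0[OF c(1) C(1) c(2) C(3)])
  have inv: "chart_inv ?c (chart_map ?c p) = p" by (rule chart_inv_chart[OF chart_A[OF c(1)] c(2)])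
  have T: "((\<lambda>t. chart_map C (\<Phi> t p)) has_vector_derivative xi C p) (at 0)"
    using fam_T[OF c(1) C(1) z] unfolding inv xi_def by simp
  have "((\<lambda>t. transition C D (chart_map C (\<Phi> t p))) has_vector_derivative dtrans C D (\<Phi> 0 p) (xi C p)) (at 0)"
  proof -
    from diff_chain_at[OF T[unfolded has_vector_derivative_def] dtrans_has_derivative[OF atlas_B C]]
    show ?thesis
      by (simp add: o_def has_vector_derivative_def linear_scale[OF dtrans_linear[OF atlas_B C]])
  qed
  then have "((\<lambda>t. chart_map D (\<Phi> t p)) has_vector_derivative dtrans C D (\<Phi> 0 p) (xi C p)) (at 0)"
    unfolding has_vector_derivative_def
  proof (rule has_derivative_transform_within_open)
    show "open {t. (t, chart_map ?c p) \<in> fam_dom ?c C}"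
      by (rule open_fix_snd[OF open_fam_dom[OF c(1) C(1)]])
    show "0 \<in> {t. (t, chart_map ?c p) \<in> fam_dom ?c C}" using z by (simp add: fam_pos_def)
    show "transition C D (chart_map C (\<Phi> t p)) = chart_map D (\<Phi> t p)" if "t \<in> {t. (t, chart_map ?c p) \<in> fam_dom ?c C}" for t
      using that inv by (simp add: fam_dom_def transition_apply[OF chC])
  qed
  then show ?thesis unfolding xi_def[of D] by (rule vector_derivative_at)
qed

lemma th_eq:
  assumes "c \<in> \<A>" "C \<in> \<B>" "x \<in> chart_img c" "\<Phi> 0 (chart_inv c x) \<in> chart_dom C"
  shows "th c u x = - \<beta> * kcosine (\<Phi> 0) (chart_inv c x) powr (- \<beta> - 1)
    * kahler_form G C (\<Phi> 0 (chart_inv c x)) (xi C (chart_inv c x)) (dmap c C (\<Phi> 0) (chart_inv c x) u)"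
proof -
  let ?p = "chart_inv c x"
  note ca = chart_at[OF atlas_B, of "\<Phi> 0 ?p"]
  have p: "?p \<in> chart_dom c" by (rule chart_inv_in[OF chart_A[OF assms(1)] assms(3)])
  show ?thesis
    unfolding th_def Let_def kahler_change[OF assms(2) ca(1) assms(4) ca(2)]
      xi_change[OF assms(2) ca(1) assms(4) ca(2)] dmap_change_target[OF imm0 assms(1) p assms(2) ca(1) assms(4) ca(2)] ..
qed

lemma th_fam:
  assumes c: "c \<in> \<A>" "C \<in> \<B>" and z: "(0, x) \<in> fam_pos c C"
  shows "symplectic_family.theta (metric_in C) (fam_rep c C) \<beta> u (0, x) = th c u x"
proof -
  interpret sf: symplectic_family "chart_img C" "metric_in C" "fam_pos c C" "fam_rep c C" \<beta>
    by (rule symplectic_in_charts[OF c])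
  note zd = fam_pos_dom[OF c z]
  note fd = fam_dom_simps[OF c zd]
  show ?thesis
    unfolding sf.theta_def sf.eta_def fam_kcos[OF c zd] fam_P[OF c zd] fam_rep_point[OF c zd] fam_T(1)[OF c z]
      th_eq[OF c fd(2,4)] kahler_form_def xi_def ..
qed

lemma in_slice: "c \<in> \<A> \<Longrightarrow> C \<in> \<B> \<Longrightarrow> x \<in> chart_img c \<Longrightarrow> \<Phi> 0 (chart_inv c x) \<in> chart_dom C \<Longrightarrow> (0, x) \<in> fam_pos c C"
  using zero_time pos0 by (simp add: fam_pos_def fam_dom_def)

lemma th_smooth:
  assumes c: "c \<in> \<A>"
  shows "smooth_on (th c u) (chart_img c)"
proof (rule smooth_on_local)
  fix x assume x: "x \<in> chart_img c"
  let ?C = "chart_at \<B> (\<Phi> 0 (chart_inv c x))"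
  note C = chart_at[OF atlas_B, of "\<Phi> 0 (chart_inv c x)"]
  interpret sf: symplectic_family "chart_img ?C" "metric_in ?C" "fam_pos c ?C" "fam_rep c ?C" \<beta>
    by (rule symplectic_in_charts[OF c C(1)])
  let ?T = "{x. (0, x) \<in> fam_pos c ?C}"
  note o = open_fix_fst[OF open_fam_pos[OF c C(1)], of 0]
  have "smooth_on (\<lambda>x. sf.theta u (0, x)) ?T"
    by (rule smooth_on_compose[OF o sf.open_W _ sf.smooth_theta smooth_on_Pair_left]) auto
  then have "smooth_on (th c u) ?T"
    by (rule smooth_on_eq[OF _ o]) (simp add: th_fam[OF c C(1)])
  moreover have "x \<in> ?T" using in_slice[OF c C(1) x C(2)] by simp
  ultimately show "\<exists>T. open T \<and> x \<in> T \<and> smooth_on (th c u) T" using o by blast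
qed

lemma th_linear:
  assumes c: "c \<in> \<A>" and x: "x \<in> chart_img c"
  shows "linear (\<lambda>u. th c u x)"
proof -
  note C = chart_at[OF atlas_B, of "\<Phi> 0 (chart_inv c x)"]
  note d = dmap_linear[OF imm0 c C(1) chart_inv_in[OF chart_A[OF c] x] C(2)]
  note k = kahler_form_bilinear[OF C]
  show ?thesis
    unfolding th_def Let_def
    by (rule linearI) (simp_all add: linear_add[OF d] linear_scale[OF d] bilinear_radd[OF k] bilinear_rmul[OF k] algebra_simps)
qed

lemma th_change:
  assumes "c \<in> \<A>" "d \<in> \<A>" "p \<in> chart_dom c" "p \<in> chart_dom d"
  shows "th c u (chart_map c p) = th d (dtrans c d p u) (chart_map d p)"
proof -
  note C = chart_at[OF atlas_B, of "\<Phi> 0 p"]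
  show ?thesis
    unfolding th_def Let_def chart_inv_chart[OF chart_A[OF assms(1)] assms(3)] chart_inv_chart[OF chart_A[OF assms(2)] assms(4)]
      dmap_change_source[OF imm0 assms(2,1,4,3) C] ..
qed

context
  assumes normal: "\<And>c C p. c \<in> \<A> \<Longrightarrow> C \<in> \<B> \<Longrightarrow> p \<in> chart_dom c \<Longrightarrow> \<Phi> 0 p \<in> chart_dom C \<Longrightarrow> normal_vec G c C (\<Phi> 0) p (xi C p)"
    and closed: "closed_along (\<Phi> 0)"
begin

lemma first_variation_chart:
  assumes c: "c \<in> \<A>" "C \<in> \<B>" and z: "(0, x) \<in> fam_pos c C"
  shows "dpsi 0 (chart_inv c x) * adens (\<Phi> 0) c (chart_inv c x)
    = frechet_derivative (th c ey) (at x) ex - frechet_derivative (th c ex) (at x) ey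
      - (\<beta> + 1) * kcosine (\<Phi> 0) (chart_inv c x) powr (- \<beta> - 3)
        * symplectic_family.EL_component (metric_in C) (fam_rep c C) \<beta> (0, x) (xi C (chart_inv c x))"
proof -
  interpret sf: symplectic_family "chart_img C" "metric_in C" "fam_pos c C" "fam_rep c C" \<beta>
    by (rule symplectic_in_charts[OF c])
  note zd = fam_pos_dom[OF c]
  note fd = fam_dom_simps[OF c zd[OF z]]
  have T: "sf.T (0, y) = xi C (chart_inv c y)" if "(0, y) \<in> fam_pos c C" for y
    unfolding xi_def by (rule fam_T(1)[OF c that])
  have n: "metric_in C (fam_rep c C (0, y)) (sf.T (0, y)) (sf.P a (0, y)) = 0" if y: "(0, y) \<in> fam_pos c C" for y a
  proof -
    note fdy = fam_dom_simps[OF c zd[OF y]]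
    show ?thesis
      unfolding T[OF y] fam_P[OF c zd[OF y]] fam_rep_point[OF c zd[OF y]]
      using normal[OF c fdy(3,4)] by (simp add: normal_vec_def)
  qed
  have cl: "sf.dg (fam_rep c C (0, x)) (sf.T (0, x)) (cplx_str (sf.P ex (0, x))) (sf.P ey (0, x))
     + sf.dg (fam_rep c C (0, x)) (sf.P ex (0, x)) (cplx_str (sf.P ey (0, x))) (sf.T (0, x))
     + sf.dg (fam_rep c C (0, x)) (sf.P ey (0, x)) (cplx_str (sf.T (0, x))) (sf.P ex (0, x)) = 0"
    unfolding T[OF z] by (rule closed_in_chart[OF c z closed normal[OF c fd(3,4)]])
  have dth: "frechet_derivative (th c u) (at x) v = frechet_derivative (sf.theta u) (at (0, x)) (0, v)" for u v
    by (rule slice_derivative[OF c z sf.smooth_theta th_fam[OF c]])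
  have "dpsi 0 (chart_inv c x) * adens (\<Phi> 0) c (chart_inv c x) = frechet_derivative sf.ell (at (0, x)) (1, 0)"
    unfolding dpsi_eq[OF c z] using area_density_pos[OF imm0 c(1) fd(3)] by simp
  also have "\<dots> = frechet_derivative (sf.theta ey) (at (0, x)) (0, ex) - frechet_derivative (sf.theta ex) (at (0, x)) (0, ey)
      - (\<beta> + 1) * sf.kcos (0, x) powr (- \<beta> - 3) * sf.EL_component (0, x) (sf.T (0, x))"
    by (rule sf.density_variation[OF z n cl])
  finally show ?thesis unfolding dth T[OF z] fam_kcos[OF c zd[OF z]] .
qed

text \<open>If the Euler-Lagrange expression vanishes in all charts, the derivative of the density is the exterior
  derivative of \<open>th\<close> in all charts.\<close>

lemma critical_if_EL:
  assumes EL: "\<And>c C p. c \<in> \<A> \<Longrightarrow> C \<in> \<B> \<Longrightarrow> p \<in> chart_dom c \<Longrightarrow> \<Phi> 0 p \<in> chart_dom C \<Longrightarrow> EL_vector \<beta> (\<Phi> 0) c C p = 0"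
  shows "(\<integral>p. dpsi 0 p \<partial>mu0) = 0"
proof (rule area0.stokes[OF mu0 th_smooth th_linear th_change continuous_dpsi0])
  fix c x assume c: "c \<in> \<A>" and x: "x \<in> chart_img c"
  let ?p = "chart_inv c x"
  note C = chart_at[OF atlas_B, of "\<Phi> 0 ?p"]
  have p: "?p \<in> chart_dom c" by (rule chart_inv_in[OF chart_A[OF c] x])
  note z = in_slice[OF c C(1) x C(2)]
  show "dpsi 0 ?p * adens (\<Phi> 0) c ?p = frechet_derivative (th c ey) (at x) ex - frechet_derivative (th c ex) (at x) ey"
    unfolding first_variation_chart[OF c C(1) z] EL_component_eq[OF c C(1) z normal[OF c C(1) p C(2)]] EL[OF c C(1) p C(2)]
    by (simp add: inner_form.zero_left[OF metric_inner_form[OF C]])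
qed

end

end

lemma (in surface_in_hermite) normal_variation_family:
  assumes "normal_variation \<A> \<B> G F \<Phi>" "\<And>p. 0 < kcosine F p"
  shows "\<exists>\<epsilon>. symplectic_variation \<A> \<B> G \<Phi> \<epsilon>" and "\<Phi> 0 = F"
    and "c \<in> \<A> \<Longrightarrow> C \<in> \<B> \<Longrightarrow> p \<in> chart_dom c \<Longrightarrow> F p \<in> chart_dom C \<Longrightarrow>
      normal_vec G c C F p (vector_derivative (\<lambda>t. chart_map C (\<Phi> t p)) (at 0))"
proof -
  obtain \<epsilon> where e: "0 < \<epsilon>" "continuous_on ({-\<epsilon><..<\<epsilon>} \<times> UNIV) (\<lambda>(t, p). \<Phi> t p)"
    "\<forall>c\<in>\<A>. \<forall>C\<in>\<B>. smooth_on (\<lambda>(t, x). local_rep c C (\<Phi> t) x)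
           {(t, x). t \<in> {-\<epsilon><..<\<epsilon>} \<and> x \<in> chart_img c \<and> \<Phi> t (chart_inv c x) \<in> chart_dom C}"
    "\<forall>t\<in>{-\<epsilon><..<\<epsilon>}. immersion \<A> \<B> (\<Phi> t)"
    using assms(1) unfolding normal_variation_def by blast
  show F: "\<Phi> 0 = F" using assms(1) unfolding normal_variation_def by blast
  have "symplectic_variation \<A> \<B> G \<Phi> \<epsilon>"
    by unfold_locales (use e assms(2) F in simp_all)
  then show "\<exists>\<epsilon>. symplectic_variation \<A> \<B> G \<Phi> \<epsilon>" ..
  show "normal_vec G c C F p (vector_derivative (\<lambda>t. chart_map C (\<Phi> t p)) (at 0))"
    if "c \<in> \<A>" "C \<in> \<B>" "p \<in> chart_dom c" "F p \<in> chart_dom C"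
    using assms(1) that unfolding normal_variation_def by blast
qed

lemma (in surface_in_hermite) EL_imp_critical:
  assumes "\<And>p. 0 < kcosine F p" "closed_along F"
    and "\<And>c C p. c \<in> \<A> \<Longrightarrow> C \<in> \<B> \<Longrightarrow> p \<in> chart_dom c \<Longrightarrow> F p \<in> chart_dom C \<Longrightarrow> EL_vector \<beta> F c C p = 0"
  shows "L_critical \<A> \<B> G \<beta> F"
  unfolding L_critical_def
proof (intro allI impI)
  fix \<Phi> assume "normal_variation \<A> \<B> G F \<Phi>"
  note nv = normal_variation_family[OF this assms(1)]
  note F = nv(2) and n = nv(3)
  obtain \<epsilon> where sv: "symplectic_variation \<A> \<B> G \<Phi> \<epsilon>" using nv(1) by blast
  interpret symplectic_variation \<A> \<B> G \<Phi> \<epsilon> \<beta> by (rule sv)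
  have "(\<integral>p. dpsi 0 p \<partial>mu0) = 0"
    by (rule critical_if_EL) (simp_all add: F xi_def n assms)
  then show "((\<lambda>t. L_functional \<A> \<B> G \<beta> (\<Phi> t)) has_real_derivative 0) (at 0)"
    using L_functional_derivative by simp
qed

section \<open>Variations supported in a chart\<close>

context surface_in_hermite
begin

lemma normal_vec_change:
  assumes F: "immersion \<A> \<B> F" and c: "c \<in> \<A>" "d \<in> \<A>" "p \<in> chart_dom c" "p \<in> chart_dom d"
    and C: "C \<in> \<B>" "D \<in> \<B>" "F p \<in> chart_dom C" "F p \<in> chart_dom D" and n: "normal_vec G c C F p n"
  shows "normal_vec G d D F p (dtrans C D (F p) n)"
  using n unfolding normal_vec_def dmap_change[OF F c C] metric_change[OF C, symmetric] by blast

lemma inj_dtrans: "smooth_atlas \<C> \<Longrightarrow> c \<in> \<C> \<Longrightarrow> d \<in> \<C> \<Longrightarrow> p \<in> chart_dom c \<Longrightarrow> p \<in> chart_dom d \<Longrightarrow> inj (dtrans c d p)"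
  using dtrans_inverse[of \<C> c d p] by (metis injI)

end

text \<open>A normal field \<open>\<nu>\<close> with compact support in a pair of charts, and below the family obtained by moving
  along straight lines in the chart of the ambient surface with velocity \<open>\<nu>\<close>.\<close>

locale local_normal_variation = surface_in_hermite \<A> \<B> G
  for \<A> :: "('s::{t2_space, second_countable_topology}, real^2) chart set"
    and \<B> :: "('m::{t2_space, second_countable_topology}, complex^2) chart set"
    and G :: "('m, complex^2) metric_tensor" +
  fixes F :: "'s \<Rightarrow> 'm" and c :: "('s, real^2) chart" and C :: "('m, complex^2) chart"
    and \<nu> :: "real^2 \<Rightarrow> complex^2" and K :: "(real^2) set"
  assumes F: "immersion \<A> \<B> F" and c: "c \<in> \<A>" and C: "C \<in> \<B>"
    and K: "compact K" "K \<subseteq> rep_dom c C F"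
    and smooth_nu: "smooth_on \<nu> UNIV" and support_nu: "x \<notin> K \<Longrightarrow> \<nu> x = 0"
    and normal_nu: "x \<in> rep_dom c C F \<Longrightarrow> normal_vec G c C F (chart_inv c x) (\<nu> x)"
begin

abbreviation "V \<equiv> rep_dom c C F"
abbreviation "metric_C \<equiv> \<lambda>y. G C (chart_inv C y)"

definition flow :: "real \<times> (real^2) \<Rightarrow> complex^2" where
  "flow z = local_rep c C F (snd z) + fst z *\<^sub>R \<nu> (snd z)"

lemmas chc = chart_A[OF c] and chC = chart_B[OF C]

lemma V_eq: "V = {x \<in> chart_img c. F (chart_inv c x) \<in> chart_dom C}"
  by (rule rep_dom_eq[OF chc])

lemma open_V: "open V" by (rule immersion_rep_open[OF F c C])

lemma V_simps:
  assumes "x \<in> V"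
  shows "x \<in> chart_img c" "chart_inv c x \<in> chart_dom c" "F (chart_inv c x) \<in> chart_dom C" "chart_map c (chart_inv c x) = x"
  using assms chart_inv_in[OF chc] chart_chart_inv[OF chc] by (auto simp: V_eq)

lemma smooth_flow: "smooth_on flow (UNIV \<times> V)"
proof -
  have o: "open (UNIV \<times> V :: (real \<times> (real^2)) set)" by (intro open_Times open_V open_UNIV)
  have "smooth_on (\<lambda>z::real \<times> (real^2). local_rep c C F (snd z)) (UNIV \<times> V)"
    by (rule smooth_on_compose[OF o open_V _ immersion_smooth[OF F c C] smooth_on_snd]) auto
  moreover have "smooth_on (\<lambda>z::real \<times> (real^2). \<nu> (snd z)) (UNIV \<times> V)"
    by (rule smooth_on_compose[OF o open_UNIV subset_UNIV smooth_nu smooth_on_snd])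
  ultimately show ?thesis
    unfolding flow_def[abs_def] by (intro smooth_on_add smooth_on_scaleR o smooth_on_fst)
qed

text \<open>The region where the deformed map stays in the chart of the ambient surface.\<close>

definition good :: "(real \<times> (real^2)) set" where
  "good = {z \<in> UNIV \<times> V. flow z \<in> chart_img C}"

lemma open_good: "open good"
proof -
  have "open (UNIV \<times> V :: (real \<times> (real^2)) set)" by (intro open_Times open_V open_UNIV)
  from continuous_open_preimage[OF smooth_on_continuous[OF smooth_flow] this open_chart_img[OF chC]]
  show ?thesis by (simp add: good_def vimage_def Int_def)
qed

lemma family_good: "surface_family (chart_img C) metric_C good flow"
proof -
  interpret hermitian_field "chart_img C" metric_C by (rule hermitian_chart[OF C])
  show ?thesis
    by unfold_locales (use open_good smooth_on_subset[OF smooth_flow, of good] in \<open>auto simp: good_def\<close>)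
qed

sublocale gf: surface_family "chart_img C" metric_C good flow by (rule family_good)

lemma flow_rest: "t = 0 \<or> x \<notin> K \<Longrightarrow> flow (t, x) = local_rep c C F x"
  by (auto simp: flow_def support_nu)

lemma local_rep_in: "x \<in> V \<Longrightarrow> local_rep c C F x \<in> chart_img C"
  using chart_map_in[OF chC V_simps(3)] by (simp add: local_rep_def)

lemma flow_slice_derivative:
  "(t, x) \<in> good \<Longrightarrow> ((\<lambda>x. flow (t, x)) has_derivative (\<lambda>a. gf.P a (t, x))) (at x)"
  unfolding gf.P_def by (rule has_derivative_fix_fst[OF smooth_on_has_derivative[OF gf.smooth_phi]])

lemma rest_good:
  assumes x: "x \<in> V" "t = 0 \<or> x \<notin> K"
  shows "(t, x) \<in> good" "0 < gf.Gram (t, x)"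
proof -
  show g: "(t, x) \<in> good" using x local_rep_in flow_rest[OF x(2)] by (simp add: good_def)
  have "(local_rep c C F has_derivative (\<lambda>a. gf.P a (t, x))) (at x)"
  proof (cases "t = 0")
    case True
    then show ?thesis using flow_slice_derivative[OF g] by (simp add: flow_rest)
  next
    case False
    then have "x \<in> - K" using x by simp
    moreover have "open (- K)" using compact_imp_closed[OF K(1)] by (simp add: open_Compl)
    ultimately show ?thesis
      using has_derivative_transform_within_open[OF flow_slice_derivative[OF g], of "- K" "local_rep c C F"]
      by (simp add: flow_rest)
  qed
  from frechet_derivative_eq[OF this]
  have P: "dmap c C F (chart_inv c x) a = gf.P a (t, x)" for a
    unfolding dmap_def V_simps(4)[OF x(1)] .
  have q: "chart_inv C (flow (t, x)) = F (chart_inv c x)"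
    using flow_rest[OF x(2)] chart_inv_chart[OF chC V_simps(3)[OF x(1)]] by (simp add: local_rep_def)
  have "gf.Gram (t, x) = gram (induced_metric \<B> G F c (chart_inv c x))"
    unfolding gf.Gram_def gf.E_def q P[symmetric]
    using induced_metric_eq[OF F c V_simps(2)[OF x(1)] C V_simps(3)[OF x(1)]] by (simp add: gram_def)
  then show "0 < gf.Gram (t, x)"
    using plane_form.gram_pos[OF induced_plane_form[OF F c V_simps(2)[OF x(1)]]] by simp
qed

text \<open>The initial surface satisfies both open conditions. On the compact support of \<open>\<nu>\<close> they persist for a
  short time, and outside of the support the map is at rest.\<close>

lemma time_bound: "\<exists>\<delta>>0. \<forall>t x. \<bar>t\<bar> < \<delta> \<longrightarrow> x \<in> V \<longrightarrow> (t, x) \<in> good \<and> 0 < gf.Gram (t, x)"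
proof -
  let ?O = "good \<inter> gf.Gram -` {0<..}"
  have o: "open ?O"
    by (rule continuous_open_preimage[OF smooth_on_continuous[OF gf.smooth_Gram] open_good open_greaterThan])
  have k: "compact ((\<lambda>x. (0::real, x)) ` K)"
    by (intro compact_continuous_image K(1) continuous_intros)
  have s: "(\<lambda>x. (0::real, x)) ` K \<subseteq> ?O" using rest_good K(2) by auto
  obtain \<delta> where d: "\<delta> > 0" "(\<Union>z\<in>(\<lambda>x. (0::real, x)) ` K. ball z \<delta>) \<subseteq> ?O"
    by (rule compact_subset_open_imp_ball_epsilon_subset[OF k o s])
  have "(t, x) \<in> good \<and> 0 < gf.Gram (t, x)" if t: "\<bar>t\<bar> < \<delta>" and x: "x \<in> V" for t x
  proof (cases "x \<in> K")
    case True
    then have "(t, x) \<in> (\<Union>z\<in>(\<lambda>x. (0::real, x)) ` K. ball z \<delta>)"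
      using t by (auto simp: dist_Pair_Pair intro!: bexI[of _ x])
    then show ?thesis using d(2) by blast
  next
    case False
    then show ?thesis using rest_good[OF x] by blast
  qed
  then show ?thesis using d(1) by blast
qed

definition \<delta> :: real where
  "\<delta> = (SOME \<delta>. 0 < \<delta> \<and> (\<forall>t x. \<bar>t\<bar> < \<delta> \<longrightarrow> x \<in> V \<longrightarrow> (t, x) \<in> good \<and> 0 < gf.Gram (t, x)))"

lemma delta: "0 < \<delta>" "t \<in> {-\<delta><..<\<delta>} \<Longrightarrow> x \<in> V \<Longrightarrow> (t, x) \<in> good"
  "t \<in> {-\<delta><..<\<delta>} \<Longrightarrow> x \<in> V \<Longrightarrow> 0 < gf.Gram (t, x)"
proof -
  have *: "0 < \<delta> \<and> (\<forall>t x. \<bar>t\<bar> < \<delta> \<longrightarrow> x \<in> V \<longrightarrow> (t, x) \<in> good \<and> 0 < gf.Gram (t, x))"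
    unfolding \<delta>_def by (rule someI_ex) (rule time_bound)
  show "0 < \<delta>" using * by simp
  show "(t, x) \<in> good" "0 < gf.Gram (t, x)" if "t \<in> {-\<delta><..<\<delta>}" "x \<in> V" for t x
  proof -
    have "\<bar>t\<bar> < \<delta>" using that(1) by (simp add: abs_less_iff)
    then show "(t, x) \<in> good" "0 < gf.Gram (t, x)" using * that(2) by simp_all
  qed
qed

text \<open>The surface is covered by the open set \<open>U\<close>, where the family is given by the coordinate formula, and the open
  set \<open>Z\<close>, where it is at rest. All properties of the family are local and are verified separately on the
  two sets.\<close>

definition U :: "'s set" where
  "U = chart_dom c \<inter> F -` chart_dom C"

definition Z :: "'s set" where
  "Z = - chart_inv c ` K"

definition \<Phi> :: "real \<Rightarrow> 's \<Rightarrow> 'm" where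
  "\<Phi> t p = (if p \<in> U then chart_inv C (flow (t, chart_map c p)) else F p)"

lemma open_U: "open U"
proof -
  have "open (F -` chart_dom C)"
    using continuous_on_open_vimage[OF open_UNIV, of F] immersion_continuous[OF F] open_chart_dom[OF chC] by simp
  then show ?thesis unfolding U_def using open_chart_dom[OF chc] by blast
qed

lemma open_Z: "open Z"
proof -
  have "K \<subseteq> chart_img c" using K(2) V_eq by blast
  then have "compact (chart_inv c ` K)"
    by (intro compact_continuous_image continuous_on_subset[OF continuous_chart_inv[OF chc]] K(1))
  then show ?thesis by (simp add: Z_def compact_imp_closed open_Compl)
qed

lemma U_V: "p \<in> U \<Longrightarrow> chart_map c p \<in> V" and U_dom: "p \<in> U \<Longrightarrow> p \<in> chart_dom c" "p \<in> U \<Longrightarrow> F p \<in> chart_dom C"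
  by (auto simp: U_def rep_dom_def)

lemma U_or_Z: "p \<in> U \<or> p \<in> Z"
proof (cases "p \<in> Z")
  case False
  then obtain x where x: "x \<in> K" "p = chart_inv c x" by (auto simp: Z_def)
  then show ?thesis using V_simps[OF subsetD[OF K(2) x(1)]] by (simp add: U_def)
qed simp

lemma chart_not_K: "p \<in> Z \<Longrightarrow> p \<in> U \<Longrightarrow> chart_map c p \<notin> K"
  using chart_inv_chart[OF chc U_dom(1)] unfolding Z_def by (metis ComplD imageI)

lemma Phi_Z: "p \<in> Z \<Longrightarrow> \<Phi> t p = F p"
  using flow_rest[of t "chart_map c p"] chart_not_K chart_inv_chart[OF chC U_dom(2)]
  by (auto simp: \<Phi>_def local_rep_apply[OF chc U_dom(1)])

lemma Phi_0: "\<Phi> 0 = F"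
proof
  show "\<Phi> 0 p = F p" for p
    using flow_rest[of 0 "chart_map c p"] chart_inv_chart[OF chC U_dom(2)]
    by (simp add: \<Phi>_def local_rep_apply[OF chc U_dom(1)])
qed

lemma Phi_U:
  assumes "t \<in> {-\<delta><..<\<delta>}" "p \<in> U"
  shows "\<Phi> t p \<in> chart_dom C" "chart_map C (\<Phi> t p) = flow (t, chart_map c p)" "(t, chart_map c p) \<in> good"
proof -
  show g: "(t, chart_map c p) \<in> good" by (rule delta(2)[OF assms(1) U_V[OF assms(2)]])
  then have "flow (t, chart_map c p) \<in> chart_img C" by (simp add: good_def)
  then show "\<Phi> t p \<in> chart_dom C" "chart_map C (\<Phi> t p) = flow (t, chart_map c p)"
    using assms(2) chart_inv_in[OF chC] chart_chart_inv[OF chC] by (simp_all add: \<Phi>_def)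
qed

lemma continuous_Phi: "continuous_on ({-\<delta><..<\<delta>} \<times> UNIV) (\<lambda>(t, p). \<Phi> t p)"
proof (rule continuous_on_local)
  fix z assume "z \<in> {-\<delta><..<\<delta>} \<times> (UNIV :: 's set)"
  then obtain t p where z: "z = (t, p)" "t \<in> {-\<delta><..<\<delta>}" by auto
  show "\<exists>T. open T \<and> z \<in> T \<and> continuous_on T (\<lambda>(t, p). \<Phi> t p)"
  proof (cases "p \<in> U")
    case True
    let ?T = "{-\<delta><..<\<delta>} \<times> U"
    have g: "(fst z, chart_map c (snd z)) \<in> good" if "z \<in> ?T" for z using Phi_U(3)[of "fst z" "snd z"] that by auto
    have "continuous_on ?T (\<lambda>z. flow (fst z, chart_map c (snd z)))"
      by (rule continuous_on_compose2[OF smooth_on_continuous[OF gf.smooth_phi]])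
         (use g U_dom(1) in \<open>auto intro!: continuous_intros continuous_on_compose2[OF continuous_chart_map[OF chc]]\<close>)
    moreover have "flow (fst z, chart_map c (snd z)) \<in> chart_img C" if "z \<in> ?T" for z using g[OF that] by (simp add: good_def)
    ultimately have "continuous_on ?T (\<lambda>z. chart_inv C (flow (fst z, chart_map c (snd z))))"
      by (intro continuous_on_compose2[OF continuous_chart_inv[OF chC]]) auto
    then have "continuous_on ?T (\<lambda>(t, p). \<Phi> t p)"
      by (rule continuous_on_eq) (auto simp: \<Phi>_def)
    moreover have "open ?T" by (intro open_Times open_U) simp
    ultimately show ?thesis using z True by blast
  next
    case False
    then have "p \<in> Z" using U_or_Z by blast
    have "continuous_on (UNIV \<times> Z) (\<lambda>z::real \<times> 's. F (snd z))"
      by (rule continuous_on_compose2[OF immersion_continuous[OF F]]) (auto intro!: continuous_intros)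
    then have "continuous_on (UNIV \<times> Z) (\<lambda>(t::real, p). \<Phi> t p)"
      by (rule continuous_on_eq) (auto simp: Phi_Z)
    moreover have "open (UNIV \<times> Z :: (real \<times> 's) set)" by (intro open_Times open_Z open_UNIV)
    ultimately show ?thesis using z \<open>p \<in> Z\<close> by blast
  qed
qed

lemma smooth_Phi:
  assumes d: "d \<in> \<A>" and D: "D \<in> \<B>"
  defines "S \<equiv> {(t, x). t \<in> {-\<delta><..<\<delta>} \<and> x \<in> chart_img d \<and> \<Phi> t (chart_inv d x) \<in> chart_dom D}"
  shows "smooth_on (\<lambda>(t, x). local_rep d D (\<Phi> t) x) S"
proof (rule smooth_on_local)
  note chd = chart_A[OF d] and chD = chart_B[OF D]
  have oS: "open S" unfolding S_def by (rule open_family_domain[OF continuous_Phi d D])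
  fix z assume "z \<in> S"
  then obtain t x where z: "z = (t, x)" "(t, x) \<in> S" by (cases z) auto
  show "\<exists>T. open T \<and> z \<in> T \<and> smooth_on (\<lambda>(t, x). local_rep d D (\<Phi> t) x) T"
  proof (cases "chart_inv d x \<in> U")
    case True
    let ?X = "{x \<in> chart_img d. chart_inv d x \<in> U}"
    let ?T = "S \<inter> (UNIV \<times> ?X)"
    have oX: "open ?X" by (rule open_chart_vimage[OF chd open_U])
    have oT: "open ?T" by (intro open_Int oS open_Times oX open_UNIV)
    have X: "chart_inv d x \<in> chart_dom d" "chart_inv d x \<in> chart_dom c" "transition d c x = chart_map c (chart_inv d x)"
      "x \<in> overlap d c" if "x \<in> ?X" for x
      using that chart_inv_in[OF chd] U_dom(1) by (auto simp: transition_def overlap_eq[OF chd])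
    have s1: "smooth_on (\<lambda>z. transition d c (snd z)) ?T"
      by (rule smooth_on_compose[OF oT open_overlap[OF chd chc] _ transition_smooth[OF atlas_A d c] smooth_on_snd])
         (use X(4) in auto)
    have s2: "smooth_on (\<lambda>z. flow (fst z, transition d c (snd z))) ?T"
      by (rule smooth_on_compose[OF oT open_good _ gf.smooth_phi smooth_on_Pair[OF oT smooth_on_fst s1]])
         (use X(3) Phi_U(3) in \<open>auto simp: S_def\<close>)
    have s3: "smooth_on (\<lambda>z. transition C D (flow (fst z, transition d c (snd z)))) ?T"
    proof (rule smooth_on_compose[OF oT open_overlap[OF chC chD] _ transition_smooth[OF atlas_B C D] s2])
      show "(\<lambda>z. flow (fst z, transition d c (snd z))) ` ?T \<subseteq> overlap C D"
      proof (rule image_subsetI)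
        fix z assume z: "z \<in> ?T"
        let ?q = "chart_inv d (snd z)"
        have q: "fst z \<in> {-\<delta><..<\<delta>}" "?q \<in> U" "\<Phi> (fst z) ?q \<in> chart_dom D" "snd z \<in> ?X"
          using z by (auto simp: S_def)
        show "flow (fst z, transition d c (snd z)) \<in> overlap C D"
          unfolding X(3)[OF q(4)] Phi_U(2)[OF q(1,2), symmetric] overlap_def
          using Phi_U(1)[OF q(1,2)] q(3) by blast
      qed
    qed
    have "smooth_on (\<lambda>(t, x). local_rep d D (\<Phi> t) x) ?T"
    proof (rule smooth_on_eq[OF s3 oT])
      fix z assume z: "z \<in> ?T"
      let ?q = "chart_inv d (snd z)"
      have q: "fst z \<in> {-\<delta><..<\<delta>}" "?q \<in> U" "snd z \<in> ?X"
        using z by (auto simp: S_def)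
      show "transition C D (flow (fst z, transition d c (snd z))) = (case z of (t, x) \<Rightarrow> local_rep d D (\<Phi> t) x)"
        unfolding X(3)[OF q(3)] Phi_U(2)[OF q(1,2), symmetric] transition_apply[OF chC Phi_U(1)[OF q(1,2)]]
        by (simp add: local_rep_def split_beta)
    qed
    moreover have "z \<in> ?T" using z True by (auto simp: S_def)
    ultimately show ?thesis using oT by blast
  next
    case False
    then have Zx: "chart_inv d x \<in> Z" using U_or_Z by blast
    let ?X = "{x \<in> chart_img d. chart_inv d x \<in> Z}"
    let ?T = "S \<inter> (UNIV \<times> ?X)"
    have oX: "open ?X" by (rule open_chart_vimage[OF chd open_Z])
    have oT: "open ?T" by (intro open_Int oS open_Times oX open_UNIV)
    have "smooth_on (\<lambda>z. local_rep d D F (snd z)) ?T"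
    proof (rule smooth_on_compose[OF oT immersion_rep_open[OF F d D] _ immersion_smooth[OF F d D] smooth_on_snd])
      show "snd ` ?T \<subseteq> rep_dom d D F" by (auto simp: S_def rep_dom_eq[OF chd] Phi_Z)
    qed
    then have "smooth_on (\<lambda>(t, x). local_rep d D (\<Phi> t) x) ?T"
      by (rule smooth_on_eq[OF _ oT]) (auto simp: local_rep_def Phi_Z)
    moreover have "z \<in> ?T" using z Zx by (auto simp: S_def)
    ultimately show ?thesis using oT by blast
  qed
qed

lemma immersion_Phi:
  assumes t: "t \<in> {-\<delta><..<\<delta>}"
  shows "immersion \<A> \<B> (\<Phi> t)"
proof -
  have ct: "continuous_on UNIV (\<Phi> t)"
  proof -
    have "continuous_on UNIV (\<lambda>p. (\<lambda>(t, p). \<Phi> t p) (t, p))"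
      by (rule continuous_on_compose2[OF continuous_Phi]) (use t in \<open>auto intro!: continuous_intros\<close>)
    then show ?thesis by simp
  qed
  show ?thesis
    unfolding immersion_def
  proof (intro conjI ballI ct)
    fix d D assume d: "d \<in> \<A>" and D: "D \<in> \<B>"
    note chd = chart_A[OF d] and chD = chart_B[OF D]
    have o: "open (rep_dom d D (\<Phi> t))" by (rule open_rep_dom[OF chd chD ct])
    have "smooth_on (\<lambda>x. (\<lambda>(t, x). local_rep d D (\<Phi> t) x) (t, x)) (rep_dom d D (\<Phi> t))"
      by (rule smooth_on_compose[OF o open_family_domain[OF continuous_Phi d D] _ smooth_Phi[OF d D] smooth_on_Pair_left])
         (use t in \<open>auto simp: rep_dom_eq[OF chd]\<close>)
    then show "smooth_on (local_rep d D (\<Phi> t)) (chart_map d ` (chart_dom d \<inter> \<Phi> t -` chart_dom D))"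
      by (simp add: rep_dom_def)
    fix p assume "p \<in> chart_dom d \<inter> \<Phi> t -` chart_dom D"
    then have p: "p \<in> chart_dom d" "\<Phi> t p \<in> chart_dom D" by auto
    show "inj (dmap d D (\<Phi> t) p)"
    proof (cases "p \<in> U")
      case True
      let ?x = "chart_map c p"
      have dc: "(local_rep c C (\<Phi> t) has_derivative (\<lambda>a. gf.P a (t, ?x))) (at ?x)"
      proof (rule has_derivative_transform_within_open[OF flow_slice_derivative[OF Phi_U(3)[OF t True]] open_V U_V[OF True]])
        fix x assume x: "x \<in> V"
        have "chart_inv c x \<in> U" using V_simps[OF x] by (simp add: U_def)
        then show "flow (t, x) = local_rep c C (\<Phi> t) x"
          using Phi_U(2)[OF t] V_simps(4)[OF x] by (simp add: local_rep_def)
      qed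
      note dm = local_rep_change[OF ct c d U_dom(1)[OF True] p(1) C D Phi_U(1)[OF t True] p(2) dc]
      have "dmap d D (\<Phi> t) p = (\<lambda>u. dtrans C D (\<Phi> t p) (gf.P (dtrans d c p u) (t, ?x)))"
        unfolding dmap_def by (rule ext) (rule frechet_derivative_eq[OF dm])
      moreover have "inj (\<lambda>a. gf.P a (t, ?x))"
        by (rule gf.Gram_pos_imp_inj[OF Phi_U(3)[OF t True] delta(3)[OF t U_V[OF True]]])
      ultimately show ?thesis
        using inj_dtrans[OF atlas_B C D Phi_U(1)[OF t True] p(2)] inj_dtrans[OF atlas_A d c p(1) U_dom(1)[OF True]]
        by (simp add: inj_def)
    next
      case False
      then have pZ: "p \<in> Z" using U_or_Z by blast
      let ?X = "{x \<in> chart_img d. chart_inv d x \<in> Z}"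
      have oX: "open ?X" by (rule open_chart_vimage[OF chd open_Z])
      have x: "chart_map d p \<in> ?X" using pZ chart_map_in[OF chd p(1)] chart_inv_chart[OF chd p(1)] by simp
      have "dmap d D (\<Phi> t) p = dmap d D F p"
        unfolding dmap_def
        by (rule frechet_derivative_cong_open[OF oX x]) (simp add: local_rep_def Phi_Z)
      then show ?thesis using dmap_inj[OF F d D p(1)] p(2) Phi_Z[OF pZ] by simp
    qed
  qed
qed

lemma immersed_family_Phi: "immersed_family \<A> \<B> G \<Phi> \<delta>"
  by unfold_locales (use delta(1) continuous_Phi smooth_Phi immersion_Phi in auto)

lemma Phi_velocity_U:
  assumes "p \<in> U"
  shows "vector_derivative (\<lambda>t. chart_map C (\<Phi> t p)) (at 0) = \<nu> (chart_map c p)"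
proof (rule vector_derivative_at)
  have "((\<lambda>t. flow (t, chart_map c p)) has_vector_derivative \<nu> (chart_map c p)) (at 0)"
    unfolding flow_def by (auto intro!: derivative_eq_intros simp: has_vector_derivative_def)
  then show "((\<lambda>t. chart_map C (\<Phi> t p)) has_vector_derivative \<nu> (chart_map c p)) (at 0)"
    unfolding has_vector_derivative_def
    by (rule has_derivative_transform_within_open[of _ _ _ _ "{-\<delta><..<\<delta>}"])
       (use delta(1) Phi_U(2)[OF _ assms] in auto)
qed

lemma Phi_velocity_Z: "p \<in> Z \<Longrightarrow> vector_derivative (\<lambda>t. chart_map D (\<Phi> t p)) (at 0) = 0"
  by (simp add: Phi_Z)

lemma symplectic_Phi:
  assumes "\<And>p. 0 < kcosine F p"
  shows "symplectic_variation \<A> \<B> G \<Phi> \<delta>"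
  by (intro symplectic_variation.intro immersed_family_Phi symplectic_variation_axioms.intro) (simp add: Phi_0 assms)

lemma normal_Phi:
  assumes pos: "\<And>p. 0 < kcosine F p" and d: "d \<in> \<A>" "D \<in> \<B>" "p \<in> chart_dom d" "F p \<in> chart_dom D"
  shows "normal_vec G d D F p (vector_derivative (\<lambda>t. chart_map D (\<Phi> t p)) (at 0))"
proof (cases "p \<in> U")
  case True
  interpret sv: symplectic_variation \<A> \<B> G \<Phi> \<delta> undefined by (rule symplectic_Phi[OF pos])
  have e: "vector_derivative (\<lambda>t. chart_map D (\<Phi> t p)) (at 0) = dtrans C D (F p) (\<nu> (chart_map c p))"
    using sv.xi_change[OF C d(2), of p] U_dom(2)[OF True] d(4) unfolding sv.xi_def Phi_velocity_U[OF True] Phi_0 by simp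
  have "normal_vec G c C F p (\<nu> (chart_map c p))"
    using normal_nu[OF U_V[OF True]] chart_inv_chart[OF chc U_dom(1)[OF True]] by simp
  then show ?thesis
    unfolding e by (rule normal_vec_change[OF F c d(1) U_dom(1)[OF True] d(3) C d(2) U_dom(2)[OF True] d(4)])
next
  case False
  then have "p \<in> Z" using U_or_Z by blast
  then show ?thesis
    unfolding normal_vec_def Phi_velocity_Z[OF \<open>p \<in> Z\<close>]
    by (simp add: inner_form.zero_left[OF metric_inner_form[OF d(2,4)]])
qed

lemma normal_variation_Phi:
  assumes pos: "\<And>p. 0 < kcosine F p"
  shows "normal_variation \<A> \<B> G F \<Phi>"
  unfolding normal_variation_def
proof (intro conjI Phi_0 exI[of _ \<delta>] delta(1) continuous_Phi ballI smooth_Phi immersion_Phi)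
  show "normal_vec G d D F p (vector_derivative (\<lambda>t. chart_map D (\<Phi> t p)) (at 0))"
    if "d \<in> \<A>" "D \<in> \<B>" "p \<in> chart_dom d \<inter> F -` chart_dom D" for d D p
    using normal_Phi[OF pos that(1,2), of p] that(3) by simp
qed

end

section \<open>The Euler-Lagrange equation\<close>

lemma integral_pos:
  fixes R :: "real^2 \<Rightarrow> real"
  assumes R: "continuous_on UNIV R" "\<And>x. 0 \<le> R x" and K: "compact K" "\<And>x. x \<notin> K \<Longrightarrow> R x = 0" and x0: "0 < R x0"
  shows "integrable lborel R" "0 < integral\<^sup>L lborel R"
proof -
  have "integrable lborel (\<lambda>x. indicator K x *\<^sub>R R x)"
    by (rule borel_integrable_compact[OF K(1) continuous_on_subset[OF R(1)]]) simp
  also have "(\<lambda>x. indicator K x *\<^sub>R R x) = R"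
  proof (rule ext)
    show "indicator K x *\<^sub>R R x = R x" for x by (cases "x \<in> K") (simp_all add: K(2))
  qed
  finally show int: "integrable lborel R" .
  have "isCont R x0" using R(1) by (simp add: continuous_on_eq_continuous_at)
  then obtain s where s: "0 < s" "\<And>x. dist x x0 < s \<Longrightarrow> dist (R x) (R x0) < R x0 / 2"
    unfolding continuous_at_eps_delta using x0 by (metis half_gt_zero)
  let ?b = "ball x0 s"
  have fin: "emeasure lborel ?b < \<infinity>" by (rule emeasure_lborel_ball_finite)
  have "0 < measure lborel ?b * (R x0 / 2)"
    using content_ball_pos[OF s(1), of x0] x0 by simp
  also have "\<dots> = (\<integral>x. indicator ?b x * (R x0 / 2) \<partial>lborel)" by simp
  also have "\<dots> \<le> integral\<^sup>L lborel R"
  proof (rule integral_mono[OF _ int])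
    show "integrable lborel (\<lambda>x. indicator ?b x * (R x0 / 2))"
      using fin by (intro integrable_mult_left integrable_real_indicator) auto
    show "indicator ?b x * (R x0 / 2) \<le> R x" for x
    proof (cases "x \<in> ?b")
      case True
      then have "dist (R x) (R x0) < R x0 / 2" by (intro s(2)) (simp add: dist_commute)
      then have "\<bar>R x - R x0\<bar> < R x0 / 2" unfolding dist_real_def .
      then have "R x0 / 2 \<le> R x" using abs_ge_minus_self[of "R x - R x0"] by linarith
      then show ?thesis using True by simp
    qed (simp add: R(2))
  qed
  finally show "0 < integral\<^sup>L lborel R" .
qed

context local_normal_variation
begin

text \<open>The support of the exact term lies in the chart, where its integral vanishes as a sum of integrals of
  partial derivatives; so a comparison of Euler-Lagrange expressions between charts is avoided.\<close>

lemma derivative_of_local_variation: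
  assumes pos: "\<And>p. 0 < kcosine F p" and closed: "closed_along F"
    and q: "\<And>x. x \<in> V \<Longrightarrow> R x = kcosine F (chart_inv c x) powr (- \<beta> - 3)
      * (adens F c (chart_inv c x) * G C (F (chart_inv c x)) (EL_vector \<beta> F c C (chart_inv c x)) (\<nu> x))"
    and R0: "\<And>x. x \<notin> V \<Longrightarrow> R x = 0" and R: "integrable lborel R"
  shows "((\<lambda>t. L_functional \<A> \<B> G \<beta> (\<Phi> t)) has_real_derivative - (\<beta> + 1) * integral\<^sup>L lborel R) (at 0)"
proof -
  interpret sv: symplectic_variation \<A> \<B> G \<Phi> \<delta> \<beta> by (rule symplectic_Phi[OF pos])
  have normal: "normal_vec G d D (\<Phi> 0) p (sv.xi D p)"
    if "d \<in> \<A>" "D \<in> \<B>" "p \<in> chart_dom d" "\<Phi> 0 p \<in> chart_dom D" for d D p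
    using normal_Phi[OF pos that(1-3)] that(4) unfolding sv.xi_def Phi_0 .
  have closed': "closed_along (\<Phi> 0)" using closed by (simp add: Phi_0)
  have fv: "sv.dpsi 0 (chart_inv d x) * adens (\<Phi> 0) d (chart_inv d x)
    = frechet_derivative (sv.th d ey) (at x) ex - frechet_derivative (sv.th d ex) (at x) ey
      - (\<beta> + 1) * kcosine (\<Phi> 0) (chart_inv d x) powr (- \<beta> - 3)
        * symplectic_family.EL_component (sv.metric_in D) (sv.fam_rep d D) \<beta> (0, x) (sv.xi D (chart_inv d x))"
    if z: "d \<in> \<A>" "D \<in> \<B>" "(0, x) \<in> sv.fam_pos d D" for d D x
    by (rule sv.first_variation_chart[OF _ closed' z]) (rule normal)
  have xi_Z: "sv.xi D p = 0" if "p \<in> Z" for D p unfolding sv.xi_def by (rule Phi_velocity_Z[OF that])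
  have th_Z: "sv.th d u x = 0" if "d \<in> \<A>" "chart_inv d x \<in> Z" for d u x
  proof -
    note ca = chart_at[OF atlas_B, of "F (chart_inv d x)"]
    show ?thesis
      unfolding sv.th_def Let_def Phi_0 xi_Z[OF that(2)]
      using bilinear_lzero[OF kahler_form_bilinear[OF ca]] by simp
  qed
  have dpsi_Z: "sv.dpsi 0 p = 0" if p: "p \<in> Z" for p
  proof -
    let ?d = "chart_at \<A> p" and ?D = "chart_at \<B> (\<Phi> 0 p)"
    note d = chart_at[OF atlas_A, of p] and D = chart_at[OF atlas_B, of "\<Phi> 0 p"]
    note chd = chart_A[OF d(1)]
    let ?X = "{x \<in> chart_img ?d. chart_inv ?d x \<in> Z}"
    have oX: "open ?X" by (rule open_chart_vimage[OF chd open_Z])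
    have inv: "chart_inv ?d (chart_map ?d p) = p" by (rule chart_inv_chart[OF chd d(2)])
    have x: "chart_map ?d p \<in> ?X" using p chart_map_in[OF chd d(2)] inv by simp
    note z = sv.in_fam_pos0[OF d(1) D(1) d(2) D(2)]
    interpret sf: symplectic_family "chart_img ?D" "sv.metric_in ?D" "sv.fam_pos ?d ?D" "sv.fam_rep ?d ?D" \<beta>
      by (rule sv.symplectic_in_charts[OF d(1) D(1)])
    have dth: "frechet_derivative (sv.th ?d u) (at (chart_map ?d p)) v = 0" for u v
      using frechet_derivative_cong_open[OF oX x, of "sv.th ?d u" "\<lambda>_. 0"] th_Z[OF d(1)] by simp
    have "sf.EL_component (0, chart_map ?d p) 0 = 0"
      using sf.EL_component_scale[OF z, of 0 0] by simp
    then have "sv.dpsi 0 p * adens (\<Phi> 0) ?d p = 0"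
      using fv[OF d(1) D(1) z] unfolding inv dth xi_Z[OF p] by simp
    then show ?thesis using area_density_pos[OF sv.imm0 d] by simp
  qed
  have off: "sv.dpsi 0 p = 0" if "p \<notin> chart_dom c" for p
    using that U_or_Z[of p] U_dom(1)[of p] dpsi_Z[of p] by blast
  define H where "H u x = (if x \<in> V then sv.th c u x else 0)" for u x
  have V_img: "V \<subseteq> chart_img c" using V_simps(1) by blast
  have V_U: "chart_inv c x \<in> U" if "x \<in> V" for x using V_simps[OF that] by (simp add: U_def)
  have th0: "sv.th c u x = 0" if x: "x \<in> V" "x \<notin> K" for u x
  proof -
    have "sv.xi C (chart_inv c x) = 0"
      unfolding sv.xi_def Phi_velocity_U[OF V_U[OF x(1)]] V_simps(4)[OF x(1)] by (rule support_nu[OF x(2)])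
    then show ?thesis
      using sv.th_eq[OF c C V_simps(1)[OF x(1)]] V_simps(3)[OF x(1)]
        bilinear_lzero[OF kahler_form_bilinear[OF C V_simps(3)[OF x(1)]]] by (simp add: Phi_0)
  qed
  have sH: "smooth_on (H u) UNIV" for u
    unfolding H_def
    by (rule extend_by_zero_smooth[OF open_V K smooth_on_subset[OF sv.th_smooth[OF c] V_img] th0])
  have H0: "H u x = 0" if "x \<notin> K" for u x using th0 that by (simp add: H_def)
  have oK: "open (- K)" using compact_imp_closed[OF K(1)] by (simp add: open_Compl)
  have dH_in: "frechet_derivative (H u) (at x) = frechet_derivative (sv.th c u) (at x)" if "x \<in> V" for u x
    by (rule frechet_derivative_cong_open[OF open_V that]) (simp add: H_def)
  have dH_out: "frechet_derivative (H u) (at x) v = 0" if "x \<notin> V" for u v x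
    using frechet_derivative_cong_open[OF oK, of x "H u" "\<lambda>_. 0"] contra_subsetD[OF K(2) that] H0 by simp
  have point: "indicator (chart_img c) x * (adens (\<Phi> 0) c (chart_inv c x) * sv.dpsi 0 (chart_inv c x))
    = (frechet_derivative (H ey) (at x) ex - frechet_derivative (H ex) (at x) ey) - (\<beta> + 1) * R x" for x
  proof (cases "x \<in> V")
    case True
    note Vx = V_simps[OF True]
    have z: "(0, x) \<in> sv.fam_pos c C" using sv.in_slice[OF c C Vx(1)] Vx(3) by (simp add: Phi_0)
    have xi: "sv.xi C (chart_inv c x) = \<nu> x"
      unfolding sv.xi_def Phi_velocity_U[OF V_U[OF True]] Vx(4) ..
    show ?thesis
      using fv[OF c C z] sv.EL_component_eq[OF c C z, of "\<nu> x"] normal_nu[OF True] Vx(1)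
      unfolding xi Phi_0 dH_in[OF True] q[OF True] by (simp add: mult.commute)
  next
    case False
    have "sv.dpsi 0 (chart_inv c x) = 0" if "x \<in> chart_img c"
    proof (rule dpsi_Z)
      show "chart_inv c x \<in> Z"
        using U_or_Z[of "chart_inv c x"] U_V[of "chart_inv c x"] False chart_chart_inv[OF chc that] by auto
    qed
    then show ?thesis using False by (cases "x \<in> chart_img c") (simp_all add: dH_out R0)
  qed
  have "(\<integral>p. sv.dpsi 0 p \<partial>sv.mu0)
    = (\<integral>x. indicator (chart_img c) x * (adens (\<Phi> 0) c (chart_inv c x) * sv.dpsi 0 (chart_inv c x)) \<partial>lborel)"
    by (rule sv.area0.integral_area_chart[OF sv.mu0 c borel_measurable_continuous_onI[OF sv.continuous_dpsi0] off])
  also have "\<dots> = (\<integral>x. (frechet_derivative (H ey) (at x) ex - frechet_derivative (H ex) (at x) ey) - (\<beta> + 1) * R x \<partial>lborel)"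
    unfolding point ..
  also have "\<dots> = - (\<beta> + 1) * integral\<^sup>L lborel R"
    using integral_derivative_zero[OF sH K(1) H0] R by (simp add: algebra_simps)
  finally show ?thesis using sv.L_functional_derivative by simp
qed

end

context surface_in_hermite
begin

text \<open>If the Euler-Lagrange expression does not vanish at a point, its value there is extended to a
  normal field by projecting a constant vector. Its pairing with the Euler-Lagrange expression is positive near the point, and the
  field is cut off outside of this neighbourhood.\<close>

lemma critical_imp_EL:
  assumes F: "immersion \<A> \<B> F" and pos: "\<And>p. 0 < kcosine F p" and closed: "closed_along F"
    and \<beta>: "\<beta> \<noteq> -1" and crit: "L_critical \<A> \<B> G \<beta> F"
    and c: "c \<in> \<A>" and C: "C \<in> \<B>" and p: "p \<in> chart_dom c" "F p \<in> chart_dom C"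
  shows "EL_vector \<beta> F c C p = 0"
proof (rule ccontr)
  define w where "w = EL_vector \<beta> F c C p"
  assume "EL_vector \<beta> F c C p \<noteq> 0"
  then have w0: "w \<noteq> 0" by (simp add: w_def)
  note chc = chart_A[OF c]
  interpret st: symplectic_variation \<A> \<B> G "\<lambda>_. F" 1 \<beta>
    by (intro symplectic_variation.intro constant_family[OF F] symplectic_variation_axioms.intro) (rule pos)
  interpret sf: symplectic_family "chart_img C" "st.metric_in C" "st.fam_pos c C" "st.fam_rep c C" \<beta>
    by (rule st.symplectic_in_charts[OF c C])
  define V where "V = rep_dom c C F"
  have oV: "open V" unfolding V_def by (rule immersion_rep_open[OF F c C])
  have V: "x \<in> chart_img c" "F (chart_inv c x) \<in> chart_dom C" "(0, x) \<in> st.fam_pos c C" if "x \<in> V" for x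
  proof -
    show "x \<in> chart_img c" "F (chart_inv c x) \<in> chart_dom C" using that by (auto simp: V_def rep_dom_eq[OF chc])
    then show "(0, x) \<in> st.fam_pos c C" by (rule st.in_slice[OF c C])
  qed
  define x0 where "x0 = chart_map c p"
  have inv0: "chart_inv c x0 = p" unfolding x0_def by (rule chart_inv_chart[OF chc p(1)])
  have x0V: "x0 \<in> V" using p by (auto simp: V_def rep_dom_def x0_def)
  \<comment> \<open>The normal part of the constant field \<open>w\<close>; its value at \<open>x0\<close> is \<open>w\<close>, which is normal there.\<close>
  define n where "n z = w - sf.tangential z w" for z
  have sn: "smooth_on n (st.fam_pos c C)"
    unfolding n_def by (intro smooth_on_diff smooth_on_const sf.open_W sf.smooth_tangential sf.Gram_pos)
  have slice: "smooth_on (\<lambda>x. k (0, x)) V" if "smooth_on k (st.fam_pos c C)"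
    for k :: "real \<times> (real^2) \<Rightarrow> 'b::real_normed_vector"
    by (rule smooth_on_compose[OF oV sf.open_W _ that smooth_on_Pair_left]) (use V(3) in auto)
  have normal: "normal_vec G c C F (chart_inv c x) (n (0, x))" if x: "x \<in> V" for x
  proof -
    note z = V(3)[OF x]
    note zd = st.fam_pos_dom[OF c C z]
    show ?thesis
      unfolding normal_vec_def n_def
      using sf.tangential_orthogonal[OF z, of w] sf.Gram_pos[OF z] st.fam_P[OF c C zd] st.fam_rep_point[OF c C zd] by simp
  qed
  have n0: "n (0, x0) = w"
  proof -
    note z = V(3)[OF x0V]
    note zd = st.fam_pos_dom[OF c C z]
    have "normal_vec G c C F p w" using st.EL_vector_normal[OF c C z] unfolding inv0 w_def .
    then have "sf.tangential (0, x0) w = 0"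
      unfolding sf.tangential_def normal_vec_def st.fam_P[OF c C zd] st.fam_rep_point[OF c C zd] inv0 by simp
    then show ?thesis by (simp add: n_def)
  qed
  define q where "q x = sf.EL_component (0, x) (n (0, x))" for x
  have q: "q x = adens F c (chart_inv c x) * G C (F (chart_inv c x)) (EL_vector \<beta> F c C (chart_inv c x)) (n (0, x))"
    if "x \<in> V" for x
    unfolding q_def by (rule st.EL_component_eq[OF c C V(3)[OF that] normal[OF that]])
  have sq: "smooth_on q V"
    unfolding q_def using slice[OF sf.smooth_EL_component[OF sn]] .
  have q0: "0 < q x0"
    unfolding q[OF x0V] inv0 n0 w_def[symmetric]
    using area_density_pos[OF F c p(1)] inner_form.pos[OF metric_inner_form[OF C p(2)] w0] by simp
  have "open {x \<in> V. 0 < q x}"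
    using continuous_open_preimage[OF smooth_on_continuous[OF sq] oV open_greaterThan, of 0]
    by (simp add: vimage_def Int_def conj_commute)
  then obtain r where r: "0 < r" "cball x0 r \<subseteq> {x \<in> V. 0 < q x}"
    using x0V q0 open_contains_cball by (metis (mono_tags, lifting) mem_Collect_eq)
  define cut where "cut x = flat 0 (r\<^sup>2 - (norm (x - x0))\<^sup>2)" for x :: "real^2"
  have chi: "smooth_on cut S" for S
    unfolding cut_def by (rule smooth_on_subset[OF smooth_norm_bump subset_UNIV])
  have chi0: "cut x = 0" if "x \<notin> cball x0 r" for x
  proof -
    have "r < norm (x - x0)" using that by (simp add: dist_norm norm_minus_commute)
    then have "r\<^sup>2 \<le> (norm (x - x0))\<^sup>2" using r(1) by (intro power_mono) auto
    then show ?thesis by (simp add: cut_def flat_eq_0_iff)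
  qed
  let ?K = "cball x0 r"
  have K: "compact ?K" "?K \<subseteq> V" using r(2) by auto
  define \<nu> where "\<nu> x = (if x \<in> V then cut x *\<^sub>R n (0, x) else 0)" for x
  interpret lv: local_normal_variation \<A> \<B> G F c C \<nu> ?K
  proof unfold_locales
    show "smooth_on \<nu> UNIV"
      unfolding \<nu>_def
      by (rule extend_by_zero_smooth[OF oV K smooth_on_scaleR[OF oV chi slice[OF sn]]]) (simp add: chi0)
    show "\<nu> x = 0" if "x \<notin> ?K" for x using chi0[OF that] by (simp add: \<nu>_def)
    show "normal_vec G c C F (chart_inv c x) (\<nu> x)" if "x \<in> rep_dom c C F" for x
    proof -
      have x: "x \<in> V" using that by (simp add: V_def)
      show ?thesis
        using normal[OF x] x unfolding normal_vec_def \<nu>_def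
        by (simp add: inner_form.scale_left[OF metric_inner_form[OF C V(2)[OF x]]])
    qed
  qed (use F c C K in \<open>auto simp: V_def\<close>)
  define R where "R x = (if x \<in> V then sf.kcos (0, x) powr (- \<beta> - 3) * (cut x * q x) else 0)" for x
  have sR: "smooth_on R UNIV"
    unfolding R_def
    by (rule extend_by_zero_smooth[OF oV K smooth_on_mult[OF oV slice[OF smooth_on_powr[OF sf.open_W sf.smooth_kcos sf.kcos_pos]]
          smooth_on_mult[OF oV chi sq]]]) (simp_all add: chi0 del: mem_cball)
  have R_nonneg: "0 \<le> R x" for x
  proof (cases "x \<in> ?K")
    case True
    then have "0 < q x" using r(2) by blast
    then show ?thesis by (simp add: R_def cut_def flat_nonneg)
  qed (simp add: R_def chi0)
  have R0: "R x = 0" if "x \<notin> ?K" for x using chi0[OF that] by (simp add: R_def)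
  have "0 < R x0"
    using x0V q0 r(1) sf.kcos_pos[OF V(3)[OF x0V]] by (simp add: R_def cut_def flat_pos_iff)
  note Rpos = integral_pos[OF smooth_on_continuous[OF sR] R_nonneg K(1) R0 this]
  have "((\<lambda>t. L_functional \<A> \<B> G \<beta> (lv.\<Phi> t)) has_real_derivative - (\<beta> + 1) * integral\<^sup>L lborel R) (at 0)"
  proof (rule lv.derivative_of_local_variation[OF pos closed])
    fix x assume "x \<in> rep_dom c C F"
    then have x: "x \<in> V" by (simp add: V_def)
    have k: "sf.kcos (0, x) = kcosine F (chart_inv c x)"
      by (rule st.fam_kcos[OF c C st.fam_pos_dom[OF c C V(3)[OF x]]])
    show "R x = kcosine F (chart_inv c x) powr (- \<beta> - 3)
      * (adens F c (chart_inv c x) * G C (F (chart_inv c x)) (EL_vector \<beta> F c C (chart_inv c x)) (\<nu> x))"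
      using x by (simp add: R_def \<nu>_def k q[OF x] inner_form.scale_right[OF metric_inner_form[OF C V(2)[OF x]]])
  next
    show "R x = 0" if "x \<notin> rep_dom c C F" for x using that by (simp add: R_def V_def)
  qed (rule Rpos(1))
  moreover have "((\<lambda>t. L_functional \<A> \<B> G \<beta> (lv.\<Phi> t)) has_real_derivative 0) (at 0)"
    using crit lv.normal_variation_Phi[OF pos] unfolding L_critical_def by blast
  ultimately have "- (\<beta> + 1) * integral\<^sup>L lborel R = 0" by (rule DERIV_unique)
  then show False using Rpos(2) \<beta> by simp
qed

end

theorem theorem1p1:
  fixes \<A> :: "('s::{t2_space, second_countable_topology}, real^2) chart set"
    and \<B> :: "('m::{t2_space, second_countable_topology}, complex^2) chart set"
    and G :: "('m, complex^2) metric_tensor"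
    and F :: "'s \<Rightarrow> 'm"
    and \<beta> :: real
  assumes "hermite_surface \<B> G"
    and "\<beta> \<noteq> -1"
    and "oriented_surface_atlas \<A>"
    and "compact (UNIV :: 's set)"
    and "immersion \<A> \<B> F"
    and "\<forall>p. cos (kahler_angle \<A> \<B> G F p) > 0"
    and "\<forall>c\<in>\<A>. \<forall>C\<in>\<B>. \<forall>p\<in>chart_dom c \<inter> F -` chart_dom C.
           \<forall>X\<in>range (dmap c C F p). \<forall>Y\<in>range (dmap c C F p). \<forall>\<xi>. normal_vec G c C F p \<xi> \<longrightarrow>
             G C (F p) (nabla_J G C (F p) \<xi> X) Y
           + G C (F p) (nabla_J G C (F p) X Y) \<xi>
           + G C (F p) (nabla_J G C (F p) Y \<xi>) X = 0"
  shows "L_critical \<A> \<B> G \<beta> F \<longleftrightarrow>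
    (\<forall>c\<in>\<A>. \<forall>C\<in>\<B>. \<forall>p\<in>chart_dom c \<inter> F -` chart_dom C.
       cos (kahler_angle \<A> \<B> G F p) ^ 3 *\<^sub>R mean_curvature G c C F p
       - \<beta> *\<^sub>R normal_proj G c C F p (cplx_str (tangent_proj G c C F p (cplx_str
           (dmap c C F p
             (gradient (induced_metric \<B> G F) c p (\<lambda>q. cos (kahler_angle \<A> \<B> G F q))))))) = 0)"
proof -
  interpret surface_in_hermite \<A> \<B> G by unfold_locales (fact assms)+
  have pos: "0 < kcosine F p" for p using assms(6) by blast
  have closed: "closed_along F" unfolding closed_along_def by (rule assms(7))
  show ?thesis
    unfolding EL_vector_def[symmetric]
  proof
    assume crit: "L_critical \<A> \<B> G \<beta> F"
    show "\<forall>c\<in>\<A>. \<forall>C\<in>\<B>. \<forall>p\<in>chart_dom c \<inter> F -` chart_dom C. EL_vector \<beta> F c C p = 0"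
      using critical_imp_EL[OF assms(5) pos closed assms(2) crit] by simp
  next
    assume "\<forall>c\<in>\<A>. \<forall>C\<in>\<B>. \<forall>p\<in>chart_dom c \<inter> F -` chart_dom C. EL_vector \<beta> F c C p = 0"
    then show "L_critical \<A> \<B> G \<beta> F" by (intro EL_imp_critical pos closed) simp
  qed
qed

end
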